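(* Let $\{\hat T,\hat P,\hat\Sigma\}$ be a reference finite element with $\hat T=[-1,1]^d$ such that, for an integer $l\ge0$, $\hat P\subset W^{l,\infty}(\hat T)$, and let $0\le m\le l$ ($m$ an integer). Let $\{\mathcal{T}_h\}_{h\in(0,1]}$ be a quasiuniform family of affine partitions of the fixed domain $\Omega$, with constants $\sigma_0$ and $C_{qu}$. Then: 1. For $1\le p,q\le\infty$ there exists a constant $C=C(l,m,p,q,d,\sigma_0,\hat T,\hat P,C_{qu})>0$ such that for all $h\in(0,1]$ and all $v\in W_h$ $$\Big(\sum_{T\in\mathcal{T}_h}\|v\|_{l,p,T}^p\Big)^{1/p}\le C\,h^{\,m-l+\min(0,\,d(\frac1p-\frac1q))}\Big(\sum_{T\in\mathcal{T}_h}\|v\|_{m,q,T}^q\Big)^{1/q}.$$ 2. For $1\le q\le p\le\infty$ and $\hat P=\mathbb{Q}_k(\hat T)$, $k\ge1$, there exists a constant $C=C(l,m,p,d,\sigma_0)>0$ such that for all $h\in(0,1]$ and all $v\in W_h$ $$\Big(\sum_{T\in\mathcal{T}_h}\|v\|_{l,p,T}^p\Big)^{1/p}\le C\Big(\frac{C_{qu}h}{k^2}\Big)^{m-l}\Big(\frac{C_{qu}h}{2(q+1)k^2}\Big)^{d(\frac1p-\frac1q)}\Big(\sum_{T\in\mathcal{T}_h}\|v\|_{m,q,T}^q\Big)^{1/q}.$$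
   Context: $\Omega\subset\mathbb{R}^d$ is a fixed bounded polyhedral Lipschitz domain (the constant in part 1 may depend on it). A partition $\mathcal{T}_h$ of $\Omega$ with maximal element diameter $h$ is affine if each closed element is $T=F_T(\hat T)$ with $F_T(\hat x)=J_T\hat x+b_T$, $J_T$ invertible. $h_T$ is the diameter of $T$, $\varrho_T$ the diameter of the largest ball contained in $T$. The family is locally quasiuniform if $h_T/\varrho_T\le\sigma_0$ for all $h$ and all $T\in\mathcal{T}_h$, and quasiuniform if, in addition, $h_T\ge C_{qu}h$ for all $h$ and all $T\in\mathcal{T}_h$ with a constant $C_{qu}>0$. $\hat P$ is a finite-dimensional function space on $\hat T$, $P_T=\{\hat v\circ F_T^{-1}:\hat v\in\hat P\}$, and $W_h=\{w\in L^2(\Omega): w|_T\in P_T\ \forall T\in\mathcal{T}_h\}$ (no interelement continuity). $\mathbb{Q}_k(\hat T)$ is the span of the monomials $\hat x^\alpha$ with $\|\alpha\|_{\ell^\infty}\le k$. $\|v\|_{l,p,G}=\big(\sum_{|\alpha|\le l}\|\partial^\alpha v\|_{L^p(G)}^p\big)^{1/p}$ for $p<\infty$ and $\|v\|_{l,\infty,G}=\max_{|\alpha|\le l}\|\partial^\alpha v\|_{L^\infty(G)}$. Conventions: $1/\infty=0$; for $p=\infty$ or $q=\infty$ the corresponding expression $(\sum_T\|\cdot\|^p)^{1/p}$ is replaced by the maximum over $T$; a factor with exponent $d(1/p-1/q)$ is $1$ if $p=q$. *)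

theory Defs
  imports
    "HOL-Analysis.Analysis"
    "HOL-Probability.Essential_Supremum"
    "HOL-Library.Function_Algebras"
begin

global_interpretation fun_space: vector_space "\<lambda>(c::real) (f::'a \<Rightarrow> real) x. c * f x"
  by unfold_locales (auto simp: fun_eq_iff algebra_simps)

definition linear_functional_on :: "('a \<Rightarrow> real) set \<Rightarrow> (('a \<Rightarrow> real) \<Rightarrow> real) \<Rightarrow> bool" where
  "linear_functional_on P N \<longleftrightarrow>
     (\<forall>u\<in>P. \<forall>v\<in>P. \<forall>a b. N (\<lambda>x. a * u x + b * v x) = a * N u + b * N v)"

definition pderiv1 :: "'n \<Rightarrow> (real^'n::finite \<Rightarrow> real) \<Rightarrow> (real^'n \<Rightarrow> real)" where
  "pderiv1 i f = (\<lambda>x. frechet_derivative f (at x) (axis i 1))"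

definition smooth_fun :: "(real^'n::finite \<Rightarrow> real) \<Rightarrow> bool" where
  "smooth_fun f \<longleftrightarrow> (\<forall>is x. foldr pderiv1 is f differentiable (at x))"

text \<open>
  A multi-index is a function \<open>\<alpha> :: 'n \<Rightarrow> nat\<close>. The operator below is only applied
  to smooth functions, for which the order of the partial derivatives is irrelevant; any
  list in which each direction \<open>i\<close> occurs exactly \<open>\<alpha> i\<close> times gives the same result.
\<close>

definition mdegree :: "('n::finite \<Rightarrow> nat) \<Rightarrow> nat" where
  "mdegree \<alpha> = (\<Sum>i\<in>UNIV. \<alpha> i)"

definition mpderiv :: "('n \<Rightarrow> nat) \<Rightarrow> (real^'n::finite \<Rightarrow> real) \<Rightarrow> (real^'n \<Rightarrow> real)" where
  "mpderiv \<alpha> f = foldr pderiv1 (SOME is. \<forall>i. count_list is i = \<alpha> i) f"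

definition test_fun :: "(real^'n::finite) set \<Rightarrow> (real^'n \<Rightarrow> real) \<Rightarrow> bool" where
  "test_fun U \<phi> \<longleftrightarrow>
     smooth_fun \<phi> \<and> compact (closure {x. \<phi> x \<noteq> 0}) \<and> closure {x. \<phi> x \<noteq> 0} \<subseteq> U"

text \<open>
  Exponents \<open>p \<in> [1,\<infinity>]\<close> are extended reals; \<open>1 / \<infinity> = 0\<close> holds in the type \<open>ereal\<close>.
\<close>

definition rinv :: "ereal \<Rightarrow> real" where
  "rinv p = real_of_ereal (1 / p)"

definition Lp_space :: "ereal \<Rightarrow> (real^'n::finite) set \<Rightarrow> (real^'n \<Rightarrow> real) set" where
  "Lp_space p U = {f \<in> borel_measurable (lebesgue_on U).
     if p = \<infinity> then esssup (lebesgue_on U) (\<lambda>x. ereal \<bar>f x\<bar>) < \<infinity>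
     else integrable (lebesgue_on U) (\<lambda>x. \<bar>f x\<bar> powr real_of_ereal p)}"

text \<open>The norm is meaningful for members of \<open>Lp_space p U\<close> only.\<close>

definition Lp_norm :: "ereal \<Rightarrow> (real^'n::finite) set \<Rightarrow> (real^'n \<Rightarrow> real) \<Rightarrow> real" where
  "Lp_norm p U f =
     (if p = \<infinity> then real_of_ereal (esssup (lebesgue_on U) (\<lambda>x. ereal \<bar>f x\<bar>))
      else (LINT x|lebesgue_on U. \<bar>f x\<bar> powr real_of_ereal p) powr rinv p)"

definition lp_sum :: "ereal \<Rightarrow> 'i set \<Rightarrow> ('i \<Rightarrow> real) \<Rightarrow> real" where
  "lp_sum p I a =
     (if p = \<infinity> then Max (a ` I) else (\<Sum>i\<in>I. a i powr real_of_ereal p) powr rinv p)"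

definition locally_integrable :: "(real^'n::finite) set \<Rightarrow> (real^'n \<Rightarrow> real) \<Rightarrow> bool" where
  "locally_integrable U f \<longleftrightarrow> (\<forall>K. compact K \<and> K \<subseteq> U \<longrightarrow> f absolutely_integrable_on K)"

definition is_weak_deriv ::
  "(real^'n::finite) set \<Rightarrow> ('n \<Rightarrow> nat) \<Rightarrow> (real^'n \<Rightarrow> real) \<Rightarrow> (real^'n \<Rightarrow> real) \<Rightarrow> bool" where
  "is_weak_deriv U \<alpha> f g \<longleftrightarrow>
     locally_integrable U f \<and> locally_integrable U g \<and>
     (\<forall>\<phi>. test_fun U \<phi> \<longrightarrow>
        (LINT x|lebesgue_on U. f x * mpderiv \<alpha> \<phi> x) =
        (-1) ^ mdegree \<alpha> * (LINT x|lebesgue_on U. g x * \<phi> x))"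

text \<open>Weak derivatives are unique up to null sets, so the choice does not affect norms.\<close>

definition weak_deriv ::
  "(real^'n::finite) set \<Rightarrow> ('n \<Rightarrow> nat) \<Rightarrow> (real^'n \<Rightarrow> real) \<Rightarrow> (real^'n \<Rightarrow> real)" where
  "weak_deriv U \<alpha> f = (SOME g. is_weak_deriv U \<alpha> f g)"

definition sobolev_space ::
  "nat \<Rightarrow> ereal \<Rightarrow> (real^'n::finite) set \<Rightarrow> (real^'n \<Rightarrow> real) set" where
  "sobolev_space l p U =
     {f. \<forall>\<alpha>. mdegree \<alpha> \<le> l \<longrightarrow> (\<exists>g. is_weak_deriv U \<alpha> f g \<and> g \<in> Lp_space p U)}"

definition sobolev_norm ::
  "nat \<Rightarrow> ereal \<Rightarrow> (real^'n::finite) set \<Rightarrow> (real^'n \<Rightarrow> real) \<Rightarrow> real" where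
  "sobolev_norm l p U f =
     lp_sum p {\<alpha>. mdegree \<alpha> \<le> l} (\<lambda>\<alpha>. Lp_norm p U (weak_deriv U \<alpha> f))"

text \<open>
  Near each boundary point the set is the strict epigraph, in a direction \<open>e\<close>, of a Lipschitz
  function of the coordinates orthogonal to \<open>e\<close>. (Only the values of \<open>\<gamma>\<close> on the hyperplane
  orthogonal to \<open>e\<close> matter; a Lipschitz function given there extends to the whole space.)
\<close>

definition lipschitz_boundary :: "(real^'n::finite) set \<Rightarrow> bool" where
  "lipschitz_boundary \<Omega> \<longleftrightarrow>
     (\<forall>z\<in>frontier \<Omega>. \<exists>U e \<gamma> L. open U \<and> z \<in> U \<and> norm e = 1 \<and> L-lipschitz_on UNIV \<gamma> \<and>
        \<Omega> \<inter> U = {y \<in> U. \<gamma> (y - (y \<bullet> e) *\<^sub>R e) < y \<bullet> e})"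

text \<open>The library's \<open>polytope\<close> is convex; a polyhedral domain need not be.\<close>

definition polyhedral_lipschitz_domain :: "(real^'n::finite) set \<Rightarrow> bool" where
  "polyhedral_lipschitz_domain \<Omega> \<longleftrightarrow>
     open \<Omega> \<and> connected \<Omega> \<and> \<Omega> \<noteq> {} \<and> bounded \<Omega> \<and>
     (\<exists>\<P>. finite \<P> \<and> (\<forall>K\<in>\<P>. polytope K) \<and> closure \<Omega> = \<Union>\<P>) \<and>
     lipschitz_boundary \<Omega>"

definition ref_cube :: "(real^'n::finite) set" where
  "ref_cube = cbox (\<chi> i. - 1) (\<chi> i. 1)"

text \<open>
  A finite element \<open>{K, P, S}\<close>: functions on \<open>K\<close> are represented by their extension by zero, and
  unisolvence says that \<open>S\<close> is a basis of the dual of \<open>P\<close>. The usual geometric requirements on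
  \<open>K\<close> are omitted since \<open>K\<close> will always be the cube.
\<close>

definition finite_element ::
  "(real^'n::finite) set \<Rightarrow> (real^'n \<Rightarrow> real) set \<Rightarrow> ((real^'n \<Rightarrow> real) \<Rightarrow> real) set \<Rightarrow> bool" where
  "finite_element K P S \<longleftrightarrow>
     (\<forall>v\<in>P. \<forall>x. x \<notin> K \<longrightarrow> v x = 0) \<and>
     (\<exists>B. finite B \<and> P = fun_space.span B) \<and>
     finite S \<and> (\<forall>N\<in>S. linear_functional_on P N) \<and>
     (\<forall>c. \<exists>!v. v \<in> P \<and> (\<forall>N\<in>S. N v = c N))"

definition Qk :: "nat \<Rightarrow> (real^'n::finite) set \<Rightarrow> (real^'n \<Rightarrow> real) set" where
  "Qk k K = fun_space.span
     {(\<lambda>x. if x \<in> K then (\<Prod>i\<in>UNIV. (x $ i) ^ \<alpha> i) else 0) | \<alpha>. \<forall>i. \<alpha> i \<le> k}"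

text \<open>
  A mesh is a set \<open>\<T>\<close> of closed elements together with the affine maps
  \<open>x \<mapsto> J T *v x + b T\<close> for \<open>T \<in> \<T>\<close>. The maps are part of the data, because the local
  space on \<open>T\<close> may depend on which of the affine maps from the cube onto \<open>T\<close> is used.
\<close>

definition elem_map :: "real^'n^'n \<Rightarrow> real^'n \<Rightarrow> real^'n \<Rightarrow> real^'n::finite" where
  "elem_map A c x = A *v x + c"

definition affine_partition ::
  "(real^'n::finite) set \<Rightarrow> real \<Rightarrow> (real^'n) set set \<Rightarrow> ((real^'n) set \<Rightarrow> real^'n^'n) \<Rightarrow>
   ((real^'n) set \<Rightarrow> real^'n) \<Rightarrow> bool" where
  "affine_partition \<Omega> h \<T> J b \<longleftrightarrow>
     finite \<T> \<and> \<Union>\<T> = closure \<Omega> \<and>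
     (\<forall>T\<in>\<T>. \<forall>T'\<in>\<T>. T \<noteq> T' \<longrightarrow> interior T \<inter> interior T' = {}) \<and>
     (\<forall>T\<in>\<T>. invertible (J T) \<and> T = elem_map (J T) (b T) ` ref_cube) \<and>
     Max (diameter ` \<T>) = h"

definition inball_diameter :: "(real^'n::finite) set \<Rightarrow> real" where
  "inball_diameter T = Sup {diameter (cball c r) | c r. 0 \<le> r \<and> cball c r \<subseteq> T}"

definition locally_quasiuniform :: "(real \<Rightarrow> (real^'n::finite) set set) \<Rightarrow> real \<Rightarrow> bool" where
  "locally_quasiuniform \<T> \<sigma>0 \<longleftrightarrow>
     (\<forall>h\<in>{0<..1}. \<forall>T\<in>\<T> h. diameter T / inball_diameter T \<le> \<sigma>0)"

definition quasiuniform :: "(real \<Rightarrow> (real^'n::finite) set set) \<Rightarrow> real \<Rightarrow> real \<Rightarrow> bool" where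
  "quasiuniform \<T> \<sigma>0 Cqu \<longleftrightarrow>
     locally_quasiuniform \<T> \<sigma>0 \<and> Cqu > 0 \<and>
     (\<forall>h\<in>{0<..1}. \<forall>T\<in>\<T> h. diameter T \<ge> Cqu * h)"

definition quasiuniform_affine_family ::
  "(real^'n::finite) set \<Rightarrow> (real \<Rightarrow> (real^'n) set set) \<Rightarrow>
   (real \<Rightarrow> (real^'n) set \<Rightarrow> real^'n^'n) \<Rightarrow> (real \<Rightarrow> (real^'n) set \<Rightarrow> real^'n) \<Rightarrow>
   real \<Rightarrow> real \<Rightarrow> bool" where
  "quasiuniform_affine_family \<Omega> \<T> J b \<sigma>0 Cqu \<longleftrightarrow>
     (\<forall>h\<in>{0<..1}. affine_partition \<Omega> h (\<T> h) (J h) (b h)) \<and> quasiuniform \<T> \<sigma>0 Cqu"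

definition local_space ::
  "(real^'n \<Rightarrow> real) set \<Rightarrow> real^'n^'n \<Rightarrow> real^'n::finite \<Rightarrow> (real^'n \<Rightarrow> real) set" where
  "local_space P A c = {v \<circ> inv (elem_map A c) | v. v \<in> P}"

definition Wh ::
  "(real^'n::finite) set \<Rightarrow> (real^'n \<Rightarrow> real) set \<Rightarrow> (real^'n) set set \<Rightarrow>
   ((real^'n) set \<Rightarrow> real^'n^'n) \<Rightarrow> ((real^'n) set \<Rightarrow> real^'n) \<Rightarrow> (real^'n \<Rightarrow> real) set" where
  "Wh \<Omega> P \<T> J b = {w \<in> Lp_space 2 \<Omega>.
     \<forall>T\<in>\<T>. \<exists>u \<in> local_space P (J T) (b T). AE x in lebesgue_on T. w x = u x}"

definition broken_norm ::
  "nat \<Rightarrow> ereal \<Rightarrow> (real^'n::finite) set set \<Rightarrow> (real^'n \<Rightarrow> real) \<Rightarrow> real" where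
  "broken_norm l p \<T> v = lp_sum p \<T> (\<lambda>T. sobolev_norm l p (interior T) v)"

end

theory Submission
  imports Defs
begin

text \<open>
  Both estimates come from an inequality between seminorms of order \<open>j\<close> and \<open>min j m\<close> on the
  reference cube. It is transported to an element \<open>T\<close> by the chain rule and a change of variables,
  where shape regularity bounds \<open>J\<^sub>T\<close> by \<open>h\<^sub>T\<close> and its inverse by \<open>4 \<sigma> / h\<^sub>T\<close>; the elements are then
  combined by \<open>\<ell>\<^sup>q \<subseteq> \<ell>\<^sup>p\<close> if \<open>q \<le> p\<close>, and otherwise by Hoelder's inequality and a volume bound for
  the number of elements.

  For a general finite-dimensional space the reference inequality is a comparison of seminorms: if all
  weak derivatives of order \<open>m\<close> vanish, so do those of order \<open>j \<ge> m\<close>. For tensor product polynomials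
  it combines the Markov and Nikolskii inequalities. The former rests on a formula
  \<open>u'(1) = \<Sum> w\<^sub>j u(y\<^sub>j)\<close> with Chebyshev nodes and \<open>\<Sum> \<bar>w\<^sub>j\<bar> = k\<^sup>2\<close>: applied on \<open>[x - 1, x]\<close> or
  \<open>[x, x + 1]\<close>, whichever lies in \<open>[-1, 1]\<close>, it writes the derivative as a combination of translates,
  which gives the bound in every \<open>L\<^sup>p\<close> at once.
\<close>

text \<open>Seminorms are compared order by order because full norms scale too badly: with the norm
  of order m on the cube, the order-l term would be bounded by order-0 terms as well, and transport
  back would lose h^(-l) instead of h^(m-l). Comparing order j with r = \<open>min j m\<close> costs
  h^(r-j) only; since j - r \<le> l - m and diameters are at most 1, every loss is covered by
  h^(m-l). Derivatives are weak and selected by \<open>SOME\<close>, and functions in W_h are known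
  only up to null sets. Nothing can be computed before weak derivatives are known to be unique
  almost everywhere, hence the bump functions and the fundamental lemma. Part 2 asks for one
  constant for all k and q, which a comparison of seminorms by finite dimension cannot give. Powers
  of k must be explicit: a derivative costs 4 k^2, a change of exponent costs (16 d^2 k^2)^(d/q -
  d/p), and this exponent lies in [0, d], so its k-free part is bounded in terms of d. The factor
  2(q+1) of the claim stands in a denominator under a nonpositive exponent and only enlarges the
  right-hand side.\<close>

section \<open>Smooth functions and test functions\<close>

lemma pderiv1_eq: "(f has_derivative f') (at x) \<Longrightarrow> pderiv1 i f x = f' (axis i 1)"
  unfolding pderiv1_def using frechet_derivative_at by metis

text \<open>A class of differentiable functions that is closed under all partial derivatives
  contains only smooth functions. Smoothness proofs below name such a class instead of computing
  iterated derivatives.\<close>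

lemma smooth_fun_coinduct:
  assumes "f \<in> X" "\<And>g x. g \<in> X \<Longrightarrow> g differentiable (at x)" "\<And>g i. g \<in> X \<Longrightarrow> pderiv1 i g \<in> X"
  shows "smooth_fun f"
proof -
  have "foldr pderiv1 is f \<in> X" for "is"
    by (induction "is") (use assms in auto)
  then show ?thesis unfolding smooth_fun_def using assms by blast
qed

lemma smooth_fun_differentiable: "smooth_fun f \<Longrightarrow> f differentiable (at x)"
  unfolding smooth_fun_def by (metis foldr.simps(1) id_apply)

lemma smooth_fun_foldr: "smooth_fun f \<Longrightarrow> smooth_fun (foldr pderiv1 is f)"
  unfolding smooth_fun_def by (metis foldr_append)

lemma smooth_fun_pderiv1: "smooth_fun f \<Longrightarrow> smooth_fun (pderiv1 i f)"
  using smooth_fun_foldr[of f "[i]"] by simp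

lemma smooth_fun_continuous: "smooth_fun f \<Longrightarrow> continuous_on S f"
  by (meson continuous_at_imp_continuous_on differentiable_imp_continuous_within smooth_fun_differentiable)

lemma has_derivative_pderiv1:
  fixes f :: "real^'n::finite \<Rightarrow> real"
  assumes "f differentiable (at x)"
  shows "(f has_derivative (\<lambda>h. \<Sum>i\<in>UNIV. h $ i * pderiv1 i f x)) (at x)"
proof -
  have d: "(f has_derivative frechet_derivative f (at x)) (at x)"
    using assms frechet_derivative_works by blast
  then have lin: "linear (frechet_derivative f (at x))"
    using has_derivative_linear by blast
  have "frechet_derivative f (at x) h = (\<Sum>i\<in>UNIV. h $ i * pderiv1 i f x)" for h
  proof -
    have "frechet_derivative f (at x) h = frechet_derivative f (at x) (\<Sum>i\<in>UNIV. (h $ i) *\<^sub>R axis i 1)"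
      using basis_expansion[of h] by (simp add: scalar_mult_eq_scaleR)
    also have "\<dots> = (\<Sum>i\<in>UNIV. h $ i * pderiv1 i f x)"
      by (simp add: linear_sum[OF lin] linear_scale[OF lin] pderiv1_def)
    finally show ?thesis .
  qed
  then show ?thesis using d by (metis (no_types, lifting) ext)
qed

lemma pderiv1_affine:
  fixes u v :: "real^'n::finite \<Rightarrow> real"
  assumes "u differentiable (at x)" "v differentiable (at x)"
  shows "(\<lambda>x. a * u x + b * v x) differentiable (at x)"
    and "pderiv1 i (\<lambda>x. a * u x + b * v x) x = a * pderiv1 i u x + b * pderiv1 i v x"
proof -
  have "((\<lambda>x. a * u x + b * v x) has_derivative
      (\<lambda>h. a * frechet_derivative u (at x) h + b * frechet_derivative v (at x) h)) (at x)"
    using assms[unfolded frechet_derivative_works] by (auto intro!: derivative_eq_intros)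
  from this pderiv1_eq[OF this, of i] show "(\<lambda>x. a * u x + b * v x) differentiable (at x)"
    "pderiv1 i (\<lambda>x. a * u x + b * v x) x = a * pderiv1 i u x + b * pderiv1 i v x"
    by (auto simp: differentiable_def pderiv1_def)
qed

lemma pderiv1_mult:
  fixes u v :: "real^'n::finite \<Rightarrow> real"
  assumes "u differentiable (at x)" "v differentiable (at x)"
  shows "(\<lambda>x. u x * v x) differentiable (at x)"
    and "pderiv1 i (\<lambda>x. u x * v x) x = u x * pderiv1 i v x + pderiv1 i u x * v x"
proof -
  have "((\<lambda>x. u x * v x) has_derivative
      (\<lambda>h. u x * frechet_derivative v (at x) h + frechet_derivative u (at x) h * v x)) (at x)"
    using assms[unfolded frechet_derivative_works] by (auto intro!: derivative_eq_intros)
  from this pderiv1_eq[OF this, of i] show "(\<lambda>x. u x * v x) differentiable (at x)"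
    "pderiv1 i (\<lambda>x. u x * v x) x = u x * pderiv1 i v x + pderiv1 i u x * v x"
    by (auto simp: differentiable_def pderiv1_def)
qed

lemma smooth_fun_const: "smooth_fun (\<lambda>x::real^'n::finite. c)"
proof (rule smooth_fun_coinduct[where X="range (\<lambda>c x. c)"])
  fix g :: "real^'n \<Rightarrow> real" and i assume "g \<in> range (\<lambda>c x. c)"
  then obtain c where "g = (\<lambda>x. c)" by auto
  then have "pderiv1 i g = (\<lambda>x. 0)"
    by (auto intro!: ext pderiv1_eq[OF has_derivative_const])
  then show "pderiv1 i g \<in> range (\<lambda>c x. c)" by blast
qed auto

lemma smooth_fun_lincomb:
  assumes "smooth_fun f" "smooth_fun g"
  shows "smooth_fun (\<lambda>x. a * f x + b * g x)"
proof (rule smooth_fun_coinduct[where X="{\<lambda>x. a * f x + b * g x | f g. smooth_fun f \<and> smooth_fun g}"])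
  fix h i assume "h \<in> {\<lambda>x. a * f x + b * g x | f g. smooth_fun f \<and> smooth_fun g}"
  then obtain f g where fg: "smooth_fun f" "smooth_fun g" and h: "h = (\<lambda>x. a * f x + b * g x)" by auto
  then have "pderiv1 i h = (\<lambda>x. a * pderiv1 i f x + b * pderiv1 i g x)"
    unfolding h by (intro ext pderiv1_affine(2) smooth_fun_differentiable)
  then show "pderiv1 i h \<in> {\<lambda>x. a * f x + b * g x | f g. smooth_fun f \<and> smooth_fun g}"
    using fg smooth_fun_pderiv1 by blast
qed (use assms in \<open>auto intro: pderiv1_affine simp: smooth_fun_differentiable\<close>)

lemma smooth_fun_cmult: "smooth_fun f \<Longrightarrow> smooth_fun (\<lambda>x. a * f x)"
  using smooth_fun_lincomb[of f f a 0] by simp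

lemma smooth_fun_add: "smooth_fun f \<Longrightarrow> smooth_fun g \<Longrightarrow> smooth_fun (\<lambda>x. f x + g x)"
  using smooth_fun_lincomb[of f g 1 1] by simp

text \<open>The Leibniz rule turns a product into a sum of products, so products alone are not
  closed under differentiation, while finite sums of them are.\<close>

inductive_set product_sums :: "(real^'n::finite \<Rightarrow> real) set" where
  prod: "smooth_fun f \<Longrightarrow> smooth_fun g \<Longrightarrow> (\<lambda>x. f x * g x) \<in> product_sums"
| add: "u \<in> product_sums \<Longrightarrow> v \<in> product_sums \<Longrightarrow> (\<lambda>x. u x + v x) \<in> product_sums"

lemma product_sums_pderiv1:
  "u \<in> product_sums \<Longrightarrow> (\<forall>x. u differentiable (at x)) \<and> (\<forall>i. pderiv1 i u \<in> product_sums)"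
proof (induction rule: product_sums.induct)
  case (prod f g)
  have "pderiv1 i (\<lambda>x. f x * g x) = (\<lambda>x. f x * pderiv1 i g x + pderiv1 i f x * g x)" for i
    using prod by (auto simp: fun_eq_iff pderiv1_mult smooth_fun_differentiable)
  with prod show ?case
    by (auto intro!: product_sums.intros smooth_fun_pderiv1 intro: pderiv1_mult smooth_fun_differentiable)
next
  case (add u v)
  have "pderiv1 i (\<lambda>x. u x + v x) = (\<lambda>x. pderiv1 i u x + pderiv1 i v x)" for i
    using add pderiv1_affine(2)[of u _ v i 1 1] by (auto simp: fun_eq_iff)
  with add pderiv1_affine(1)[of u _ v 1 1] show ?case
    by (auto intro!: product_sums.intros)
qed

lemma smooth_fun_mult: "smooth_fun f \<Longrightarrow> smooth_fun g \<Longrightarrow> smooth_fun (\<lambda>x. f x * g x)"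
  by (rule smooth_fun_coinduct[of _ product_sums]) (use product_sums_pderiv1 product_sums.prod in blast)+

lemma smooth_fun_prod: "finite I \<Longrightarrow> (\<And>i. i \<in> I \<Longrightarrow> smooth_fun (f i)) \<Longrightarrow> smooth_fun (\<lambda>x. \<Prod>i\<in>I. f i x)"
  by (induction I rule: finite_induct) (auto intro: smooth_fun_const smooth_fun_mult)

subsection \<open>Affine changes of variables\<close>

lemma elem_map_has_derivative: "(elem_map A c has_derivative (*v) A) (at x)"
proof -
  have "((\<lambda>x. A *v x + c) has_derivative (\<lambda>x. A *v x + 0)) (at x)"
    by (intro has_derivative_add has_derivative_const linear_imp_has_derivative matrix_vector_mul_linear)
  then show ?thesis unfolding elem_map_def[abs_def] by simp
qed

lemma pderiv1_compose_elem_map: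
  assumes "\<phi> differentiable (at (elem_map A c x))"
  shows "(\<lambda>x. \<phi> (elem_map A c x)) differentiable (at x)"
    and "pderiv1 i (\<lambda>x. \<phi> (elem_map A c x)) x = (\<Sum>j\<in>UNIV. A $ j $ i * pderiv1 j \<phi> (elem_map A c x))"
proof -
  have "((\<lambda>x. \<phi> (elem_map A c x)) has_derivative
      (\<lambda>h. \<Sum>j\<in>UNIV. (A *v h) $ j * pderiv1 j \<phi> (elem_map A c x))) (at x)"
    using diff_chain_at[OF elem_map_has_derivative has_derivative_pderiv1[OF assms]]
    by (simp add: o_def)
  from this pderiv1_eq[OF this, of i] show "(\<lambda>x. \<phi> (elem_map A c x)) differentiable (at x)"
    "pderiv1 i (\<lambda>x. \<phi> (elem_map A c x)) x = (\<Sum>j\<in>UNIV. A $ j $ i * pderiv1 j \<phi> (elem_map A c x))"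
    by (auto simp: differentiable_def matrix_vector_mul_component inner_axis column_def)
qed

text \<open>Closure of the compositions with one affine map under the chain rule; the scalar
  \<open>k\<close> collects the matrix entries that appear.\<close>

inductive_set affine_pullbacks :: "real^'n^'n \<Rightarrow> real^'n \<Rightarrow> (real^'n::finite \<Rightarrow> real) set" for A c where
  base: "smooth_fun f \<Longrightarrow> (\<lambda>x. k * f (elem_map A c x)) \<in> affine_pullbacks A c"
| add: "u \<in> affine_pullbacks A c \<Longrightarrow> v \<in> affine_pullbacks A c \<Longrightarrow> (\<lambda>x. u x + v x) \<in> affine_pullbacks A c"

lemma affine_pullbacks_sum:
  "finite I \<Longrightarrow> (\<And>i. i \<in> I \<Longrightarrow> u i \<in> affine_pullbacks A c) \<Longrightarrow> (\<lambda>x. \<Sum>i\<in>I. u i x) \<in> affine_pullbacks A c"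
  by (induction I rule: finite_induct)
     (use affine_pullbacks.base[OF smooth_fun_const, of 0] in \<open>auto intro: affine_pullbacks.add\<close>)

lemma affine_pullbacks_pderiv1:
  "u \<in> affine_pullbacks A c \<Longrightarrow> (\<forall>x. u differentiable (at x)) \<and> (\<forall>i. pderiv1 i u \<in> affine_pullbacks A c)"
proof (induction rule: affine_pullbacks.induct)
  case (base f k)
  have 1: "pderiv1 i (\<lambda>x. k * f (elem_map A c x)) = (\<lambda>x. \<Sum>j\<in>UNIV. (k * A $ j $ i) * pderiv1 j f (elem_map A c x))" for i
  proof
    fix x
    show "pderiv1 i (\<lambda>x. k * f (elem_map A c x)) x = (\<Sum>j\<in>UNIV. (k * A $ j $ i) * pderiv1 j f (elem_map A c x))"
      using pderiv1_affine(2)[of "\<lambda>x. f (elem_map A c x)" x "\<lambda>x. f (elem_map A c x)" i k 0]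
        pderiv1_compose_elem_map[of f A c x, OF smooth_fun_differentiable[OF base]]
      by (simp add: sum_distrib_left mult.assoc)
  qed
  have 2: "(\<lambda>x. k * f (elem_map A c x)) differentiable (at x)" for x
    using pderiv1_affine(1)[of "\<lambda>x. f (elem_map A c x)" x "\<lambda>x. f (elem_map A c x)" k 0]
      pderiv1_compose_elem_map[of f A c x, OF smooth_fun_differentiable[OF base]] by simp
  show ?case unfolding 1
    using 2 base by (auto intro!: affine_pullbacks_sum affine_pullbacks.base smooth_fun_pderiv1)
next
  case (add u v)
  have "pderiv1 i (\<lambda>x. u x + v x) = (\<lambda>x. pderiv1 i u x + pderiv1 i v x)" for i
    using add pderiv1_affine(2)[of u _ v i 1 1] by (auto simp: fun_eq_iff)
  with add pderiv1_affine(1)[of u _ v 1 1] show ?case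
    by (auto intro!: affine_pullbacks.intros)
qed

lemma smooth_fun_compose_elem_map: "smooth_fun f \<Longrightarrow> smooth_fun (\<lambda>x. f (elem_map A c x))"
  by (rule smooth_fun_coinduct[of _ "affine_pullbacks A c"])
     (use affine_pullbacks_pderiv1 affine_pullbacks.base[of f 1] in fastforce)+

text \<open>The whole tower \<open>F\<close> of successive derivatives is part of the data, so that
  the multiples of all \<open>F n (s * x $ i + t)\<close> form a class closed under partial
  derivatives. Directions other than \<open>i\<close> give the multiple 0.\<close>

lemma smooth_fun_coordinate:
  fixes i :: "'n::finite"
  assumes "\<And>n t. (F n has_real_derivative F (Suc n) t) (at t)"
  shows "smooth_fun (\<lambda>x::real^'n. F 0 (s * x $ i + t))"
proof (rule smooth_fun_coinduct[where X="{\<lambda>x. k * F n (s * x $ i + t) | k n. True}"])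
  have d: "((\<lambda>x. k * F n (s * x $ i + t)) has_derivative (\<lambda>h. k * (F (Suc n) (s * x $ i + t) * (s * h $ i)))) (at x)"
    for k n and x :: "real^'n"
    using assms[of n "s * x $ i + t"]
    by (auto intro!: derivative_eq_intros bounded_linear_imp_has_derivative
        has_derivative_compose[of "\<lambda>x. s * x $ i + t" _ x UNIV "F n", OF _ assms[THEN has_field_derivative_imp_has_derivative], simplified] bounded_linear_vec_nth)
  { fix g :: "real^'n \<Rightarrow> real" and x j assume "g \<in> {\<lambda>x. k * F n (s * x $ i + t) | k n. True}"
    then obtain k n where g: "g = (\<lambda>x. k * F n (s * x $ i + t))" by auto
    show "g differentiable (at x)" unfolding g differentiable_def using d by blast
    have "pderiv1 j g = (\<lambda>x. (if j = i then k * s else 0) * F (Suc n) (s * x $ i + t))"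
      unfolding g by (rule ext, subst pderiv1_eq[OF d]) (simp add: axis_def)
    then show "pderiv1 j g \<in> {\<lambda>x. k * F n (s * x $ i + t) | k n. True}" by blast }
  have "(\<lambda>x. F 0 (s * x $ i + t)) = (\<lambda>x. 1 * F 0 (s * x $ i + t))" by simp
  then show "(\<lambda>x. F 0 (s * x $ i + t)) \<in> {\<lambda>x. k * F n (s * x $ i + t) | k n. True}" by blast
qed

subsection \<open>Bump functions\<close>

text \<open>The classical flat function exp(-1/t), multiplied by a polynomial in 1/t so that the
  family is closed under differentiation.\<close>

definition flat_exp :: "real poly \<Rightarrow> real \<Rightarrow> real" where
  "flat_exp p t = (if t > 0 then poly p (1 / t) * exp (- (1 / t)) else 0)"

lemma poly_times_exp_minus_tendsto: "((\<lambda>s. poly p s * exp (- s)) \<longlongrightarrow> (0::real)) at_top"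
proof -
  have "((\<lambda>s. \<Sum>i\<le>degree p. coeff p i * (s ^ i / exp s)) \<longlongrightarrow> (\<Sum>i\<le>degree p. coeff p i * 0)) at_top"
    by (intro tendsto_sum tendsto_mult tendsto_const tendsto_power_div_exp_0)
  then show ?thesis
    by (simp add: poly_altdef sum_distrib_right exp_minus divide_inverse mult.assoc)
qed

text \<open>With s = 1/t, the derivative of p(s) exp(-s) with respect to t is s^2 (p(s) - p'(s))
  exp(-s). At 0 the difference quotient itself has the form polynomial times exponential.\<close>

lemma flat_exp_has_derivative:
  "(flat_exp p has_real_derivative flat_exp ([:0, 0, 1:] * (p - pderiv p)) t) (at t)"
proof (cases "t = 0")
  case False
  show ?thesis
  proof (cases "t > 0")
    case True
    have "((\<lambda>t. poly p (1 / t) * exp (- (1 / t))) has_real_derivative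
        flat_exp ([:0, 0, 1:] * (p - pderiv p)) t) (at t)"
      using True by (auto intro!: derivative_eq_intros DERIV_chain2[OF poly_DERIV]
          simp: flat_exp_def power2_eq_square field_simps)
    then show ?thesis
      by (rule has_field_derivative_transform_within_open[of _ _ _ "{0<..}"])
         (use True in \<open>auto simp: flat_exp_def\<close>)
  next
    case neg: False
    have "((\<lambda>t. 0) has_real_derivative 0) (at t)" by simp
    then have "(flat_exp p has_real_derivative 0) (at t)"
      by (rule has_field_derivative_transform_within_open[of _ _ _ "{..<0}"])
         (use neg False in \<open>auto simp: flat_exp_def\<close>)
    then show ?thesis using neg by (simp add: flat_exp_def)
  qed
next
  case True
  \<comment> \<open>Division by h multiplies by s = 1/h, hence the polynomial s p(s); exponential
    decay wins as s tends to infinity.\<close>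
  have "((\<lambda>h. poly ([:0,1:] * p) (1 / h) * exp (- (1/h))) \<longlongrightarrow> 0) (at_right 0)"
    using filterlim_compose[OF poly_times_exp_minus_tendsto[of "[:0,1:] * p"] filterlim_inverse_at_top_right]
    by (simp add: inverse_eq_divide)
  then have r: "((\<lambda>h. (flat_exp p h - flat_exp p 0) / (h - 0)) \<longlongrightarrow> 0) (at_right 0)"
    by (rule tendsto_cong[THEN iffD1, rotated])
       (auto simp: flat_exp_def eventually_at_right_less eventually_at intro!: exI[of _ 1])
  have l: "((\<lambda>h. (flat_exp p h - flat_exp p 0) / (h - 0)) \<longlongrightarrow> 0) (at_left 0)"
    by (rule tendsto_cong[THEN iffD1, OF _ tendsto_const])
       (auto simp: flat_exp_def eventually_at intro!: exI[of _ 1])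
  from r l have "((\<lambda>h. (flat_exp p h - flat_exp p 0) / (h - 0)) \<longlongrightarrow> 0) (at 0)"
    by (simp add: filterlim_split_at)
  then show ?thesis using True by (simp add: has_field_derivative_iff flat_exp_def)
qed

lemma smooth_fun_flat_exp:
  "smooth_fun (\<lambda>x::real^'n::finite. flat_exp 1 (s * x $ i + t))"
proof -
  define F where "F n = flat_exp (((\<lambda>p. [:0, 0, 1:] * (p - pderiv p)) ^^ n) 1)" for n
  have "(F n has_real_derivative F (Suc n) t) (at t)" for n t
    unfolding F_def using flat_exp_has_derivative by simp
  from smooth_fun_coordinate[of F, OF this, of s i t] show ?thesis
    by (simp add: F_def)
qed

lemma flat_exp_1: "0 \<le> flat_exp 1 t" "flat_exp 1 t \<le> 1" "flat_exp 1 t \<noteq> 0 \<longleftrightarrow> t > 0"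
  by (auto simp: flat_exp_def)

text \<open>The parameter \<open>m\<close> is a steepness: for every m > 0 the function is positive
  exactly on the open box, and as m grows it tends to the indicator of that box.\<close>

definition box_bump :: "real \<Rightarrow> real^'n \<Rightarrow> real^'n \<Rightarrow> real^'n::finite \<Rightarrow> real" where
  "box_bump m a b x = (\<Prod>i\<in>UNIV. flat_exp 1 (m * (x $ i - a $ i)) * flat_exp 1 (m * (b $ i - x $ i)))"

lemma smooth_fun_box_bump:
  fixes a :: "real^'n::finite"
  shows "smooth_fun (box_bump m a b)"
proof -
  have "smooth_fun (\<lambda>x::real^'n. flat_exp 1 (m * x $ i + (- m * a $ i)) * flat_exp 1 ((-m) * x $ i + m * b $ i))" for i
    by (intro smooth_fun_mult smooth_fun_flat_exp)
  then have "smooth_fun (\<lambda>x::real^'n. \<Prod>i\<in>UNIV. flat_exp 1 (m * x $ i + (- m * a $ i)) * flat_exp 1 ((-m) * x $ i + m * b $ i))"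
    by (intro smooth_fun_prod) auto
  moreover have "box_bump m a b = (\<lambda>x::real^'n. \<Prod>i\<in>UNIV. flat_exp 1 (m * x $ i + (- m * a $ i)) * flat_exp 1 ((-m) * x $ i + m * b $ i))"
    by (rule ext) (auto simp: box_bump_def algebra_simps intro!: prod.cong)
  ultimately show ?thesis by simp
qed

lemma box_bump_nonzero: "m > 0 \<Longrightarrow> box_bump m a b x \<noteq> 0 \<longleftrightarrow> x \<in> box a b"
  by (auto simp: box_bump_def flat_exp_1(3) mem_box_cart zero_less_mult_iff)

lemma test_fun_box_bump:
  assumes "m > 0" "cbox a b \<subseteq> U" shows "test_fun U (box_bump m a b)"
proof -
  have "closure {x. box_bump m a b x \<noteq> 0} \<subseteq> cbox a b"
    using assms(1) by (intro closure_minimal) (use box_subset_cbox in \<open>auto simp: box_bump_nonzero\<close>)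
  then show ?thesis
    using assms by (auto simp: test_fun_def smooth_fun_box_bump compact_eq_bounded_closed
        intro: bounded_subset[OF bounded_cbox])
qed

lemma box_bump_bounds: "0 \<le> box_bump m a b x" "box_bump m a b x \<le> 1"
  unfolding box_bump_def by (auto intro!: prod_nonneg prod_le_1 mult_le_one simp: flat_exp_1)

lemma flat_exp_tendsto: "0 < t \<Longrightarrow> (\<lambda>m. flat_exp 1 (real (Suc m) * t)) \<longlonglongrightarrow> 1"
proof -
  assume t: "0 < t"
  have "(\<lambda>m. exp (- (inverse (real (Suc m)) * (1 / t)))) \<longlonglongrightarrow> exp (- (0 * (1 / t)))"
    by (intro tendsto_intros LIMSEQ_inverse_real_of_nat)
  then show ?thesis using t by (simp add: flat_exp_def divide_inverse)
qed

lemma box_bump_tendsto: "(\<lambda>m. box_bump (real (Suc m)) a b x) \<longlonglongrightarrow> indicator (box a b) x"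
proof (cases "x \<in> box a b")
  case True
  then have "(\<lambda>m. box_bump (real (Suc m)) a b x) \<longlonglongrightarrow> (\<Prod>i\<in>(UNIV::'a set). 1 * 1)"
    unfolding box_bump_def by (intro tendsto_prod tendsto_mult flat_exp_tendsto) (auto simp: mem_box_cart)
  with True show ?thesis by simp
next
  case False
  then have "(\<lambda>m. box_bump (real (Suc m)) a b x) = (\<lambda>m. 0)"
    using box_bump_nonzero[of "real (Suc _)" a b x] by auto
  with False show ?thesis by simp
qed

subsection \<open>Symmetry of mixed partial derivatives\<close>

lemma has_real_derivative_along_axis:
  fixes f :: "real^'n::finite \<Rightarrow> real"
  assumes "f differentiable (at (x + t *\<^sub>R axis i 1))"
  shows "((\<lambda>t. f (x + t *\<^sub>R axis i 1)) has_real_derivative pderiv1 i f (x + t *\<^sub>R axis i 1)) (at t)"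
proof -
  let ?f' = "frechet_derivative f (at (x + t *\<^sub>R axis i 1))"
  have d: "(f has_derivative ?f') (at (x + t *\<^sub>R axis i 1))"
    using assms frechet_derivative_works by blast
  then have lin: "linear ?f'" using has_derivative_linear by blast
  have "((\<lambda>t. x + t *\<^sub>R axis i 1) has_derivative (\<lambda>h. h *\<^sub>R axis i 1)) (at t)"
    by (auto intro!: derivative_eq_intros)
  from diff_chain_at[OF this d]
  have "((\<lambda>t. f (x + t *\<^sub>R axis i 1)) has_derivative (\<lambda>h. ?f' (h *\<^sub>R axis i 1))) (at t)"
    by (simp add: o_def)
  moreover have "(\<lambda>h. ?f' (h *\<^sub>R axis i 1)) = (*) (pderiv1 i f (x + t *\<^sub>R axis i 1))"
    by (auto simp: linear_scale[OF lin] pderiv1_def)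
  ultimately show ?thesis by (simp add: has_field_derivative_def)
qed

text \<open>Two uses of the mean value theorem: in direction \<open>i\<close> for the increment of
  \<open>f\<close> in direction \<open>j\<close>, then in direction \<open>j\<close> for
  \<open>pderiv1 i f\<close>. The left-hand side is symmetric in \<open>i\<close> and
  \<open>j\<close>.\<close>

lemma second_difference:
  fixes f :: "real^'n::finite \<Rightarrow> real"
  assumes "smooth_fun f" "h > 0"
  obtains s t where "0 < s" "s < h" "0 < t" "t < h"
    "f (x + h *\<^sub>R axis i 1 + h *\<^sub>R axis j 1) - f (x + h *\<^sub>R axis i 1) - f (x + h *\<^sub>R axis j 1) + f x
      = h\<^sup>2 * pderiv1 j (pderiv1 i f) (x + s *\<^sub>R axis i 1 + t *\<^sub>R axis j 1)"
proof -
  note d = smooth_fun_differentiable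
  let ?u = "\<lambda>s. f ((x + h *\<^sub>R axis j 1) + s *\<^sub>R axis i 1) - f (x + s *\<^sub>R axis i 1)"
  have "(?u has_real_derivative pderiv1 i f ((x + h *\<^sub>R axis j 1) + s *\<^sub>R axis i 1) - pderiv1 i f (x + s *\<^sub>R axis i 1)) (at s)" for s
    by (intro DERIV_diff has_real_derivative_along_axis d assms)
  from MVT2[of 0 h, OF assms(2) this] obtain s where s: "0 < s" "s < h"
    "?u h - ?u 0 = h * (pderiv1 i f ((x + h *\<^sub>R axis j 1) + s *\<^sub>R axis i 1) - pderiv1 i f (x + s *\<^sub>R axis i 1))"
    by auto
  let ?w = "\<lambda>t. pderiv1 i f ((x + s *\<^sub>R axis i 1) + t *\<^sub>R axis j 1)"
  have "(?w has_real_derivative pderiv1 j (pderiv1 i f) ((x + s *\<^sub>R axis i 1) + t *\<^sub>R axis j 1)) (at t)" for t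
    by (intro has_real_derivative_along_axis d smooth_fun_pderiv1 assms)
  from MVT2[of 0 h, OF assms(2) this] obtain t where t: "0 < t" "t < h"
    "?w h - ?w 0 = h * pderiv1 j (pderiv1 i f) (x + s *\<^sub>R axis i 1 + t *\<^sub>R axis j 1)"
    by auto
  have "?u h - ?u 0 = h * (?w h - ?w 0)"
    using s(3) by (simp add: algebra_simps)
  with s t show thesis
    by (intro that[of s t]) (auto simp: algebra_simps power2_eq_square)
qed

text \<open>The symmetric second difference equals h^2 times either mixed derivative, each taken at
  some point near x. As both are continuous at x, different values there would contradict this for
  small h.\<close>

lemma pderiv1_commute:
  assumes "smooth_fun f"
  shows "pderiv1 i (pderiv1 j f) = pderiv1 j (pderiv1 i f)"
proof (rule ext, rule ccontr)
  fix x
  let ?p = "pderiv1 i (pderiv1 j f)" and ?q = "pderiv1 j (pderiv1 i f)"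
  assume ne: "?p x \<noteq> ?q x"
  define e where "e = \<bar>?p x - ?q x\<bar> / 2"
  have e: "e > 0" using ne by (simp add: e_def)
  have "isCont ?p x" "isCont ?q x"
    using assms by (meson differentiable_imp_continuous_within smooth_fun_differentiable smooth_fun_pderiv1)+
  then obtain d1 d2 where d: "d1 > 0" "\<And>y. dist y x < d1 \<Longrightarrow> dist (?p y) (?p x) < e"
     "d2 > 0" "\<And>y. dist y x < d2 \<Longrightarrow> dist (?q y) (?q x) < e"
    using e unfolding continuous_at_eps_delta by metis
  \<comment> \<open>The intermediate points lie within 2h of x, hence inside both continuity
    radii.\<close>
  define h where "h = min d1 d2 / 2"
  have h: "h > 0" "2 * h \<le> d1" "2 * h \<le> d2" using d by (auto simp: h_def)
  obtain s t where 1: "0 < s" "s < h" "0 < t" "t < h"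
    "f (x + h *\<^sub>R axis i 1 + h *\<^sub>R axis j 1) - f (x + h *\<^sub>R axis i 1) - f (x + h *\<^sub>R axis j 1) + f x
      = h\<^sup>2 * ?q (x + s *\<^sub>R axis i 1 + t *\<^sub>R axis j 1)"
    using second_difference[OF assms h(1)] by blast
  obtain s' t' where 2: "0 < s'" "s' < h" "0 < t'" "t' < h"
    "f (x + h *\<^sub>R axis j 1 + h *\<^sub>R axis i 1) - f (x + h *\<^sub>R axis j 1) - f (x + h *\<^sub>R axis i 1) + f x
      = h\<^sup>2 * ?p (x + s' *\<^sub>R axis j 1 + t' *\<^sub>R axis i 1)"
    using second_difference[OF assms h(1)] by blast
  have eq: "?q (x + s *\<^sub>R axis i 1 + t *\<^sub>R axis j 1) = ?p (x + s' *\<^sub>R axis j 1 + t' *\<^sub>R axis i 1)"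
  proof -
    have "h\<^sup>2 * ?q (x + s *\<^sub>R axis i 1 + t *\<^sub>R axis j 1) = h\<^sup>2 * ?p (x + s' *\<^sub>R axis j 1 + t' *\<^sub>R axis i 1)"
      unfolding 1(5)[symmetric] 2(5)[symmetric] by (simp add: add_ac diff_right_commute)
    then show ?thesis using h by simp
  qed
  have near: "dist (x + s *\<^sub>R axis a 1 + t *\<^sub>R axis b 1) x < 2 * h"
    if "0 < s" "s < h" "0 < t" "t < h" for s t :: real and a b
    using that norm_triangle_ineq[of "s *\<^sub>R axis a (1::real)" "t *\<^sub>R axis b 1"] by (simp add: dist_norm)
  have "dist (?q (x + s *\<^sub>R axis i 1 + t *\<^sub>R axis j 1)) (?q x) < e"
    using d(4)[OF order_less_le_trans[OF near[OF 1(1-4), of i j] h(3)]] .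
  moreover have "dist (?p (x + s' *\<^sub>R axis j 1 + t' *\<^sub>R axis i 1)) (?p x) < e"
    using d(2)[OF order_less_le_trans[OF near[OF 2(1-4), of j i] h(2)]] .
  ultimately show False unfolding eq dist_real_def e_def by (smt (verit) field_sum_of_halves)
qed

section \<open>Iterated derivatives indexed by lists of directions\<close>

lemma foldr_pderiv1_commute:
  "smooth_fun f \<Longrightarrow> foldr pderiv1 is (pderiv1 i f) = pderiv1 i (foldr pderiv1 is f)"
  by (induction "is") (simp_all add: pderiv1_commute smooth_fun_foldr)

lemma foldr_pderiv1_perm:
  "smooth_fun f \<Longrightarrow> mset is = mset js \<Longrightarrow> foldr pderiv1 is f = foldr pderiv1 js f"
proof (induction "is" arbitrary: js)
  case (Cons a "is")
  then have "a \<in> set js" by (metis list.set_intros(1) set_mset_mset)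
  then obtain ys zs where js: "js = ys @ a # zs" by (meson split_list)
  then have "mset is = mset (ys @ zs)" using Cons.prems(2) by simp
  with Cons have "foldr pderiv1 is f = foldr pderiv1 (ys @ zs) f" by blast
  then show ?case
    using Cons.prems(1) by (simp add: js foldr_pderiv1_commute smooth_fun_foldr)
qed simp

text \<open>Lists of directions replace multi-indices from here on: every multi-index is some
  \<open>count_list js\<close>, and by symmetry of mixed derivatives the list selected by
  \<open>SOME\<close> gives the same operator as \<open>js\<close>.\<close>

lemma mpderiv_count_list:
  assumes "smooth_fun f" shows "mpderiv (count_list js) f = foldr pderiv1 js f"
proof -
  have "\<forall>i. count_list (SOME is. \<forall>i. count_list is i = count_list js i) i = count_list js i"
    by (rule someI[of _ js]) simp
  then show ?thesis
    unfolding mpderiv_def by (intro foldr_pderiv1_perm assms) (simp add: multiset_eq_iff count_mset)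
qed

lemma mdegree_count_list: "mdegree (count_list js) = length js"
  unfolding mdegree_def by (rule sum_count_set) auto

lemma ex_count_list: "\<exists>js. count_list js = (\<alpha> :: 'n::finite \<Rightarrow> nat)"
proof -
  obtain js where js: "mset js = Abs_multiset \<alpha>" using ex_mset by blast
  have "count (Abs_multiset \<alpha>) = \<alpha>" by (rule count_Abs_multiset) simp
  then have "count_list js = \<alpha>" by (metis (no_types) js count_mset ext)
  then show ?thesis by blast
qed

text \<open>Off its closed support a function vanishes on a neighbourhood, so its derivative
  vanishes there as well; differentiation cannot enlarge the support.\<close>

lemma test_fun_foldr:
  assumes "test_fun U \<phi>" shows "test_fun U (foldr pderiv1 is \<phi>)"
proof -
  have step: "closure {x. pderiv1 i g x \<noteq> 0} \<subseteq> closure {x. g x \<noteq> 0}" for i and g :: "real^'a \<Rightarrow> real"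
  proof (rule closure_minimal[OF _ closed_closure], rule subsetI, rule ccontr)
    fix x assume nz: "x \<in> {x. pderiv1 i g x \<noteq> 0}" and x: "x \<notin> closure {x. g x \<noteq> 0}"
    have z: "0 = g y" if "y \<in> - closure {x. g x \<noteq> 0}" for y
    proof (rule ccontr)
      assume "0 \<noteq> g y"
      then have "y \<in> closure {x. g x \<noteq> 0}" by (intro closure_subset[THEN subsetD]) simp
      with that show False by simp
    qed
    have "((\<lambda>x. 0) has_derivative (\<lambda>h. 0)) (at x)" by simp
    then have "(g has_derivative (\<lambda>h. 0)) (at x)"
      by (rule has_derivative_transform_within_open[OF _ open_Compl[OF closed_closure] _ z]) (use x in simp)
    then show False using nz by (simp add: pderiv1_eq)
  qed
  have sub: "closure {x. foldr pderiv1 is \<phi> x \<noteq> 0} \<subseteq> closure {x. \<phi> x \<noteq> 0}"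
  proof (induction "is")
    case (Cons i "is")
    from subset_trans[OF step[of i "foldr pderiv1 is \<phi>"] this] show ?case by simp
  qed simp
  have \<phi>: "compact (closure {x. \<phi> x \<noteq> 0})" "closure {x. \<phi> x \<noteq> 0} \<subseteq> U" "smooth_fun \<phi>"
    using assms by (simp_all add: test_fun_def)
  show ?thesis
    unfolding test_fun_def
    using compact_Int_closed[OF \<phi>(1) closed_closure, of "{x. foldr pderiv1 is \<phi> x \<noteq> 0}"] sub
    by (intro conjI smooth_fun_foldr \<phi>(3) subset_trans[OF sub \<phi>(2)]) (simp add: Int_absorb1)
qed

section \<open>Lebesgue measure under linear maps\<close>

lemma lborel_integral_translation:
  fixes f :: "'a::euclidean_space \<Rightarrow> real"
  assumes f: "integrable lborel f"
  shows "integrable lborel (\<lambda>x. f (x + v))" "(LINT x|lborel. f (x + v)) = (LINT x|lborel. f x)"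
proof -
  have [measurable]: "f \<in> borel_measurable borel" using f by auto
  have "integrable (distr lborel borel ((+) v)) f \<longleftrightarrow> integrable lborel (\<lambda>x. f (v + x))"
    by (rule integrable_distr_eq) auto
  with f show "integrable lborel (\<lambda>x. f (x + v))" by (simp add: lborel_distr_plus add.commute)
  have "(LINT x|distr lborel borel ((+) v). f x) = (LINT x|lborel. f (v + x))"
    by (rule integral_distr) auto
  then show "(LINT x|lborel. f (x + v)) = (LINT x|lborel. f x)" by (simp add: lborel_distr_plus add.commute)
qed

lemma lborel_distr_reflect: 
  fixes c :: "'a::euclidean_space"
  shows "distr lborel borel (\<lambda>x. c - x) = lborel"
proof -
  have "lborel = density (distr lborel borel (\<lambda>x. c + (-1) *\<^sub>R x)) (\<lambda>_. 1)"
    using lborel_affine[of "-1" c] by simp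
  then show ?thesis by (simp add: density_1)
qed

text \<open>Uniqueness of Haar measure: both sides of the conclusion equal the measure of
  \<open>{(y, x). y \<in> B \<and> x - y \<in> A}\<close> with respect to \<open>lborel \<Otimes> M\<close>, by Tonelli.\<close>

lemma translation_invariant_measure_eq:
  fixes M :: "'a::euclidean_space measure"
  assumes sets[measurable_cong]: "sets M = sets borel" and sf: "sigma_finite_measure M"
    and inv: "\<And>c. distr M borel (\<lambda>x. c + x) = M"
    and A: "A \<in> sets borel" and B: "B \<in> sets borel"
  shows "emeasure M A * emeasure lborel B = emeasure M B * emeasure lborel A"
proof -
  interpret M: sigma_finite_measure M by fact
  interpret P: pair_sigma_finite lborel M by unfold_locales
  note [measurable] = A B
  have tr: "(\<integral>\<^sup>+x. f (c + x) \<partial>M) = (\<integral>\<^sup>+x. f x \<partial>M)" if [measurable]: "f \<in> borel_measurable borel" for f and c :: 'a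
  proof -
    have "(\<integral>\<^sup>+x. f x \<partial>distr M borel (\<lambda>x. c + x)) = (\<integral>\<^sup>+x. f (c + x) \<partial>M)"
      by (rule nn_integral_distr) simp_all
    then show ?thesis by (simp add: inv)
  qed
  have refl: "(\<integral>\<^sup>+x. f (c - x) \<partial>lborel) = (\<integral>\<^sup>+x. f x \<partial>lborel)" if [measurable]: "f \<in> borel_measurable borel" for f and c :: 'a
  proof -
    have "(\<integral>\<^sup>+x. f x \<partial>distr lborel borel (\<lambda>x. c - x)) = (\<integral>\<^sup>+x. f (c - x) \<partial>lborel)"
      by (rule nn_integral_distr) simp_all
    then show ?thesis by (simp add: lborel_distr_reflect)
  qed
  have "emeasure M A * emeasure lborel B = (\<integral>\<^sup>+y. (\<integral>\<^sup>+x. indicator A x * indicator B y \<partial>M) \<partial>lborel)"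
    by (simp add: nn_integral_multc nn_integral_cmult)
  also have "\<dots> = (\<integral>\<^sup>+y. (\<integral>\<^sup>+x. indicator A (- y + x) * indicator B y \<partial>M) \<partial>lborel)"
    by (subst tr[of "\<lambda>x. indicator A x * indicator B _"]) simp_all
  also have "\<dots> = (\<integral>\<^sup>+x. (\<integral>\<^sup>+y. indicator A (- y + x) * indicator B y \<partial>lborel) \<partial>M)"
    by (rule P.Fubini'[symmetric]) simp
  also have "\<dots> = (\<integral>\<^sup>+x. (\<integral>\<^sup>+y. indicator A y * indicator B (x - y) \<partial>lborel) \<partial>M)"
  proof (rule nn_integral_cong)
    fix x
    show "(\<integral>\<^sup>+y. indicator A (- y + x) * indicator B y \<partial>lborel) = (\<integral>\<^sup>+y. indicator A y * indicator B (x - y) \<partial>lborel)"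
      using refl[of "\<lambda>y. indicator A y * indicator B (x - y)" x] by simp
  qed
  also have "\<dots> = (\<integral>\<^sup>+y. (\<integral>\<^sup>+x. indicator A y * indicator B (- y + x) \<partial>M) \<partial>lborel)"
    by (subst P.Fubini') (simp_all add: algebra_simps)
  also have "\<dots> = (\<integral>\<^sup>+y. (\<integral>\<^sup>+x. indicator A y * indicator B x \<partial>M) \<partial>lborel)"
    by (subst tr[of "\<lambda>x. indicator A _ * indicator B x"]) simp_all
  also have "\<dots> = emeasure M B * emeasure lborel A"
    by (simp add: nn_integral_multc nn_integral_cmult mult.commute)
  finally show ?thesis .
qed

text \<open>The image measure under \<open>g\<close> is translation invariant, since a shift by c
  after \<open>g\<close> is a shift by \<open>f c\<close> before it. Comparison with Lebesgue
  measure on the unit cube then fixes the constant.\<close>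

lemma lborel_distr_linear:
  fixes f g :: "'a::euclidean_space \<Rightarrow> 'a"
  assumes lin: "linear f" "linear g" and gf: "\<And>x. g (f x) = x" "\<And>x. f (g x) = x"
  obtains c where "c > (0::real)" "distr lborel borel g = density lborel (\<lambda>_. ennreal c)"
proof -
  let ?M = "distr lborel borel g" and ?B = "cbox 0 One :: 'a set"
  have [measurable]: "f \<in> borel_measurable borel" "g \<in> borel_measurable borel"
    using lin by (auto intro!: borel_measurable_continuous_onI linear_continuous_on simp: linear_conv_bounded_linear)
  have em: "emeasure ?M A = emeasure lborel (f ` A)" if "A \<in> sets borel" for A
  proof -
    have "g -` A = f ` A" using gf by (auto intro!: image_eqI[of _ f "g _"])
    then show ?thesis using that by (simp add: emeasure_distr)
  qed
  have fin: "emeasure ?M (ball 0 n) \<noteq> \<infinity>" for n :: real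
  proof -
    have "bounded (f ` ball 0 n)" using lin bounded_linear_image linear_conv_bounded_linear by blast
    then show ?thesis using emeasure_bounded_finite by (fastforce simp: em)
  qed
  have "\<Union> (range (\<lambda>n. ball (0::'a) (real n))) = UNIV"
    using reals_Archimedean2 by (auto simp: dist_norm)
  then have sf: "sigma_finite_measure ?M"
    using fin by (intro sigma_finite_measure.intro exI[of _ "range (\<lambda>n. ball 0 (real n))"]) auto
  have inv: "distr ?M borel (\<lambda>x. c + x) = ?M" for c
  proof -
    have "distr ?M borel (\<lambda>x. c + x) = distr lborel borel ((\<lambda>x. c + x) \<circ> g)"
      by (subst distr_distr) auto
    also have "(\<lambda>x. c + x) \<circ> g = g \<circ> (\<lambda>x. f c + x)"
      by (auto simp: gf linear_add[OF lin(2)])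
    also have "distr lborel borel (g \<circ> (\<lambda>x. f c + x)) = distr (distr lborel borel (\<lambda>x. f c + x)) borel g"
      by (subst distr_distr) auto
    also have "\<dots> = ?M" by (simp add: lborel_distr_plus)
    finally show ?thesis .
  qed
  define c where "c = measure ?M ?B"
  have "bounded (f ` ?B)" using lin bounded_linear_image linear_conv_bounded_linear bounded_cbox by blast
  then have B: "emeasure ?M ?B = ennreal c"
    unfolding c_def using emeasure_bounded_finite by (intro emeasure_eq_ennreal_measure) (fastforce simp: em)
  have eq: "emeasure ?M A = ennreal c * emeasure lborel A" if "A \<in> sets borel" for A
  proof -
    have "emeasure lborel ?B = 1" by (simp add: emeasure_lborel_cbox_eq)
    then show ?thesis
      using translation_invariant_measure_eq[of ?M A ?B, OF _ sf inv that] B by simp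
  qed
  \<comment> \<open>Infinite total mass excludes c = 0.\<close>
  have "emeasure ?M UNIV = \<infinity>" by (simp add: emeasure_distr)
  then have "c \<noteq> 0" using eq[of UNIV] by auto
  then have "c > 0" unfolding c_def using measure_nonneg less_le by metis
  moreover have "distr lborel borel g = density lborel (\<lambda>_. ennreal c)"
    by (rule measure_eqI) (auto simp: eq emeasure_density nn_integral_cmult)
  ultimately show thesis using that by blast
qed

lemma lborel_distr_affine:
  fixes f g :: "'a::euclidean_space \<Rightarrow> 'a"
  assumes lin: "linear f" "linear g" and gf: "\<And>x. g (f x) = x" "\<And>x. f (g x) = x"
  obtains c where "c > (0::real)" "distr lborel borel (\<lambda>x. g (x - t)) = density lborel (\<lambda>_. ennreal c)"
proof -
  obtain c where c: "c > (0::real)" "distr lborel borel g = density lborel (\<lambda>_. ennreal c)"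
    using lborel_distr_linear[OF assms] .
  have [measurable]: "g \<in> borel_measurable borel"
    using lin by (auto intro!: borel_measurable_continuous_onI linear_continuous_on simp: linear_conv_bounded_linear)
  have "distr lborel borel (\<lambda>x. g (x - t)) = distr (distr lborel borel (\<lambda>x. - t + x)) borel g"
    by (subst distr_distr) (auto simp: o_def)
  then have "distr lborel borel (\<lambda>x. g (x - t)) = density lborel (\<lambda>_. ennreal c)"
    by (simp only: lborel_distr_plus c)
  with c(1) show thesis by (rule that)
qed


section \<open>Change of variables under invertible affine maps\<close>

lemma matrix_inv_mult:
  "invertible A \<Longrightarrow> A ** matrix_inv A = mat 1 \<and> matrix_inv A ** A = mat 1"
  unfolding matrix_inv_def invertible_def by (rule someI_ex)

text \<open>The inverse is again of the form \<open>elem_map\<close>, so every statement about these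
  maps can also be used in the opposite direction.\<close>

lemma elem_map_inverse:
  fixes A :: "real^'n::finite^'n"
  assumes "invertible A"
  shows "elem_map (matrix_inv A) (- (matrix_inv A *v c)) (elem_map A c x) = x"
    and "elem_map A c (elem_map (matrix_inv A) (- (matrix_inv A *v c)) x) = x"
    and "invertible (matrix_inv A)"
    and "inv (elem_map A c) = elem_map (matrix_inv A) (- (matrix_inv A *v c))"
proof -
  have 1: "matrix_inv A ** A = mat 1" "A ** matrix_inv A = mat 1"
    using matrix_inv_mult[OF assms] by auto
  show a: "elem_map (matrix_inv A) (- (matrix_inv A *v c)) (elem_map A c x) = x" for x
    by (simp add: elem_map_def matrix_vector_right_distrib matrix_vector_mul_assoc 1)
  show b: "elem_map A c (elem_map (matrix_inv A) (- (matrix_inv A *v c)) x) = x" for x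
    by (simp add: elem_map_def matrix_vector_right_distrib matrix_vector_mul_assoc 1
        matrix_vector_mult_diff_distrib)
  show "invertible (matrix_inv A)" using 1 unfolding invertible_def by blast
  show "inv (elem_map A c) = elem_map (matrix_inv A) (- (matrix_inv A *v c))"
    using a b by (intro inv_unique_comp) (auto simp: o_def)
qed

lemma lebesgue_distr_elem_map:
  fixes A :: "real^'n::finite^'n"
  assumes "invertible A"
  obtains c where "c > (0::real)" "elem_map A b \<in> lebesgue \<rightarrow>\<^sub>M lebesgue"
    "distr lebesgue lebesgue (elem_map A b) = density lebesgue (\<lambda>_. ennreal c)"
proof -
  let ?F = "elem_map A b"
  have 1: "matrix_inv A ** A = mat 1" "A ** matrix_inv A = mat 1"
    using matrix_inv_mult[OF assms] by auto
  obtain c where c: "c > (0::real)" "distr lborel borel (\<lambda>x. A *v (x - (- (matrix_inv A *v b)))) = density lborel (\<lambda>_. ennreal c)"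
    using lborel_distr_affine[of "(*v) (matrix_inv A)" "(*v) A" "- (matrix_inv A *v b)"]
    by (auto simp: matrix_vector_mul_assoc 1)
  have "(\<lambda>x. A *v (x - (- (matrix_inv A *v b)))) = ?F"
    by (auto simp: elem_map_def matrix_vector_right_distrib matrix_vector_mul_assoc 1)
  with c have d: "distr lborel borel ?F = density lborel (\<lambda>_. ennreal c)" by simp
  have F_borel[measurable]: "?F \<in> borel \<rightarrow>\<^sub>M borel"
    by (intro borel_measurable_continuous_onI continuous_at_imp_continuous_on ballI
        has_derivative_continuous[OF elem_map_has_derivative])
  have d2: "distr lebesgue lborel ?F = density lborel (\<lambda>_. ennreal c)"
    using d by (simp add: distr_completion cong: distr_cong)
  \<comment> \<open>The map preserves null sets in both directions, which carries measurability and
    the image formula from Borel sets over to the completion.\<close>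
  have eq: "null_sets lborel = null_sets (distr lebesgue lborel ?F)"
    unfolding d2 using c(1) by (auto simp: null_sets_def emeasure_density nn_integral_cmult)
  have m: "?F \<in> lebesgue \<rightarrow>\<^sub>M lebesgue"
    by (simp add: completion.measurable_completion2 eq measurable_completion)
  have "distr lebesgue lebesgue ?F = completion (distr lebesgue lborel ?F)"
    by (subst completion.completion_distr_eq) (auto simp: eq measurable_completion)
  also have "\<dots> = density lebesgue (\<lambda>_. ennreal c)"
    unfolding d2 using c(1) by (intro completion_density_eq) (auto intro!: always_eventually)
  finally show thesis using that c(1) m by blast
qed

text \<open>This is \<open>\<bar>det A\<bar>\<close>, but only its relation to the volumes of images is needed.\<close>

definition dilation_factor :: "real^'n::finite^'n \<Rightarrow> real^'n \<Rightarrow> real" where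
  "dilation_factor A b = (SOME c. c > 0 \<and> elem_map A b \<in> lebesgue \<rightarrow>\<^sub>M lebesgue \<and>
     density (distr lebesgue lebesgue (elem_map A b)) (\<lambda>_. ennreal c) = lebesgue)"

lemma dilation_factor:
  assumes "invertible A"
  shows "dilation_factor A b > 0" "elem_map A b \<in> lebesgue \<rightarrow>\<^sub>M lebesgue"
    "density (distr lebesgue lebesgue (elem_map A b)) (\<lambda>_. ennreal (dilation_factor A b)) = lebesgue"
proof -
  obtain c where c: "c > (0::real)" "elem_map A b \<in> lebesgue \<rightarrow>\<^sub>M lebesgue"
    "distr lebesgue lebesgue (elem_map A b) = density lebesgue (\<lambda>_. ennreal c)"
    using lebesgue_distr_elem_map[OF assms] .
  \<comment> \<open>The density c of the image measure is 1/|det A|. Its reciprocal undoes it and is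
    the factor by which the map multiplies volumes.\<close>
  have "density (density lebesgue (\<lambda>_::real^'a. ennreal c)) (\<lambda>_. ennreal (1/c)) = lebesgue"
    using c(1) by (subst density_density_eq) (auto simp: ennreal_mult[symmetric] density_1)
  with c have "1/c > 0 \<and> elem_map A b \<in> lebesgue \<rightarrow>\<^sub>M lebesgue \<and>
     density (distr lebesgue lebesgue (elem_map A b)) (\<lambda>_. ennreal (1/c)) = lebesgue" by simp
  then have "dilation_factor A b > 0 \<and> elem_map A b \<in> lebesgue \<rightarrow>\<^sub>M lebesgue \<and>
    density (distr lebesgue lebesgue (elem_map A b)) (\<lambda>_. ennreal (dilation_factor A b)) = lebesgue"
    unfolding dilation_factor_def by (rule someI)
  then show "dilation_factor A b > 0" "elem_map A b \<in> lebesgue \<rightarrow>\<^sub>M lebesgue"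
    "density (distr lebesgue lebesgue (elem_map A b)) (\<lambda>_. ennreal (dilation_factor A b)) = lebesgue" by auto
qed

lemma lebesgue_integral_elem_map:
  fixes f :: "real^'n::finite \<Rightarrow> real"
  assumes A: "invertible A" and f: "f \<in> borel_measurable lebesgue"
  shows "(LINT x|lebesgue. f x) = dilation_factor A b * (LINT x|lebesgue. f (elem_map A b x))"
    and "integrable lebesgue f \<longleftrightarrow> integrable lebesgue (\<lambda>x. f (elem_map A b x))"
proof -
  note [measurable] = f dilation_factor(2)[OF A]
  note c = dilation_factor(1,3)[OF A, of b]
  have "(LINT x|lebesgue. f x) = (LINT x|density (distr lebesgue lebesgue (elem_map A b)) (\<lambda>_. ennreal (dilation_factor A b)). f x)"
    using c by simp
  also have "\<dots> = (LINT x|distr lebesgue lebesgue (elem_map A b). dilation_factor A b * f x)"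
    using c(1) by (subst integral_density) auto
  also have "\<dots> = (LINT x|lebesgue. dilation_factor A b * f (elem_map A b x))"
    by (subst integral_distr) auto
  finally show "(LINT x|lebesgue. f x) = dilation_factor A b * (LINT x|lebesgue. f (elem_map A b x))"
    by simp
  have "integrable lebesgue f = integrable (density (distr lebesgue lebesgue (elem_map A b)) (\<lambda>_. ennreal (dilation_factor A b))) f"
    using c by simp
  also have "\<dots> = integrable (distr lebesgue lebesgue (elem_map A b)) (\<lambda>x. dilation_factor A b * f x)"
    using c(1) by (subst integrable_density) auto
  also have "\<dots> = integrable lebesgue (\<lambda>x. dilation_factor A b * f (elem_map A b x))"
    by (subst integrable_distr_eq) auto
  finally show "integrable lebesgue f \<longleftrightarrow> integrable lebesgue (\<lambda>x. f (elem_map A b x))"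
    using c(1) by simp
qed

section \<open>Weak derivatives\<close>

lemma integrable_continuous_compact_support:
  fixes \<psi> :: "'a::euclidean_space \<Rightarrow> real"
  assumes "continuous_on UNIV \<psi>" "compact K" "\<And>x. x \<notin> K \<Longrightarrow> \<psi> x = 0"
  shows "integrable lborel \<psi>"
proof -
  have "integrable lborel (\<lambda>x. indicator K x *\<^sub>R \<psi> x)"
    using assms by (intro borel_integrable_compact) (auto intro: continuous_on_subset)
  moreover have "(\<lambda>x. indicator K x *\<^sub>R \<psi> x) = \<psi>"
    using assms(3) by (fastforce simp: indicator_def)
  ultimately show ?thesis by simp
qed

lemma bounded_continuous_compact_support:
  fixes \<psi> :: "'a::topological_space \<Rightarrow> real"
  assumes "continuous_on UNIV \<psi>" "compact K" "\<And>x. x \<notin> K \<Longrightarrow> \<psi> x = 0"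
  obtains B where "0 \<le> B" "\<And>x. \<bar>\<psi> x\<bar> \<le> B"
proof -
  have "compact (\<psi> ` K)" using assms by (auto intro: compact_continuous_image continuous_on_subset)
  then obtain B where B: "\<And>x. x \<in> K \<Longrightarrow> \<bar>\<psi> x\<bar> \<le> B"
    using compact_imp_bounded[of "\<psi> ` K"] unfolding bounded_iff by auto
  show thesis
  proof (rule that[of "max B 0"])
    show "\<bar>\<psi> x\<bar> \<le> max B 0" for x
      using B[of x] assms(3)[of x] by (cases "x \<in> K") auto
  qed simp
qed

text \<open>The integral of a difference quotient vanishes by translation invariance.\<close>

lemma integral_pderiv1_compact_support:
  fixes \<psi> :: "real^'n::finite \<Rightarrow> real"
  assumes diff: "\<And>x. \<psi> differentiable (at x)" and cont: "continuous_on UNIV (pderiv1 i \<psi>)"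
    and K: "compact K" and supp: "\<And>x. x \<notin> K \<Longrightarrow> \<psi> x = 0"
  shows "(LINT x|lborel. pderiv1 i \<psi> x) = 0"
proof -
  let ?D = "pderiv1 i \<psi>" and ?e = "axis i 1 :: real^'n"
  \<comment> \<open>Steps of length at most 1 are used, so all difference quotients vanish outside
    this enlargement; a constant on it is the integrable majorant.\<close>
  define K' where "K' = {x + y | x y. x \<in> K \<and> y \<in> cball 0 1}"
  have K': "compact K'" unfolding K'_def by (intro compact_sums K) auto
  have c\<psi>: "continuous_on UNIV \<psi>"
    using diff by (meson continuous_at_imp_continuous_on differentiable_imp_continuous_within)
  have D0: "?D x = 0" if "x \<notin> K" for x
  proof -
    have "((\<lambda>x. 0) has_derivative (\<lambda>h. 0)) (at x)" by simp
    then have "(\<psi> has_derivative (\<lambda>h. 0)) (at x)"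
      by (rule has_derivative_transform_within_open[of _ _ _ _ "- K"])
         (use that supp compact_imp_closed[OF K] in auto)
    then show ?thesis by (simp add: pderiv1_eq)
  qed
  obtain B where B: "0 \<le> B" "\<And>x. \<bar>?D x\<bar> \<le> B"
    using bounded_continuous_compact_support[OF cont K D0] by blast
  define h where "h n = inverse (real (Suc n))" for n
  have h: "0 < h n" "h n \<le> 1" for n unfolding h_def by (auto simp: inverse_le_1_iff)
  define q where "q n x = (\<psi> (x + h n *\<^sub>R ?e) - \<psi> x) / h n" for n x
  have int\<psi>: "integrable lborel \<psi>" by (rule integrable_continuous_compact_support[OF c\<psi> K supp])
  note int_shift = lborel_integral_translation[OF int\<psi>]
  have q0: "(LINT x|lborel. q n x) = 0" for n
    unfolding q_def using int_shift int\<psi> by simp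
  have "(\<lambda>n. LINT x|lborel. q n x) \<longlonglongrightarrow> (LINT x|lborel. ?D x)"
  proof (rule integral_dominated_convergence[where w="\<lambda>x. indicator K' x *\<^sub>R B"])
    show "?D \<in> borel_measurable lborel" using cont by (simp add: borel_measurable_continuous_onI)
    show "q n \<in> borel_measurable lborel" for n
      unfolding q_def[abs_def] using int_shift(1) int\<psi> by (auto intro!: borel_measurable_divide borel_measurable_diff)
    show "integrable lborel (\<lambda>x. indicator K' x *\<^sub>R B)"
      by (intro borel_integrable_compact K') simp
    show "AE x in lborel. (\<lambda>n. q n x) \<longlonglongrightarrow> ?D x"
    proof (intro AE_I2)
      fix x
      have "((\<lambda>t. \<psi> (x + t *\<^sub>R ?e)) has_real_derivative ?D (x + 0 *\<^sub>R ?e)) (at 0)"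
        by (rule has_real_derivative_along_axis) (rule diff)
      then have "((\<lambda>t. (\<psi> (x + t *\<^sub>R ?e) - \<psi> x) / t) \<longlongrightarrow> ?D x) (at 0)"
        by (simp add: has_field_derivative_iff)
      moreover have "filterlim h (at 0) sequentially"
        unfolding filterlim_at using h LIMSEQ_inverse_real_of_nat
        by (auto simp: h_def[abs_def] intro!: always_eventually)
      ultimately show "(\<lambda>n. q n x) \<longlonglongrightarrow> ?D x"
        unfolding q_def by (rule filterlim_compose)
    qed
    show "AE x in lborel. norm (q n x) \<le> indicator K' x *\<^sub>R B" for n
    proof (intro AE_I2)
      fix x
      show "norm (q n x) \<le> indicator K' x *\<^sub>R B"
      proof (cases "x \<in> K'")
        case True
        \<comment> \<open>By the mean value theorem the difference quotient is a value of the
          derivative, hence bounded by \<open>B\<close> uniformly in n.\<close>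
        obtain z where "\<psi> (x + h n *\<^sub>R ?e) - \<psi> (x + 0 *\<^sub>R ?e) = (h n - 0) * ?D (x + z *\<^sub>R ?e)"
          using MVT2[OF h(1)[of n], of "\<lambda>t. \<psi> (x + t *\<^sub>R ?e)" "\<lambda>t. ?D (x + t *\<^sub>R ?e)"]
            has_real_derivative_along_axis[OF diff] by blast
        then have "q n x = ?D (x + z *\<^sub>R ?e)" using h(1)[of n] by (simp add: q_def)
        with True B(2) show ?thesis by simp
      next
        case False
        have "x \<notin> K" using False unfolding K'_def by force
        moreover have "x + h n *\<^sub>R ?e \<notin> K"
        proof
          assume "x + h n *\<^sub>R ?e \<in> K"
          then have "(x + h n *\<^sub>R ?e) + (- h n *\<^sub>R ?e) \<in> K'"
            unfolding K'_def using h[of n]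
            by (intro CollectI exI[of _ "x + h n *\<^sub>R ?e"] exI[of _ "- h n *\<^sub>R ?e"]) auto
          with False show False by simp
        qed
        ultimately show ?thesis using supp B(1) by (simp add: q_def)
      qed
    qed
  qed
  then show ?thesis unfolding q0 by (simp add: LIMSEQ_const_iff)
qed

lemma test_fun_support:
  assumes "test_fun U \<phi>"
  obtains K where "compact K" "K \<subseteq> U" "\<And>x. x \<notin> K \<Longrightarrow> \<phi> x = 0"
proof -
  have "\<phi> x = 0" if "x \<notin> closure {x. \<phi> x \<noteq> 0}" for x
  proof (rule ccontr)
    assume "\<phi> x \<noteq> 0"
    then have "x \<in> closure {x. \<phi> x \<noteq> 0}" by (intro closure_subset[THEN subsetD]) simp
    with that show False by simp
  qed
  moreover have "compact (closure {x. \<phi> x \<noteq> 0})" "closure {x. \<phi> x \<noteq> 0} \<subseteq> U"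
    using assms by (simp_all only: test_fun_def)
  ultimately show thesis using that by blast
qed

lemma test_fun_smooth: "test_fun U \<phi> \<Longrightarrow> smooth_fun \<phi>" by (simp add: test_fun_def)

lemma locally_integrable_indicator:
  "locally_integrable U g \<Longrightarrow> compact K \<Longrightarrow> K \<subseteq> U \<Longrightarrow> integrable lebesgue (\<lambda>x. indicator K x *\<^sub>R g x)"
  by (simp only: locally_integrable_def set_integrable_def)

text \<open>A test function is bounded with compact support K in U, so a multiple of g cut off to K
  dominates the product. Integrals over U and over the whole space may then be exchanged.\<close>

lemma integral_test_fun:
  fixes g :: "real^'n::finite \<Rightarrow> real"
  assumes U: "open U" and g: "locally_integrable U g" and \<phi>: "test_fun U \<phi>"
  shows "integrable lebesgue (\<lambda>x. g x * \<phi> x)"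
    and "integrable (lebesgue_on U) (\<lambda>x. g x * \<phi> x)"
    and "(LINT x|lebesgue_on U. g x * \<phi> x) = (LINT x|lebesgue. g x * \<phi> x)"
proof -
  obtain K where K: "compact K" "K \<subseteq> U" "\<And>x. x \<notin> K \<Longrightarrow> \<phi> x = 0" using test_fun_support[OF \<phi>] by blast
  have c: "continuous_on UNIV \<phi>" using \<phi> by (simp add: test_fun_smooth smooth_fun_continuous)
  then obtain B where B: "0 \<le> B" "\<And>x. \<bar>\<phi> x\<bar> \<le> B" using bounded_continuous_compact_support[OF c K(1,3)] by blast
  have i: "integrable lebesgue (\<lambda>x. indicator K x *\<^sub>R g x)"
    by (rule locally_integrable_indicator[OF g K(1,2)])
  have m: "\<phi> \<in> borel_measurable lebesgue" using c by (intro measurable_completion) (simp add: borel_measurable_continuous_onI)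
  have eq: "(\<lambda>x. g x * \<phi> x) = (\<lambda>x. (indicator K x *\<^sub>R g x) * \<phi> x)"
    using K(3) by (fastforce simp: indicator_def)
  show int: "integrable lebesgue (\<lambda>x. g x * \<phi> x)"
  proof (rule Bochner_Integration.integrable_bound[of _ "\<lambda>x. B * (indicator K x *\<^sub>R g x)"])
    show "integrable lebesgue (\<lambda>x. B * (indicator K x *\<^sub>R g x))" using i by simp
    show "(\<lambda>x. g x * \<phi> x) \<in> borel_measurable lebesgue"
      unfolding eq using i m by (intro borel_measurable_times) auto
    show "AE x in lebesgue. norm (g x * \<phi> x) \<le> norm (B * (indicator K x *\<^sub>R g x))"
    proof (intro always_eventually allI)
      fix x show "norm (g x * \<phi> x) \<le> norm (B * (indicator K x *\<^sub>R g x))"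
        using B(1) mult_right_mono[OF B(2)[of x], of "\<bar>g x\<bar>"] K(3)[of x]
        by (cases "x \<in> K") (simp_all add: abs_mult mult.commute)
    qed
  qed
  have eq2: "(\<lambda>x. indicator U x *\<^sub>R (g x * \<phi> x)) = (\<lambda>x. g x * \<phi> x)"
  proof
    fix x show "indicator U x *\<^sub>R (g x * \<phi> x) = g x * \<phi> x"
      using K(2) K(3)[of x] by (cases "x \<in> K") (auto simp: indicator_def)
  qed
  show "integrable (lebesgue_on U) (\<lambda>x. g x * \<phi> x)"
    using U int by (subst integrable_restrict_space) (simp_all only: eq2, auto)
  show "(LINT x|lebesgue_on U. g x * \<phi> x) = (LINT x|lebesgue. g x * \<phi> x)"
    using U by (subst integral_restrict_space) (simp_all only: eq2, auto)
qed

lemma locally_integrable_continuous: "continuous_on U f \<Longrightarrow> locally_integrable U f"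
  unfolding locally_integrable_def set_integrable_def
proof (intro allI impI, elim conjE)
  fix K assume "continuous_on U f" "compact K" "K \<subseteq> U"
  then have "integrable lborel (\<lambda>x. indicator K x *\<^sub>R f x)"
    using borel_integrable_compact[of K f] continuous_on_subset by blast
  then show "integrable lebesgue (\<lambda>x. indicator K x *\<^sub>R f x)"
    using integrable_completion by blast
qed

lemma is_weak_deriv_iff:
  "is_weak_deriv U (count_list js) f g \<longleftrightarrow> locally_integrable U f \<and> locally_integrable U g \<and>
    (\<forall>\<phi>. test_fun U \<phi> \<longrightarrow> (LINT x|lebesgue_on U. f x * foldr pderiv1 js \<phi> x) =
        (-1) ^ length js * (LINT x|lebesgue_on U. g x * \<phi> x))"
  unfolding is_weak_deriv_def by (simp add: mpderiv_count_list test_fun_smooth mdegree_count_list)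

text \<open>The product of \<open>f\<close> and the test function is smooth with compact support, so
  the integral of its derivative vanishes; the Leibniz rule splits that integral.\<close>

lemma integration_by_parts_test_fun:
  fixes f :: "real^'n::finite \<Rightarrow> real"
  assumes U: "open U" and f: "smooth_fun f" and \<phi>: "test_fun U \<phi>"
  shows "(LINT x|lebesgue_on U. f x * pderiv1 i \<phi> x) = - (LINT x|lebesgue_on U. pderiv1 i f x * \<phi> x)"
proof -
  note cont = smooth_fun_continuous and s\<phi> = test_fun_smooth[OF \<phi>]
  obtain K where K: "compact K" "K \<subseteq> U" "\<And>x. x \<notin> K \<Longrightarrow> \<phi> x = 0" using test_fun_support[OF \<phi>] by blast
  have \<phi>': "test_fun U (pderiv1 i \<phi>)" using test_fun_foldr[OF \<phi>, of "[i]"] by simp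
  have li: "locally_integrable U f" "locally_integrable U (pderiv1 i f)"
    using f by (auto intro!: locally_integrable_continuous cont smooth_fun_pderiv1)
  note 1 = integral_test_fun[OF U li(1) \<phi>'] and 2 = integral_test_fun[OF U li(2) \<phi>]
  have eq: "pderiv1 i (\<lambda>x. f x * \<phi> x) = (\<lambda>x. f x * pderiv1 i \<phi> x + pderiv1 i f x * \<phi> x)"
    by (rule ext) (intro pderiv1_mult smooth_fun_differentiable f s\<phi>)
  have "(LINT x|lborel. pderiv1 i (\<lambda>x. f x * \<phi> x) x) = 0"
  proof (rule integral_pderiv1_compact_support[OF _ _ K(1)])
    show "continuous_on UNIV (pderiv1 i (\<lambda>x. f x * \<phi> x))"
      using f s\<phi> by (intro cont smooth_fun_pderiv1 smooth_fun_mult)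
  qed (use K(3) f s\<phi> in \<open>auto intro!: smooth_fun_differentiable smooth_fun_mult\<close>)
  moreover have "(LINT x|lborel. pderiv1 i (\<lambda>x. f x * \<phi> x) x) = (LINT x|lebesgue. pderiv1 i (\<lambda>x. f x * \<phi> x) x)"
    using f s\<phi> by (intro integral_completion[symmetric])
      (simp add: borel_measurable_continuous_onI cont smooth_fun_pderiv1 smooth_fun_mult)
  ultimately have "(LINT x|lebesgue. f x * pderiv1 i \<phi> x) + (LINT x|lebesgue. pderiv1 i f x * \<phi> x) = 0"
    using 1(1) 2(1) by (simp add: eq)
  then show ?thesis unfolding 1(3) 2(3) by linarith
qed

text \<open>One derivative is moved at a time, each with a sign. It lands innermost on
  \<open>f\<close>, so commutation of derivatives is needed to restore the order of the
  list.\<close>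

lemma smooth_fun_is_weak_deriv:
  assumes U: "open U" and f: "smooth_fun f"
  shows "is_weak_deriv U (count_list js) f (foldr pderiv1 js f)"
proof -
  have "(LINT x|lebesgue_on U. f x * foldr pderiv1 js \<phi> x) = (-1) ^ length js * (LINT x|lebesgue_on U. foldr pderiv1 js f x * \<phi> x)"
    if "test_fun U \<phi>" for \<phi>
    using f
  proof (induction js arbitrary: f)
    case (Cons i js)
    show ?case
      using integration_by_parts_test_fun[OF U Cons.prems test_fun_foldr[OF that]] 
        Cons.IH[OF smooth_fun_pderiv1[OF Cons.prems]]
      by (simp add: foldr_pderiv1_commute[OF Cons.prems])
  qed simp
  then show ?thesis
    using f unfolding is_weak_deriv_iff by (auto intro!: locally_integrable_continuous smooth_fun_continuous smooth_fun_foldr)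
qed


subsection \<open>Uniqueness\<close>

text \<open>Dynkin's argument: open boxes are closed under intersection and generate the Borel sets,
  and the sets over which f integrates to zero are closed under complements and countable disjoint
  unions. An integrable function with zero integral over every Borel set vanishes almost
  everywhere.\<close>

lemma AE_zero_if_box_integrals_zero:
  fixes f :: "'a::euclidean_space \<Rightarrow> real"
  assumes f: "integrable lborel f" and sup: "\<And>x. x \<notin> box a b \<Longrightarrow> f x = 0"
    and box: "\<And>c d. (LINT x:box c d|lborel. f x) = 0"
  shows "AE x in lborel. f x = 0"
proof (rule sigma_finite_measure.density_zero[OF sigma_finite_lborel f])
  fix A :: "'a set" assume "A \<in> sets lborel"
  then have A: "A \<in> sigma_sets UNIV (range (\<lambda>(a, b). box a b))"
    by (subst (asm) sets_lborel, subst (asm) borel_eq_box) simp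
  have Int: "Int_stable (range (\<lambda>(a, b). box a b :: 'a set))"
    by (auto simp: Int_stable_def box_Int_box)
  have Pow: "range (\<lambda>(a, b). box a b :: 'a set) \<subseteq> Pow UNIV" by simp
  have si: "set_integrable lborel X f" if "X \<in> sets borel" for X
    using that f unfolding set_integrable_def by (intro integrable_mult_indicator) auto
  have borel: "X \<in> sets borel" if "X \<in> sigma_sets UNIV (range (\<lambda>(a, b). box a b :: 'a set))" for X
    using that by (subst borel_eq_box) simp
  show "(LINT x:A|lborel. f x) = 0"
    using Int Pow A
  proof (induction rule: sigma_sets_induct_disjoint)
    case (basic A)
    then show ?case using box by auto
  next
    case empty
    then show ?case by (simp add: set_lebesgue_integral_def)
  next
    case (compl A)
    \<comment> \<open>For complements the total integral must vanish; it does because f lives on a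
      single box.\<close>
    have "(LINT x|lborel. f x) = (LINT x:box a b|lborel. f x)"
      unfolding set_lebesgue_integral_def
      by (intro Bochner_Integration.integral_cong refl) (use sup in \<open>fastforce simp: indicator_def\<close>)
    then have "(LINT x:UNIV|lborel. f x) = 0" using box by (simp add: set_lebesgue_integral_def)
    moreover have "(LINT x:A \<union> (UNIV - A)|lborel. f x) = (LINT x:A|lborel. f x) + (LINT x:UNIV - A|lborel. f x)"
      using borel[OF compl(1)] by (intro set_integral_Un si) auto
    ultimately show ?case using compl by (simp add: Un_Diff)
  next
    case (union A)
    have "(LINT x:(\<Union>i. A i)|lborel. f x) = (\<Sum>i. (LINT x:A i|lborel. f x))"
    proof (rule lebesgue_integral_countable_add)
      show A: "A i \<in> sets lborel" for i using borel union(2) by auto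
      show "A i \<inter> A j = {}" if "i \<noteq> j" for i j using union(1) that by (auto simp: disjoint_family_on_def)
      show "set_integrable lborel (\<Union>i. A i) f" using A by (intro si) auto
    qed
    then show ?case using union by simp
  qed
qed

text \<open>Reduction to a Borel representative, cut off outside the box so that it keeps the
  support condition at every point.\<close>

lemma AE_zero_if_box_integrals_zero_lebesgue:
  fixes f :: "'a::euclidean_space \<Rightarrow> real"
  assumes f: "integrable lebesgue f" and sup: "\<And>x. x \<notin> box a b \<Longrightarrow> f x = 0"
    and box: "\<And>c d. (LINT x:box c d|lebesgue. f x) = 0"
  shows "AE x in lebesgue. f x = 0"
proof -
  obtain f0 where f0: "f0 \<in> borel_measurable lborel" "AE x in lborel. f x = f0 x"
    using completion_ex_borel_measurable_real[of f lborel] f by auto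
  define f1 where "f1 x = indicator (box a b) x * f0 x" for x
  have [measurable]: "f0 \<in> borel_measurable borel" using f0(1) by simp
  have m1[measurable]: "f1 \<in> borel_measurable borel" unfolding f1_def[abs_def] by simp
  have ae: "AE x in lborel. f x = f1 x"
    using f0(2) by eventually_elim (use sup in \<open>auto simp: f1_def indicator_def\<close>)
  have ae': "AE x in lebesgue. f x = f1 x" using ae by (rule AE_completion)
  have m1': "f1 \<in> borel_measurable lebesgue" by (intro measurable_completion) simp
  have "integrable lebesgue f1"
    using f integrable_cong_AE[OF _ m1' ae'] by auto
  then have i1: "integrable lborel f1" by (subst (asm) integrable_completion) auto
  have "AE x in lborel. f1 x = 0"
  proof (rule AE_zero_if_box_integrals_zero[OF i1])
    show "f1 x = 0" if "x \<notin> box a b" for x using that by (simp add: f1_def)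
    show "(LINT x:box c d|lborel. f1 x) = 0" for c d
    proof -
      have "(LINT x:box c d|lborel. f1 x) = (LINT x:box c d|lebesgue. f1 x)"
        unfolding set_lebesgue_integral_def by (subst integral_completion) auto
      also have "\<dots> = (LINT x:box c d|lebesgue. f x)"
        unfolding set_lebesgue_integral_def using ae' f m1'
        by (intro integral_cong_AE borel_measurable_scaleR borel_measurable_indicator)
           (auto elim!: eventually_mono)
      finally show ?thesis using box by simp
    qed
  qed
  then have "AE x in lebesgue. f1 x = 0" by (rule AE_completion)
  with ae' show ?thesis by eventually_elim simp
qed

text \<open>The bumps are admissible test functions and tend to the indicator of the box with values
  in [0, 1]; dominated convergence gives the integral of g over the box.\<close>

lemma fundamental_lemma_box:
  fixes g :: "real^'n::finite \<Rightarrow> real"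
  assumes U: "open U" and g: "locally_integrable U g"
    and z: "\<And>\<phi>. test_fun U \<phi> \<Longrightarrow> (LINT x|lebesgue_on U. g x * \<phi> x) = 0"
    and sub: "cbox a b \<subseteq> U"
  shows "(LINT x|lebesgue. indicator (box a b) x * g x) = 0"
proof -
  let ?\<phi> = "\<lambda>m. box_bump (real (Suc m)) a b"
  have i: "integrable lebesgue (\<lambda>x. indicator (cbox a b) x *\<^sub>R g x)"
    by (rule locally_integrable_indicator[OF g compact_cbox sub])
  have i2: "integrable lebesgue (\<lambda>x. indicator (box a b) x * (indicator (cbox a b) x *\<^sub>R g x))"
    using integrable_mult_indicator[OF _ i, of "box a b"] by simp
  have eq: "indicator (box a b) x * (indicator (cbox a b) x *\<^sub>R g x) = indicator (box a b) x * g x" for x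
    using box_subset_cbox[of a b] by (auto simp: indicator_def)
  have test: "test_fun U (?\<phi> m)" for m by (rule test_fun_box_bump) (use sub in auto)
  have 0: "(LINT x|lebesgue. g x * ?\<phi> m x) = 0" for m
    using z[OF test] integral_test_fun(3)[OF U g test] by simp
  have "(\<lambda>m. LINT x|lebesgue. g x * ?\<phi> m x) \<longlonglongrightarrow> (LINT x|lebesgue. indicator (box a b) x * g x)"
  proof (rule integral_dominated_convergence[where w="\<lambda>x. \<bar>indicator (cbox a b) x *\<^sub>R g x\<bar>"])
    show "(\<lambda>x. indicator (box a b) x * g x) \<in> borel_measurable lebesgue" using i2 unfolding eq by auto
    show "(\<lambda>x. g x * ?\<phi> m x) \<in> borel_measurable lebesgue" for m
      using integral_test_fun(1)[OF U g test] by auto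
    show "integrable lebesgue (\<lambda>x. \<bar>indicator (cbox a b) x *\<^sub>R g x\<bar>)" using i by simp
    show "AE x in lebesgue. (\<lambda>m. g x * ?\<phi> m x) \<longlonglongrightarrow> indicator (box a b) x * g x"
    proof (intro always_eventually allI)
      fix x show "(\<lambda>m. g x * ?\<phi> m x) \<longlonglongrightarrow> indicator (box a b) x * g x"
        using tendsto_mult[OF tendsto_const box_bump_tendsto, of "g x" a b x] by (simp add: mult.commute)
    qed
    show "AE x in lebesgue. norm (g x * ?\<phi> m x) \<le> \<bar>indicator (cbox a b) x *\<^sub>R g x\<bar>" for m
    proof (intro always_eventually allI)
      fix x
      show "norm (g x * ?\<phi> m x) \<le> \<bar>indicator (cbox a b) x *\<^sub>R g x\<bar>"
      proof (cases "x \<in> box a b")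
        case True
        then have "x \<in> cbox a b" using box_subset_cbox by blast
        then show ?thesis using box_bump_bounds[of "real (Suc m)" a b x] by (simp add: abs_mult mult_left_le)
      next
        case False
        then have "?\<phi> m x = 0" using box_bump_nonzero[of "real (Suc m)" a b x] by auto
        then show ?thesis by simp
      qed
    qed
  qed
  then show ?thesis unfolding 0 by (simp add: LIMSEQ_const_iff)
qed

lemma fundamental_lemma_cbox:
  fixes g :: "real^'n::finite \<Rightarrow> real"
  assumes U: "open U" and g: "locally_integrable U g"
    and z: "\<And>\<phi>. test_fun U \<phi> \<Longrightarrow> (LINT x|lebesgue_on U. g x * \<phi> x) = 0"
    and sub: "cbox a b \<subseteq> U"
  shows "AE x in lebesgue. x \<in> cbox a b \<longrightarrow> g x = 0"
proof -
  have i: "integrable lebesgue (\<lambda>x. indicator (cbox a b) x *\<^sub>R g x)"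
    by (rule locally_integrable_indicator[OF g compact_cbox sub])
  have eq: "indicator (box a b) x * (indicator (cbox a b) x *\<^sub>R g x) = indicator (box a b) x * g x" for x
    using box_subset_cbox[of a b] by (auto simp: indicator_def)
  have i2: "integrable lebesgue (\<lambda>x. indicator (box a b) x * g x)"
    using integrable_mult_indicator[OF _ i, of "box a b"] unfolding real_scaleR_def eq[unfolded real_scaleR_def] by simp
  have "AE x in lebesgue. indicator (box a b) x * g x = 0"
  proof (rule AE_zero_if_box_integrals_zero_lebesgue[OF i2, of a b])
    fix c d
    \<comment> \<open>An arbitrary box may leave U. Its intersection with the given one is again a
      box, and the closure of this stays inside U.\<close>
    obtain a' b' where ab: "box a b \<inter> box c d = box a' b'" by (simp add: box_Int_box) 
    have "(LINT x|lebesgue. indicator (box a' b') x * g x) = 0"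
    proof (cases "box a' b' = {}")
      case False
      then have "cbox a' b' = closure (box a' b')" by (simp add: closure_box)
      also have "\<dots> \<subseteq> cbox a b"
        using ab box_subset_cbox[of a b] by (intro closure_minimal) auto
      finally have "cbox a' b' \<subseteq> U" using sub by simp
      with z show ?thesis by (rule fundamental_lemma_box[OF U g])
    qed simp
    moreover have "indicator (box c d) x *\<^sub>R (indicator (box a b) x * g x) = indicator (box a' b') x * g x" for x
      unfolding ab[symmetric] by (auto simp: indicator_def)
    ultimately show "(LINT x:box c d|lebesgue. indicator (box a b) x * g x) = 0"
      by (simp only: set_lebesgue_integral_def)
  qed auto
  moreover have "AE x in lebesgue. x \<notin> cbox a b - box a b"
    using negligible_frontier_interval[of a b] by (simp only: negligible_iff_null_sets AE_not_in)
  ultimately show ?thesis by eventually_elim (auto simp: indicator_def split: if_splits)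
qed

text \<open>Local integrability gives integrability on compact boxes only; U is a countable union of
  closed boxes, so the exceptional sets still form a null set.\<close>

lemma fundamental_lemma:
  fixes g :: "real^'n::finite \<Rightarrow> real"
  assumes U: "open U" and g: "locally_integrable U g"
    and z: "\<And>\<phi>. test_fun U \<phi> \<Longrightarrow> (LINT x|lebesgue_on U. g x * \<phi> x) = 0"
  shows "AE x in lebesgue_on U. g x = 0"
proof -
  obtain D where D: "countable D" "D \<subseteq> Pow U" "\<And>X. X \<in> D \<Longrightarrow> \<exists>a b. X = cbox a b" "\<Union>D = U"
    using open_countable_Union_open_cbox[OF U] by metis
  have *: "AE x in lebesgue. x \<in> X \<longrightarrow> g x = 0" if XD: "X \<in> D" for X
  proof -
    obtain a b where X: "X = cbox a b" using D(3)[OF XD] by blast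
    have "cbox a b \<subseteq> U" using D(2) XD X by blast
    then show ?thesis unfolding X by (rule fundamental_lemma_cbox[OF U g z, rotated])
  qed
  then have "AE x in lebesgue. \<forall>X\<in>D. x \<in> X \<longrightarrow> g x = 0"
    unfolding AE_ball_countable[OF D(1)] by (intro ballI *)
  then have "AE x in lebesgue. x \<in> U \<longrightarrow> g x = 0"
    by eventually_elim (use D(4) in blast)
  then show ?thesis using U by (subst AE_restrict_space_iff) auto
qed

lemma is_weak_deriv_unique:
  assumes U: "open U" and g: "is_weak_deriv U \<alpha> f g" and h: "is_weak_deriv U \<alpha> f h"
  shows "AE x in lebesgue_on U. g x = h x"
proof -
  have li: "locally_integrable U g" "locally_integrable U h" using g h by (auto simp: is_weak_deriv_def)
  then have li': "locally_integrable U (\<lambda>x. g x - h x)"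
    unfolding locally_integrable_def by (auto intro: set_integral_diff)
  have "AE x in lebesgue_on U. g x - h x = 0"
  proof (rule fundamental_lemma[OF U li'])
    fix \<phi> assume \<phi>: "test_fun U \<phi>"
    have "(LINT x|lebesgue_on U. g x * \<phi> x) = (LINT x|lebesgue_on U. h x * \<phi> x)"
      using g h \<phi> by (simp add: is_weak_deriv_def)
    then show "(LINT x|lebesgue_on U. (g x - h x) * \<phi> x) = 0"
      using integral_test_fun(2)[OF U _ \<phi>] li by (simp add: left_diff_distrib)
  qed
  then show ?thesis by simp
qed

lemma weak_deriv_works: "is_weak_deriv U \<alpha> f g \<Longrightarrow> is_weak_deriv U \<alpha> f (weak_deriv U \<alpha> f)"
  unfolding weak_deriv_def by (rule someI_ex[of "is_weak_deriv U \<alpha> f"]) blast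

section \<open>Lebesgue norms\<close>

lemma borel_measurable_lebesgue_on_AE:
  fixes f g :: "'a::euclidean_space \<Rightarrow> real"
  assumes U: "U \<in> sets lebesgue" and f: "f \<in> borel_measurable (lebesgue_on U)" and ae: "AE x in lebesgue_on U. f x = g x"
  shows "g \<in> borel_measurable (lebesgue_on U)"
proof -
  have "AE x in lebesgue. x \<in> U \<longrightarrow> f x = g x"
    using ae U by (subst (asm) AE_restrict_space_iff) auto
  then have "AE x in lebesgue. (if x \<in> U then f x else 0) = (if x \<in> U then g x else 0)"
    by eventually_elim auto
  moreover have "(\<lambda>x. if x \<in> U then f x else 0) \<in> borel_measurable lebesgue"
    using f borel_measurable_if[OF U] by blast
  ultimately have "(\<lambda>x. if x \<in> U then g x else 0) \<in> borel_measurable lebesgue"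
    by (rule borel_measurable_AE[rotated])
  then show ?thesis using borel_measurable_if[OF U] by blast
qed

text \<open>All functions and weak derivatives met below are essentially bounded on sets of finite
  measure, so \<open>Lp_space \<infinity>\<close> is the working space for norms of every
  exponent.\<close>

lemma Lp_space_infinity_iff:
  "f \<in> Lp_space \<infinity> U \<longleftrightarrow> f \<in> borel_measurable (lebesgue_on U) \<and> (\<exists>B. AE x in lebesgue_on U. \<bar>f x\<bar> \<le> B)"
proof (intro iffI conjI; (elim conjE)?)
  assume f: "f \<in> Lp_space \<infinity> U"
  then show "f \<in> borel_measurable (lebesgue_on U)" by (simp add: Lp_space_def)
  have fin: "esssup (lebesgue_on U) (\<lambda>x. ereal \<bar>f x\<bar>) < \<infinity>" using f by (simp add: Lp_space_def)
  have "ereal \<bar>f x\<bar> \<le> ereal (real_of_ereal (esssup (lebesgue_on U) (\<lambda>x. ereal \<bar>f x\<bar>)))"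
    if "ereal \<bar>f x\<bar> \<le> esssup (lebesgue_on U) (\<lambda>x. ereal \<bar>f x\<bar>)" for x
    using that fin by (cases "esssup (lebesgue_on U) (\<lambda>x. ereal \<bar>f x\<bar>)") auto
  then have "AE x in lebesgue_on U. \<bar>f x\<bar> \<le> real_of_ereal (esssup (lebesgue_on U) (\<lambda>x. ereal \<bar>f x\<bar>))"
    using esssup_AE[of "\<lambda>x. ereal \<bar>f x\<bar>" "lebesgue_on U"] by (auto elim!: eventually_mono)
  then show "\<exists>B. AE x in lebesgue_on U. \<bar>f x\<bar> \<le> B" by blast
next
  assume f: "f \<in> borel_measurable (lebesgue_on U)" "\<exists>B. AE x in lebesgue_on U. \<bar>f x\<bar> \<le> B"
  then obtain B where "AE x in lebesgue_on U. ereal \<bar>f x\<bar> \<le> ereal B" by auto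
  then have "esssup (lebesgue_on U) (\<lambda>x. ereal \<bar>f x\<bar>) \<le> ereal B" using f by (intro esssup_I) auto
  then have "esssup (lebesgue_on U) (\<lambda>x. ereal \<bar>f x\<bar>) < \<infinity>" using le_less_trans by fastforce
  then show "f \<in> Lp_space \<infinity> U" using f by (simp add: Lp_space_def)
qed

lemma Lp_norm_infinity_le:
  assumes "f \<in> borel_measurable (lebesgue_on U)" "AE x in lebesgue_on U. \<bar>f x\<bar> \<le> a" "0 \<le> a"
  shows "Lp_norm \<infinity> U f \<le> a"
proof -
  have "esssup (lebesgue_on U) (\<lambda>x. ereal \<bar>f x\<bar>) \<le> ereal a" using assms by (intro esssup_I) auto
  then show ?thesis using assms(3)
    by (cases "esssup (lebesgue_on U) (\<lambda>x. ereal \<bar>f x\<bar>)") (auto simp: Lp_norm_def)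
qed

lemma AE_le_Lp_norm_infinity:
  assumes "f \<in> Lp_space \<infinity> U"
  shows "AE x in lebesgue_on U. \<bar>f x\<bar> \<le> Lp_norm \<infinity> U f"
proof -
  have fin: "esssup (lebesgue_on U) (\<lambda>x. ereal \<bar>f x\<bar>) < \<infinity>" using assms by (simp add: Lp_space_def)
  have "\<bar>f x\<bar> \<le> Lp_norm \<infinity> U f"
    if "ereal \<bar>f x\<bar> \<le> esssup (lebesgue_on U) (\<lambda>x. ereal \<bar>f x\<bar>)" for x
    using that fin by (cases "esssup (lebesgue_on U) (\<lambda>x. ereal \<bar>f x\<bar>)") (auto simp: Lp_norm_def)
  then show ?thesis
    using esssup_AE[of "\<lambda>x. ereal \<bar>f x\<bar>" "lebesgue_on U"] by (auto elim!: eventually_mono)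
qed

text \<open>Only a negative finite essential supremum could violate this. The almost sure bound by
  it is absurd at each point, hence implies a bound by -\<infinity>, so the supremum would be
  -\<infinity> after all; and \<open>real_of_ereal\<close> sends -\<infinity> to 0.\<close>

lemma Lp_norm_nonneg: "0 \<le> Lp_norm p U f"
proof (cases "p = \<infinity>")
  case True
  let ?s = "esssup (lebesgue_on U) (\<lambda>x. ereal \<bar>f x\<bar>)"
  have "0 \<le> real_of_ereal ?s"
  proof (rule ccontr)
    assume neg: "\<not> 0 \<le> real_of_ereal ?s"
    then have s: "?s < 0" "?s \<noteq> - \<infinity>" by (cases ?s; auto)+
    then have m: "(\<lambda>x. ereal \<bar>f x\<bar>) \<in> borel_measurable (lebesgue_on U)"
      using esssup_non_measurable[of "\<lambda>x. ereal \<bar>f x\<bar>" "lebesgue_on U"] by (cases "(\<lambda>x. ereal \<bar>f x\<bar>) \<in> borel_measurable (lebesgue_on U)") (auto simp: top_ereal_def)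
    have "ereal \<bar>f x\<bar> \<le> - \<infinity>" if "ereal \<bar>f x\<bar> \<le> ?s" for x
    proof -
      have "0 \<le> ereal \<bar>f x\<bar>" by simp
      also note that
      also note s(1)
      finally show ?thesis by simp
    qed
    then have "AE x in lebesgue_on U. ereal \<bar>f x\<bar> \<le> - \<infinity>"
      using esssup_AE[of "\<lambda>x. ereal \<bar>f x\<bar>" "lebesgue_on U"] by (auto elim!: eventually_mono)
    then have "?s \<le> - \<infinity>" using m by (rule esssup_I[rotated])
    with s show False by simp
  qed
  then show ?thesis using True by (simp add: Lp_norm_def)
qed (simp add: Lp_norm_def)

lemma Lp_norm_cong_AE:
  assumes f: "f \<in> borel_measurable (lebesgue_on U)" and U: "U \<in> sets lebesgue" and ae: "AE x in lebesgue_on U. f x = g x"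
  shows "Lp_norm p U f = Lp_norm p U g"
proof -
  have g: "g \<in> borel_measurable (lebesgue_on U)" using borel_measurable_lebesgue_on_AE[OF U f ae] .
  have 1: "esssup (lebesgue_on U) (\<lambda>x. ereal \<bar>f x\<bar>) = esssup (lebesgue_on U) (\<lambda>x. ereal \<bar>g x\<bar>)"
    using f g ae by (intro esssup_AE_cong) auto
  have 2: "(LINT x|lebesgue_on U. \<bar>f x\<bar> powr real_of_ereal p) = (LINT x|lebesgue_on U. \<bar>g x\<bar> powr real_of_ereal p)"
    using f g ae by (intro integral_cong_AE) auto
  show ?thesis unfolding Lp_norm_def 1 2 by simp
qed

lemma Lp_space_infinity_cong_AE:
  assumes "f \<in> Lp_space \<infinity> U" and U: "U \<in> sets lebesgue" and ae: "AE x in lebesgue_on U. f x = g x"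
  shows "g \<in> Lp_space \<infinity> U"
proof -
  obtain B where "AE x in lebesgue_on U. \<bar>f x\<bar> \<le> B" using assms(1) by (auto simp: Lp_space_infinity_iff)
  with ae have "AE x in lebesgue_on U. \<bar>g x\<bar> \<le> B" by eventually_elim simp
  then show ?thesis using assms(1) borel_measurable_lebesgue_on_AE[OF U _ ae] by (auto simp: Lp_space_infinity_iff)
qed

lemma exponent_cases:
  assumes "1 \<le> (p::ereal)" obtains "p = \<infinity>" | r where "p = ereal r" "1 \<le> r"
  using assms by (cases p) auto

lemma rinv_simps [simp]: "rinv \<infinity> = 0" "rinv (ereal r) = 1 / r"
  unfolding rinv_def by (simp_all add: divide_ereal_def inverse_eq_divide) (cases "r = 0"; simp)?

lemma rinv_bounds: "1 \<le> p \<Longrightarrow> 0 \<le> rinv p" "1 \<le> p \<Longrightarrow> rinv p \<le> 1"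
  by (elim exponent_cases; simp)+

lemma Lp_norm_ereal: "Lp_norm (ereal r) U f = (LINT x|lebesgue_on U. \<bar>f x\<bar> powr r) powr (1 / r)"
  by (simp add: Lp_norm_def)

lemma Lp_space_infinity_integrable_powr:
  assumes U: "U \<in> lmeasurable" and f: "f \<in> Lp_space \<infinity> U" and r: "0 < r"
  shows "integrable (lebesgue_on U) (\<lambda>x. \<bar>f x\<bar> powr r)"
proof -
  interpret finite_measure "lebesgue_on U" using U by (rule finite_measure_lebesgue_on)
  obtain B where B: "AE x in lebesgue_on U. \<bar>f x\<bar> \<le> B" and m: "f \<in> borel_measurable (lebesgue_on U)"
    using f by (auto simp: Lp_space_infinity_iff)
  show ?thesis
  proof (rule integrable_const_bound)
    show "AE x in lebesgue_on U. norm (\<bar>f x\<bar> powr r) \<le> B powr r"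
      using B by eventually_elim (use r in \<open>auto intro!: powr_mono2\<close>)
  qed (use m in auto)
qed

lemma Lp_norm_ereal_le:
  assumes "0 < r" "(LINT x|lebesgue_on U. \<bar>f x\<bar> powr r) \<le> a powr r" "0 \<le> a"
  shows "Lp_norm (ereal r) U f \<le> a"
proof -
  have "(LINT x|lebesgue_on U. \<bar>f x\<bar> powr r) powr (1 / r) \<le> (a powr r) powr (1 / r)"
    using assms by (intro powr_mono2) (auto intro!: integral_nonneg_AE)
  then show ?thesis using assms by (simp add: Lp_norm_ereal powr_powr)
qed

lemma integral_powr_Lp_norm:
  assumes "0 < r" shows "(LINT x|lebesgue_on U. \<bar>f x\<bar> powr r) = Lp_norm (ereal r) U f powr r"
  using assms by (simp add: Lp_norm_ereal powr_powr integral_nonneg_AE)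

text \<open>At the endpoint 0 convexity reduces to s^r \<le> s for 0 < s < 1.\<close>

lemma powr_convex_nonneg:
  assumes "1 \<le> r" shows "convex_on {0..} (\<lambda>x::real. x powr r)"
proof (rule convex_onI)
  fix t x y :: real assume t: "0 < t" "t < 1" and xy: "x \<in> {0..}" "y \<in> {0..}"
  have u: "(s * z) powr r \<le> s * z powr r" if "0 < s" "s < 1" "0 \<le> z" for s z
  proof -
    have "s powr r \<le> s powr 1" using that assms by (intro powr_mono') auto
    then show ?thesis using that by (simp add: powr_mult mult_right_mono)
  qed
  show "((1 - t) *\<^sub>R x + t *\<^sub>R y) powr r \<le> (1 - t) * x powr r + t * y powr r"
  proof (cases "x = 0 \<or> y = 0")
    case True
    then show ?thesis using t xy u[of t y] u[of "1 - t" x] assms by auto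
  next
    case False
    then show ?thesis using convex_onD[OF powr_convex[OF assms], of t x y] t xy by simp
  qed
qed simp

text \<open>Jensen's inequality for t^r with the normalised weights |c_i| / L, where L is the sum of
  all |c_i|.\<close>

lemma powr_sum_le:
  fixes c y :: "'i \<Rightarrow> real"
  assumes I: "finite I" and r: "1 \<le> r"
  shows "\<bar>\<Sum>i\<in>I. c i * y i\<bar> powr r \<le> (\<Sum>i\<in>I. \<bar>c i\<bar>) powr (r - 1) * (\<Sum>i\<in>I. \<bar>c i\<bar> * \<bar>y i\<bar> powr r)"
proof (cases "(\<Sum>i\<in>I. \<bar>c i\<bar>) = 0")
  case True
  then have "c i = 0" if "i \<in> I" for i using I that by (simp add: sum_nonneg_eq_0_iff)
  then show ?thesis using r by simp
next
  case False
  define L where "L = (\<Sum>i\<in>I. \<bar>c i\<bar>)"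
  have L: "L > 0" using False sum_nonneg[of I "\<lambda>i. \<bar>c i\<bar>"] unfolding L_def by linarith
  have "\<bar>\<Sum>i\<in>I. c i * y i\<bar> \<le> (\<Sum>i\<in>I. \<bar>c i\<bar> * \<bar>y i\<bar>)"
    by (rule order_trans[OF sum_abs]) (simp add: abs_mult)
  also have "\<dots> = L * (\<Sum>i\<in>I. (\<bar>c i\<bar> / L) *\<^sub>R \<bar>y i\<bar>)"
    using L by (simp add: sum_distrib_left)
  finally have "\<bar>\<Sum>i\<in>I. c i * y i\<bar> powr r \<le> (L * (\<Sum>i\<in>I. (\<bar>c i\<bar> / L) *\<^sub>R \<bar>y i\<bar>)) powr r"
    using r by (intro powr_mono2) auto
  also have "\<dots> = L powr r * (\<Sum>i\<in>I. (\<bar>c i\<bar> / L) *\<^sub>R \<bar>y i\<bar>) powr r"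
    using L by (subst powr_mult) (auto intro!: sum_nonneg)
  also have "\<dots> \<le> L powr r * (\<Sum>i\<in>I. (\<bar>c i\<bar> / L) * \<bar>y i\<bar> powr r)"
  proof (intro mult_left_mono convex_on_sum[OF I _ powr_convex_nonneg[OF r]])
    show "I \<noteq> {}" using False by auto
    show "(\<Sum>i\<in>I. \<bar>c i\<bar> / L) = 1" using L by (simp add: sum_divide_distrib[symmetric] L_def[symmetric])
  qed (use L in auto)
  also have "\<dots> = L powr (r - 1) * (\<Sum>i\<in>I. \<bar>c i\<bar> * \<bar>y i\<bar> powr r)"
    using L by (simp add: sum_divide_distrib[symmetric] powr_diff)
  finally show ?thesis unfolding L_def .
qed

lemma Lp_space_infinity_sum:
  assumes I: "finite I" and g: "\<And>i. i \<in> I \<Longrightarrow> g i \<in> Lp_space \<infinity> U"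
  shows "(\<lambda>x. \<Sum>i\<in>I. c i * g i x) \<in> Lp_space \<infinity> U"
proof -
  have "AE x in lebesgue_on U. \<forall>i\<in>I. \<bar>g i x\<bar> \<le> Lp_norm \<infinity> U (g i)"
    using I g AE_le_Lp_norm_infinity by (subst AE_finite_all) auto
  then have "AE x in lebesgue_on U. \<bar>\<Sum>i\<in>I. c i * g i x\<bar> \<le> (\<Sum>i\<in>I. \<bar>c i\<bar> * Lp_norm \<infinity> U (g i))"
  proof eventually_elim
    case (elim x)
    show ?case
      by (rule order_trans[OF sum_abs]) (use elim in \<open>auto simp: abs_mult intro!: sum_mono mult_left_mono\<close>)
  qed
  moreover have "(\<lambda>x. \<Sum>i\<in>I. c i * g i x) \<in> borel_measurable (lebesgue_on U)"
    using g by (intro borel_measurable_sum borel_measurable_times borel_measurable_const) (auto simp: Lp_space_infinity_iff)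
  ultimately show ?thesis by (auto simp: Lp_space_infinity_iff)
qed

text \<open>Takes the place of Minkowski's inequality: with a common bound \<open>a\<close> for the
  summands, integrating the pointwise Jensen inequality is enough, and the constant does not depend
  on p.\<close>

lemma Lp_norm_sum_le:
  assumes U: "U \<in> lmeasurable" and I: "finite I" and g: "\<And>i. i \<in> I \<Longrightarrow> g i \<in> Lp_space \<infinity> U"
    and p: "1 \<le> p" and a: "0 \<le> a" "\<And>i. i \<in> I \<Longrightarrow> Lp_norm p U (g i) \<le> a"
  shows "Lp_norm p U (\<lambda>x. \<Sum>i\<in>I. c i * g i x) \<le> (\<Sum>i\<in>I. \<bar>c i\<bar>) * a"
  using p
proof (cases rule: exponent_cases)
  case 1
  have "AE x in lebesgue_on U. \<forall>i\<in>I. \<bar>g i x\<bar> \<le> Lp_norm \<infinity> U (g i)"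
    using I g AE_le_Lp_norm_infinity by (subst AE_finite_all) auto
  then have "AE x in lebesgue_on U. \<bar>\<Sum>i\<in>I. c i * g i x\<bar> \<le> (\<Sum>i\<in>I. \<bar>c i\<bar>) * a"
  proof eventually_elim
    case (elim x)
    have "\<bar>\<Sum>i\<in>I. c i * g i x\<bar> \<le> (\<Sum>i\<in>I. \<bar>c i\<bar> * a)"
      by (rule order_trans[OF sum_abs]) (use elim a 1 in \<open>fastforce simp: abs_mult intro!: sum_mono mult_left_mono\<close>)
    then show ?case by (simp add: sum_distrib_right)
  qed
  moreover have "(\<lambda>x. \<Sum>i\<in>I. c i * g i x) \<in> borel_measurable (lebesgue_on U)"
    using g by (intro borel_measurable_sum borel_measurable_times borel_measurable_const) (auto simp: Lp_space_infinity_iff)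
  ultimately show ?thesis unfolding 1 using a by (intro Lp_norm_infinity_le) (auto intro!: mult_nonneg_nonneg sum_nonneg)
next
  case (2 r)
  define L where "L = (\<Sum>i\<in>I. \<bar>c i\<bar>)"
  have L: "0 \<le> L" unfolding L_def by (auto intro: sum_nonneg)
  have ig: "integrable (lebesgue_on U) (\<lambda>x. \<bar>g i x\<bar> powr r)" if "i \<in> I" for i
    using Lp_space_infinity_integrable_powr[OF U g[OF that]] 2 by simp
  have "(LINT x|lebesgue_on U. \<bar>\<Sum>i\<in>I. c i * g i x\<bar> powr r) \<le> (LINT x|lebesgue_on U. L powr (r - 1) * (\<Sum>i\<in>I. \<bar>c i\<bar> * \<bar>g i x\<bar> powr r))"
    unfolding L_def using ig 2 U I
    by (intro integral_mono powr_sum_le Lp_space_infinity_integrable_powr Lp_space_infinity_sum g) auto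
  also have "\<dots> = L powr (r - 1) * (\<Sum>i\<in>I. \<bar>c i\<bar> * (LINT x|lebesgue_on U. \<bar>g i x\<bar> powr r))"
    using ig by simp
  also have "\<dots> \<le> L powr (r - 1) * (\<Sum>i\<in>I. \<bar>c i\<bar> * a powr r)"
  proof (intro mult_left_mono sum_mono)
    fix i assume i: "i \<in> I"
    show "(LINT x|lebesgue_on U. \<bar>g i x\<bar> powr r) \<le> a powr r"
      using integral_powr_Lp_norm[of r U "g i"] a(2)[OF i] 2 Lp_norm_nonneg by (auto intro!: powr_mono2)
  qed auto
  also have "\<dots> = (L * a) powr r"
  proof (cases "L = 0")
    case False
    then have "L powr (r - 1) * L = L powr r" using L powr_mult_base[of L "r - 1"] by (simp add: mult.commute)
    then show ?thesis using L a by (simp add: L_def[symmetric] sum_distrib_right[symmetric] powr_mult mult.assoc[symmetric])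
  qed (use 2 in simp)
  finally show ?thesis unfolding 2 using 2 L a unfolding L_def[symmetric] by (intro Lp_norm_ereal_le) auto
qed


text \<open>A crude form of Hoelder's inequality suffices; it follows from \<open>t \<le> 1 + t\<^sup>q\<close>.\<close>

lemma Lp_norm_1_le:
  assumes U: "U \<in> lmeasurable" and f: "f \<in> Lp_space \<infinity> U" and q: "1 \<le> q"
  shows "Lp_norm 1 U f \<le> (measure lebesgue U + 1) * Lp_norm q U f"
proof -
  interpret finite_measure "lebesgue_on U" using U by (rule finite_measure_lebesgue_on)
  let ?m = "measure lebesgue U"
  have m: "measure (lebesgue_on U) U = ?m" using U by (simp add: measure_restrict_space)
  have 1: "Lp_norm 1 U f = (LINT x|lebesgue_on U. \<bar>f x\<bar>)"
    using Lp_norm_ereal[of 1 U f] by (simp flip: one_ereal_def add: integral_nonneg_AE)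
  have i1: "integrable (lebesgue_on U) (\<lambda>x. \<bar>f x\<bar>)"
    using Lp_space_infinity_integrable_powr[OF U f, of 1] by simp
  have "Lp_norm 1 U f \<le> (?m + 1) * a" if a: "Lp_norm q U f \<le> a" "0 < a" for a
    using q
  proof (cases rule: exponent_cases)
    case 1
    have "(LINT x|lebesgue_on U. \<bar>f x\<bar>) \<le> (LINT x|lebesgue_on U. a)"
      using i1 AE_le_Lp_norm_infinity[OF f] a 1 by (intro integral_mono_AE) (auto elim!: eventually_mono)
    then show ?thesis using a by (simp add: \<open>Lp_norm 1 U f = _\<close> m algebra_simps)
  next
    case (2 r)
    have ir: "integrable (lebesgue_on U) (\<lambda>x. \<bar>f x\<bar> powr r)"
      using Lp_space_infinity_integrable_powr[OF U f] 2 by simp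
    have "\<bar>f x\<bar> \<le> a * (1 + \<bar>f x\<bar> powr r / a powr r)" for x
    proof (cases "\<bar>f x\<bar> \<le> a")
      case True
      then show ?thesis using a by (simp add: distrib_left add_increasing2)
    next
      case False
      then have "\<bar>f x\<bar> / a \<le> (\<bar>f x\<bar> / a) powr r"
        using a 2 powr_mono[of 1 r "\<bar>f x\<bar> / a"] by simp
      then have "\<bar>f x\<bar> \<le> a * (\<bar>f x\<bar> powr r / a powr r)" using a by (simp add: powr_divide field_simps)
      then show ?thesis using a by (simp add: distrib_left)
    qed
    then have "(LINT x|lebesgue_on U. \<bar>f x\<bar>) \<le> (LINT x|lebesgue_on U. a * (1 + \<bar>f x\<bar> powr r / a powr r))"
      using i1 ir by (intro integral_mono) auto
    also have "\<dots> = a * (?m + (LINT x|lebesgue_on U. \<bar>f x\<bar> powr r) / a powr r)"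
      using ir m by simp
    also have "\<dots> \<le> a * (?m + 1)"
      using a 2 powr_mono2[of r "Lp_norm q U f" a] Lp_norm_nonneg[of q U f]
      by (intro mult_left_mono add_left_mono) (auto simp: integral_powr_Lp_norm divide_le_eq)
    finally show ?thesis by (simp add: \<open>Lp_norm 1 U f = _\<close> mult.commute)
  qed
  \<comment> \<open>Division by \<open>a\<close> required a > 0, but the norm may be 0; hence a =
    norm + e, and e tends to 0.\<close>
  then have "Lp_norm 1 U f \<le> (?m + 1) * (Lp_norm q U f + e)" if "0 < e" for e
    using that Lp_norm_nonneg[of q U f] by force
  then have "\<forall>\<^sub>F e in at_right 0. Lp_norm 1 U f \<le> (?m + 1) * (Lp_norm q U f + e)"
    by (auto simp: eventually_at intro!: exI[of _ 1])
  moreover have "((\<lambda>e. (?m + 1) * (Lp_norm q U f + e)) \<longlongrightarrow> (?m + 1) * (Lp_norm q U f + 0)) (at_right 0)"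
    by (intro tendsto_intros)
  ultimately show ?thesis
    using tendsto_lowerbound[of _ _ "at_right (0::real)"] by fastforce
qed

lemma Lp_norm_le_infinity:
  assumes U: "U \<in> lmeasurable" and f: "f \<in> Lp_space \<infinity> U" and p: "1 \<le> p"
  shows "Lp_norm p U f \<le> (measure lebesgue U + 1) * Lp_norm \<infinity> U f"
  using p
proof (cases rule: exponent_cases)
  case 1
  have "1 * Lp_norm \<infinity> U f \<le> (measure lebesgue U + 1) * Lp_norm \<infinity> U f"
    by (rule mult_right_mono) (simp_all add: Lp_norm_nonneg)
  then show ?thesis using 1 by simp
next
  case (2 r)
  interpret finite_measure "lebesgue_on U" using U by (rule finite_measure_lebesgue_on)
  let ?m = "measure lebesgue U" and ?a = "Lp_norm \<infinity> U f"
  have m: "measure (lebesgue_on U) U = ?m" using U by (simp add: measure_restrict_space)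
  have "(LINT x|lebesgue_on U. \<bar>f x\<bar> powr r) \<le> (LINT x|lebesgue_on U. ?a powr r)"
    using Lp_space_infinity_integrable_powr[OF U f] 2 AE_le_Lp_norm_infinity[OF f]
    by (intro integral_mono_AE) (auto elim!: eventually_mono intro!: powr_mono2)
  also have "\<dots> = ?m * ?a powr r" using m by simp
  \<comment> \<open>The sharp factor would be the r-th root of the measure; the measure plus 1
    bounds it for all r \<ge> 1 at once.\<close>
  also have "\<dots> \<le> (?m + 1) powr r * ?a powr r"
  proof (rule mult_right_mono)
    have "(?m + 1) powr 1 \<le> (?m + 1) powr r" using 2 by (intro powr_mono) auto
    then show "?m \<le> (?m + 1) powr r" by simp
  qed simp
  also have "\<dots> = ((?m + 1) * ?a) powr r" by (simp add: powr_mult Lp_norm_nonneg)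
  finally show ?thesis unfolding 2 using 2 by (intro Lp_norm_ereal_le) (auto intro!: mult_nonneg_nonneg Lp_norm_nonneg)
qed

subsection \<open>Affine changes of variables\<close>

lemma AE_elem_map:
  assumes A: "invertible A" and P: "AE x in lebesgue. P x"
  shows "AE x in lebesgue. P (elem_map A b x)"
proof -
  note c = dilation_factor[OF A, of b]
  have "AE x in density (distr lebesgue lebesgue (elem_map A b)) (\<lambda>_. ennreal (dilation_factor A b)). P x"
    using P unfolding c(3) .
  then have "AE x in distr lebesgue lebesgue (elem_map A b). P x"
    using c(1) by (subst (asm) AE_density) auto
  then show ?thesis by (rule AE_distrD[OF c(2)])
qed

text \<open>The assumption on \<open>V\<close> says that \<open>V = F(U)\<close>; this form keeps the locale symmetric under exchange of the two maps.\<close>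

locale affine_iso =
  fixes A B :: "real^'n::finite^'n" and a b :: "real^'n" and U V :: "(real^'n) set"
  assumes A: "invertible A" and B: "invertible B"
    and GF: "\<And>x. elem_map B b (elem_map A a x) = x"
    and FG: "\<And>y. elem_map A a (elem_map B b y) = y"
    and openU: "open U" and openV: "open V"
    and V: "\<And>y. y \<in> V \<longleftrightarrow> elem_map B b y \<in> U"
    and Um: "U \<in> lmeasurable" and Vm: "V \<in> lmeasurable"
begin

abbreviation "F \<equiv> elem_map A a"
abbreviation "G \<equiv> elem_map B b"

lemma U_iff: "x \<in> U \<longleftrightarrow> F x \<in> V" using V GF by simp

lemma swap: "affine_iso B A b a V U"
  by unfold_locales (use A B GF FG openU openV U_iff Um Vm in auto)

lemma sets_UV [simp]: "U \<in> sets lebesgue" "V \<in> sets lebesgue"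
  using openU openV by auto

lemma AE_pullback:
  assumes "AE x in lebesgue_on U. P x" shows "AE y in lebesgue_on V. P (G y)"
proof -
  have "AE x in lebesgue. x \<in> U \<longrightarrow> P x" using assms by (subst (asm) AE_restrict_space_iff) auto
  from AE_elem_map[OF B this, of b] have "AE y in lebesgue. y \<in> V \<longrightarrow> P (G y)" by (simp add: V)
  then show ?thesis by (subst AE_restrict_space_iff) auto
qed

lemma measurable_pullback:
  fixes f :: "real^'n \<Rightarrow> real"
  assumes "f \<in> borel_measurable (lebesgue_on U)" shows "(\<lambda>y. f (G y)) \<in> borel_measurable (lebesgue_on V)"
proof -
  have "(\<lambda>x. if x \<in> U then f x else 0) \<in> borel_measurable lebesgue"
    using assms borel_measurable_if[of U f] by simp
  from measurable_compose[OF dilation_factor(2)[OF B, of b] this]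
  have "(\<lambda>y. if y \<in> V then f (G y) else 0) \<in> borel_measurable lebesgue" by (simp add: V)
  then show ?thesis using borel_measurable_if[of V "\<lambda>y. f (G y)"] by simp
qed

lemma Lp_space_pullback:
  assumes "f \<in> Lp_space \<infinity> U" shows "(\<lambda>y. f (G y)) \<in> Lp_space \<infinity> V"
  using assms measurable_pullback[of f] AE_pullback[of "\<lambda>x. \<bar>f x\<bar> \<le> _"] unfolding Lp_space_infinity_iff by blast

lemma integral_pullback:
  fixes f :: "real^'n \<Rightarrow> real"
  assumes "f \<in> borel_measurable (lebesgue_on U)"
  shows "(LINT y|lebesgue_on V. f (G y)) = dilation_factor A a * (LINT x|lebesgue_on U. f x)"
proof -
  have m: "(\<lambda>y. if y \<in> V then f (G y) else 0) \<in> borel_measurable lebesgue"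
    using measurable_pullback[OF assms] borel_measurable_if[of V "\<lambda>y. f (G y)"] by simp
  have "(LINT y|lebesgue_on V. f (G y)) = (LINT y|lebesgue. (if y \<in> V then f (G y) else 0))"
    by (simp add: Lebesgue_Measure.integral_restrict_UNIV)
  also have "\<dots> = dilation_factor A a * (LINT x|lebesgue. (if x \<in> U then f x else 0))"
    by (subst lebesgue_integral_elem_map(1)[OF A m, of a]) (simp add: U_iff[symmetric] GF cong: if_cong)
  also have "\<dots> = dilation_factor A a * (LINT x|lebesgue_on U. f x)"
    by (simp add: Lebesgue_Measure.integral_restrict_UNIV)
  finally show ?thesis .
qed

lemma Lp_norm_pullback:
  assumes f: "f \<in> Lp_space \<infinity> U" and p: "1 \<le> p"
  shows "Lp_norm p V (\<lambda>y. f (G y)) \<le> dilation_factor A a powr rinv p * Lp_norm p U f"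
  using p
proof (cases rule: exponent_cases)
  case 1
  \<comment> \<open>Needed since \<open>0 powr 0\<close> is 0: only for a nonzero base is the power
    with exponent \<open>rinv \<infinity>\<close> equal to 1.\<close>
  have "dilation_factor A a \<noteq> 0" using dilation_factor(1)[OF A, of a] by simp
  moreover have "Lp_norm \<infinity> V (\<lambda>y. f (G y)) \<le> Lp_norm \<infinity> U f"
    using AE_pullback[OF AE_le_Lp_norm_infinity[OF f]] measurable_pullback f
    by (intro Lp_norm_infinity_le) (auto simp: Lp_space_infinity_iff Lp_norm_nonneg)
  ultimately show ?thesis by (simp add: 1)
next
  case (2 r)
  have m: "(\<lambda>x. \<bar>f x\<bar> powr r) \<in> borel_measurable (lebesgue_on U)" using f by (auto simp: Lp_space_infinity_iff)
  note c = dilation_factor(1)[OF A, of a]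
  have "(LINT y|lebesgue_on V. \<bar>f (G y)\<bar> powr r) = dilation_factor A a * Lp_norm p U f powr r"
    using integral_pullback[OF m] 2 by (simp add: integral_powr_Lp_norm)
  also have "\<dots> = (dilation_factor A a powr rinv p * Lp_norm p U f) powr r"
    using c 2 by (simp add: powr_mult powr_powr Lp_norm_nonneg)
  finally show ?thesis using 2 unfolding 2 by (intro Lp_norm_ereal_le) (auto intro!: mult_nonneg_nonneg Lp_norm_nonneg)
qed

end

section \<open>Sobolev seminorms\<close>

lemma integrable_of_Lp_space_infinity:
  assumes "U \<in> lmeasurable" "f \<in> Lp_space \<infinity> U" shows "integrable (lebesgue_on U) f"
proof -
  interpret finite_measure "lebesgue_on U" using assms(1) by (rule finite_measure_lebesgue_on)
  obtain B where "AE x in lebesgue_on U. norm (f x) \<le> B" "f \<in> borel_measurable (lebesgue_on U)"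
    using assms(2) by (auto simp: Lp_space_infinity_iff)
  then show ?thesis by (rule integrable_const_bound)
qed

lemma locally_integrable_of_Lp_space_infinity:
  assumes U: "U \<in> lmeasurable" and f: "f \<in> Lp_space \<infinity> U" shows "locally_integrable U f"
  unfolding locally_integrable_def
proof (intro allI impI, elim conjE)
  fix K assume K: "compact K" "K \<subseteq> U"
  have "set_integrable lebesgue U f"
    using integrable_of_Lp_space_infinity[OF U f] U unfolding set_integrable_def
    by (subst (asm) integrable_restrict_space) auto
  then show "f absolutely_integrable_on K"
    by (rule set_integrable_subset) (use K in \<open>simp_all add: borel_compact\<close>)
qed

lemma locally_integrable_cong_AE:
  assumes U: "open U" and f: "locally_integrable U f" and ae: "AE x in lebesgue_on U. f x = g x"
  shows "locally_integrable U g"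
  unfolding locally_integrable_def
proof (intro allI impI, elim conjE)
  fix K assume K: "compact K" "K \<subseteq> U"
  have "AE x in lebesgue. x \<in> U \<longrightarrow> f x = g x" using ae U by (subst (asm) AE_restrict_space_iff) auto
  then have ae': "AE x in lebesgue. indicator K x *\<^sub>R f x = indicator K x *\<^sub>R g x"
    by eventually_elim (use K in \<open>auto simp: indicator_def\<close>)
  have i: "integrable lebesgue (\<lambda>x. indicator K x *\<^sub>R f x)" by (rule locally_integrable_indicator[OF f K])
  then have m: "(\<lambda>x. indicator K x *\<^sub>R g x) \<in> borel_measurable lebesgue"
    by (intro borel_measurable_AE[OF _ ae']) auto
  have "integrable lebesgue (\<lambda>x. indicator K x *\<^sub>R g x)"
    using i integrable_cong_AE[OF borel_measurable_integrable[OF i] m ae'] by simp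
  then show "g absolutely_integrable_on K" by (simp only: set_integrable_def)
qed

text \<open>Functions in W_h agree with mapped reference functions only almost everywhere, so weak
  derivatives must not depend on the representative.\<close>

lemma is_weak_deriv_cong_AE:
  assumes U: "open U" and fg: "is_weak_deriv U \<alpha> f g"
    and f: "AE x in lebesgue_on U. f x = f' x" and g: "AE x in lebesgue_on U. g x = g' x"
  shows "is_weak_deriv U \<alpha> f' g'"
proof -
  obtain js where js: "\<alpha> = count_list js" using ex_count_list[of \<alpha>] by metis
  have li: "locally_integrable U f" "locally_integrable U g" "locally_integrable U f'" "locally_integrable U g'"
    using fg locally_integrable_cong_AE[OF U _ f] locally_integrable_cong_AE[OF U _ g] by (auto simp: is_weak_deriv_def)
  have cong: "(LINT x|lebesgue_on U. u x * \<phi> x) = (LINT x|lebesgue_on U. u' x * \<phi> x)"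
    if "AE x in lebesgue_on U. u x = u' x" "locally_integrable U u" "locally_integrable U u'" "test_fun U \<phi>" for u u' \<phi>
    using that integral_test_fun(2)[OF U _ that(4)] by (intro integral_cong_AE) (auto elim!: eventually_mono)
  show ?thesis
    using fg unfolding js is_weak_deriv_iff
    by (simp add: li cong[OF f li(1,3)] cong[OF g li(2,4)] test_fun_foldr)
qed

lemma sobolev_space_infinity_iff:
  fixes U :: "(real^'n::finite) set"
  shows "v \<in> sobolev_space l \<infinity> U \<longleftrightarrow> (\<forall>js. length js \<le> l \<longrightarrow> (\<exists>g \<in> Lp_space \<infinity> U. is_weak_deriv U (count_list js) v g))"
proof
  assume v: "v \<in> sobolev_space l \<infinity> U"
  show "\<forall>js. length js \<le> l \<longrightarrow> (\<exists>g \<in> Lp_space \<infinity> U. is_weak_deriv U (count_list js) v g)"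
  proof (intro allI impI)
    fix js :: "'n list" assume "length js \<le> l"
    then have "mdegree (count_list js) \<le> l" by (simp add: mdegree_count_list)
    then show "\<exists>g \<in> Lp_space \<infinity> U. is_weak_deriv U (count_list js) v g"
      using v unfolding sobolev_space_def by blast
  qed
next
  assume *: "\<forall>js. length js \<le> l \<longrightarrow> (\<exists>g \<in> Lp_space \<infinity> U. is_weak_deriv U (count_list js) v g)"
  show "v \<in> sobolev_space l \<infinity> U"
    unfolding sobolev_space_def
  proof (intro CollectI allI impI)
    fix \<alpha> :: "'n \<Rightarrow> nat" assume "mdegree \<alpha> \<le> l"
    moreover obtain js where "count_list js = \<alpha>" using ex_count_list by blast
    ultimately show "\<exists>g. is_weak_deriv U \<alpha> v g \<and> g \<in> Lp_space \<infinity> U"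
      using * mdegree_count_list[of js] by auto
  qed
qed

section \<open>Derivatives and seminorms indexed by lists\<close>

abbreviation wderiv :: "(real^'n::finite) set \<Rightarrow> 'n list \<Rightarrow> (real^'n \<Rightarrow> real) \<Rightarrow> (real^'n \<Rightarrow> real)" where
  "wderiv U js v \<equiv> weak_deriv U (count_list js) v"

text \<open>The bridge from the derivative selected by \<open>SOME\<close> to an explicit one: by
  uniqueness, any bounded weak derivative computes the norms.\<close>

lemma wderiv_eq:
  assumes U: "open U" and g: "is_weak_deriv U (count_list js) v g" "g \<in> Lp_space \<infinity> U"
  shows "AE x in lebesgue_on U. g x = wderiv U js v x" "wderiv U js v \<in> Lp_space \<infinity> U"
    "Lp_norm p U (wderiv U js v) = Lp_norm p U g"
proof -
  show ae: "AE x in lebesgue_on U. g x = wderiv U js v x"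
    using is_weak_deriv_unique[OF U g(1) weak_deriv_works[OF g(1)]] .
  show "wderiv U js v \<in> Lp_space \<infinity> U" using Lp_space_infinity_cong_AE[OF g(2) _ ae] U by auto
  show "Lp_norm p U (wderiv U js v) = Lp_norm p U g"
    using g(2) U by (intro Lp_norm_cong_AE[OF _ _ ae, symmetric]) (auto simp: Lp_space_infinity_iff)
qed

lemma sobolev_wderiv:
  assumes U: "open U" and v: "v \<in> sobolev_space l \<infinity> U" and js: "length js \<le> l"
  shows "is_weak_deriv U (count_list js) v (wderiv U js v)" "wderiv U js v \<in> Lp_space \<infinity> U"
  using v js wderiv_eq(2)[OF U] weak_deriv_works unfolding sobolev_space_infinity_iff by blast+

definition lists_of_length :: "nat \<Rightarrow> 'a list set" where
  "lists_of_length n = {js. length js = n}"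

lemma finite_lists_of_length [simp]: "finite (lists_of_length n :: 'a::finite list set)"
  using finite_lists_length_eq[of "UNIV :: 'a set" n] by (simp add: lists_of_length_def)

lemma card_lists_of_length: "card (lists_of_length n :: 'a::finite list set) = CARD('a) ^ n"
  using card_lists_length_eq[of "UNIV :: 'a set" n] by (simp add: lists_of_length_def)

lemma lists_of_length_0: "lists_of_length 0 = {[]}" by (auto simp: lists_of_length_def)

lemma sum_lists_of_length_Suc:
  "(\<Sum>js\<in>lists_of_length (Suc n). f js) = (\<Sum>j\<in>UNIV. \<Sum>js\<in>lists_of_length n. f (j # js))"
  for f :: "'a::finite list \<Rightarrow> 'b::comm_monoid_add"
proof -
  have "lists_of_length (Suc n) = (\<lambda>(j, js). j # js) ` (UNIV \<times> lists_of_length n :: ('a \<times> 'a list) set)"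
    by (auto simp: lists_of_length_def length_Suc_conv image_iff)
  moreover have "inj_on (\<lambda>(j, js). j # js) (UNIV \<times> lists_of_length n :: ('a \<times> 'a list) set)"
    by (auto simp: inj_on_def)
  ultimately have "(\<Sum>js\<in>lists_of_length (Suc n). f js) = (\<Sum>(j, js)\<in>UNIV \<times> lists_of_length n. f (j # js))"
    by (simp add: sum.reindex o_def case_prod_unfold)
  then show ?thesis by (simp add: sum.cartesian_product)
qed

text \<open>A plain sum over ordered lists, so mixed derivatives are counted repeatedly. This
  differs from the usual seminorm by factors depending on dimension and order only, and it fits the
  chain rule, which produces sums over lists.\<close>

definition sobolev_seminorm :: "nat \<Rightarrow> ereal \<Rightarrow> (real^'n::finite) set \<Rightarrow> (real^'n \<Rightarrow> real) \<Rightarrow> real" where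
  "sobolev_seminorm j p U v = (\<Sum>js\<in>lists_of_length j. Lp_norm p U (wderiv U js v))"

lemma sobolev_seminorm_nonneg: "0 \<le> sobolev_seminorm j p U v"
  unfolding sobolev_seminorm_def by (intro sum_nonneg Lp_norm_nonneg)

lemma Lp_norm_le_sobolev_seminorm:
  "Lp_norm p U (wderiv U js v) \<le> sobolev_seminorm (length js) p U v"
  unfolding sobolev_seminorm_def
  by (rule member_le_sum) (simp_all add: Lp_norm_nonneg, simp add: lists_of_length_def)

text \<open>The product of the entries B_(j i) along two lists of equal length: the coefficient of
  the derivative \<open>js\<close> in the derivative \<open>is\<close> of a composition with an
  affine map.\<close>

fun chain_coeff :: "real^'n^'n \<Rightarrow> 'n list \<Rightarrow> 'n list \<Rightarrow> real" where
  "chain_coeff B (i # is) (j # js) = B $ j $ i * chain_coeff B is js"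
| "chain_coeff B _ _ = 1"

lemma chain_coeff_bound:
  assumes "\<And>i j. \<bar>B $ i $ j\<bar> \<le> a" "length is = length js"
  shows "\<bar>chain_coeff B is js\<bar> \<le> a ^ length is"
  using assms(2)
proof (induction "is" js rule: list_induct2)
  case (Cons i "is" j js)
  then show ?case
    using assms(1)[of j i] order_trans[OF abs_ge_zero assms(1)] by (auto simp: abs_mult intro!: mult_mono)
qed simp

lemma pderiv1_sum:
  assumes "finite I" "\<And>i x. i \<in> I \<Longrightarrow> f i differentiable (at x)"
  shows "(\<forall>x. (\<lambda>x. \<Sum>i\<in>I. c i * f i x) differentiable (at x)) \<and>
    pderiv1 k (\<lambda>x. \<Sum>i\<in>I. c i * f i x) = (\<lambda>x. \<Sum>i\<in>I. c i * pderiv1 k (f i) x)"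
  using assms
proof (induction I rule: finite_induct)
  case empty
  have "pderiv1 k (\<lambda>x. 0) = (\<lambda>x. 0)" by (intro ext pderiv1_eq[OF has_derivative_const])
  then show ?case by simp
next
  case (insert i I)
  let ?g = "\<lambda>x. \<Sum>i\<in>I. c i * f i x"
  have eq: "(\<lambda>x. \<Sum>i\<in>insert i I. c i * f i x) = (\<lambda>x. c i * f i x + 1 * ?g x)"
    using insert by (simp add: fun_eq_iff)
  have IH: "?g differentiable (at x)" "pderiv1 k ?g = (\<lambda>x. \<Sum>i\<in>I. c i * pderiv1 k (f i) x)" for x
    using insert by auto
  have f: "f i differentiable (at x)" for x using insert by simp
  show ?case
    unfolding eq using pderiv1_affine(1)[OF f IH(1), where a="c i" and b=1] pderiv1_affine(2)[OF f IH(1), of k "c i" 1] insert(1,2)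
    by (auto simp: fun_eq_iff IH(2) simp del: mult_1)
qed

text \<open>The differential of an affine map is constant, so the iterated chain rule produces no
  terms of lower order; this is why seminorms scale exactly.\<close>

lemma foldr_pderiv1_compose_elem_map:
  assumes "smooth_fun \<psi>"
  shows "foldr pderiv1 is (\<lambda>y. \<psi> (elem_map B b y)) =
    (\<lambda>y. \<Sum>js\<in>lists_of_length (length is). chain_coeff B is js * foldr pderiv1 js \<psi> (elem_map B b y))"
proof (induction "is")
  case Nil
  show ?case by (simp add: lists_of_length_0)
next
  case (Cons i "is")
  let ?L = "lists_of_length (length is)" and ?D = "\<lambda>js. foldr pderiv1 js \<psi>"
  have s: "smooth_fun (?D js)" for js by (rule smooth_fun_foldr[OF assms])
  note d = smooth_fun_differentiable[OF s] and c = pderiv1_compose_elem_map[OF smooth_fun_differentiable[OF s]]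
  have "foldr pderiv1 (i # is) (\<lambda>y. \<psi> (elem_map B b y)) =
      (\<lambda>y. \<Sum>js\<in>?L. chain_coeff B is js * pderiv1 i (\<lambda>y. ?D js (elem_map B b y)) y)"
    using pderiv1_sum[of ?L "\<lambda>js y. ?D js (elem_map B b y)" "chain_coeff B is" i] c(1) by (simp add: Cons)
  also have "\<dots> = (\<lambda>y. \<Sum>js\<in>?L. \<Sum>j\<in>UNIV. chain_coeff B (i # is) (j # js) * ?D (j # js) (elem_map B b y))"
    by (simp add: c(2) sum_distrib_left mult_ac)
  also have "\<dots> = (\<lambda>y. \<Sum>js\<in>lists_of_length (length (i # is)). chain_coeff B (i # is) js * ?D js (elem_map B b y))"
    by (subst sum.swap) (simp add: sum_lists_of_length_Suc)
  finally show ?case .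
qed

context affine_iso begin

lemma test_fun_pullback:
  assumes "test_fun V \<phi>" shows "test_fun U (\<lambda>x. \<phi> (F x))"
proof -
  obtain K where K: "compact K" "K \<subseteq> V" "\<And>x. x \<notin> K \<Longrightarrow> \<phi> x = 0" using test_fun_support[OF assms] by blast
  have "continuous_on K G"
    by (intro continuous_at_imp_continuous_on ballI has_derivative_continuous[OF elem_map_has_derivative])
  then have c: "compact (G ` K)" using K(1) compact_continuous_image by blast
  have sub: "closure {x. \<phi> (F x) \<noteq> 0} \<subseteq> G ` K"
  proof (rule closure_minimal)
    show "{x. \<phi> (F x) \<noteq> 0} \<subseteq> G ` K"
      using K(3) GF by (metis (mono_tags, lifting) image_eqI mem_Collect_eq subsetI)
  qed (use c compact_imp_closed in blast)
  have "closure {x. \<phi> (F x) \<noteq> 0} \<subseteq> U"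
    using sub K(2) V by blast
  moreover have "compact (closure {x. \<phi> (F x) \<noteq> 0})"
    using compact_Int_closed[OF c closed_closure, of "{x. \<phi> (F x) \<noteq> 0}"] sub by (simp add: Int_absorb1)
  ultimately show ?thesis
    using smooth_fun_compose_elem_map[OF test_fun_smooth[OF assms]] by (simp add: test_fun_def)
qed

text \<open>The chain rule is applied to the test function, where it is classical: a test function
  on V is \<psi> composed with \<open>G\<close> for a test function \<psi> on U. Its derivatives
  expand, the integrals are pulled back to U, and there the weak derivatives of \<open>v\<close> are
  used.\<close>

lemma is_weak_deriv_pullback:
  assumes v: "v \<in> Lp_space \<infinity> U"
    and g: "\<And>js. length js = length is \<Longrightarrow> g js \<in> Lp_space \<infinity> U \<and> is_weak_deriv U (count_list js) v (g js)"
  shows "is_weak_deriv V (count_list is) (\<lambda>y. v (G y))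
     (\<lambda>y. \<Sum>js\<in>lists_of_length (length is). chain_coeff B is js * g js (G y))"
  unfolding is_weak_deriv_iff
proof (intro conjI allI impI)
  let ?L = "lists_of_length (length is)"
  have gL: "g js \<in> Lp_space \<infinity> U" if "js \<in> ?L" for js using g that by (simp add: lists_of_length_def)
  show "locally_integrable V (\<lambda>y. v (G y))"
    by (intro locally_integrable_of_Lp_space_infinity Vm Lp_space_pullback v)
  show "locally_integrable V (\<lambda>y. \<Sum>js\<in>?L. chain_coeff B is js * g js (G y))"
    by (intro locally_integrable_of_Lp_space_infinity Vm Lp_space_infinity_sum Lp_space_pullback gL) simp
  fix \<phi> assume \<phi>: "test_fun V \<phi>"
  define \<psi> where "\<psi> x = \<phi> (F x)" for x
  have \<psi>: "test_fun U \<psi>" unfolding \<psi>_def[abs_def] by (rule test_fun_pullback[OF \<phi>])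
  have \<phi>_eq: "\<phi> = (\<lambda>y. \<psi> (G y))" by (simp add: \<psi>_def FG)
  have pull: "integrable (lebesgue_on V) (\<lambda>y. u (G y) * \<eta> (G y))"
    "(LINT y|lebesgue_on V. u (G y) * \<eta> (G y)) = dilation_factor A a * (LINT x|lebesgue_on U. u x * \<eta> x)"
    if u: "u \<in> Lp_space \<infinity> U" and \<eta>: "test_fun U \<eta>" for u \<eta>
  proof -
    have "test_fun V (\<lambda>y. \<eta> (G y))" using affine_iso.test_fun_pullback[OF swap \<eta>] .
    then show "integrable (lebesgue_on V) (\<lambda>y. u (G y) * \<eta> (G y))"
      using integral_test_fun(2)[OF openV] locally_integrable_of_Lp_space_infinity[OF Vm Lp_space_pullback[OF u]] by blast
    have "(\<lambda>x. u x * \<eta> x) \<in> borel_measurable (lebesgue_on U)"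
      using integral_test_fun(2)[OF openU locally_integrable_of_Lp_space_infinity[OF Um u] \<eta>] by auto
    from integral_pullback[OF this] show "(LINT y|lebesgue_on V. u (G y) * \<eta> (G y)) = dilation_factor A a * (LINT x|lebesgue_on U. u x * \<eta> x)" .
  qed
  have "(LINT y|lebesgue_on V. v (G y) * foldr pderiv1 is \<phi> y) =
      (LINT y|lebesgue_on V. (\<Sum>js\<in>?L. chain_coeff B is js * (v (G y) * foldr pderiv1 js \<psi> (G y))))"
    unfolding \<phi>_eq foldr_pderiv1_compose_elem_map[OF test_fun_smooth[OF \<psi>]]
    by (simp add: sum_distrib_left mult_ac)
  also have "\<dots> = (\<Sum>js\<in>?L. chain_coeff B is js * (dilation_factor A a * (LINT x|lebesgue_on U. v x * foldr pderiv1 js \<psi> x)))"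
    using pull[OF v test_fun_foldr[OF \<psi>]] by simp
  also have "\<dots> = (\<Sum>js\<in>?L. chain_coeff B is js * (dilation_factor A a * ((-1) ^ length is * (LINT x|lebesgue_on U. g js x * \<psi> x))))"
    using g \<psi> by (intro sum.cong refl) (simp add: lists_of_length_def is_weak_deriv_iff)
  also have "\<dots> = (-1) ^ length is * (\<Sum>js\<in>?L. chain_coeff B is js * (dilation_factor A a * (LINT x|lebesgue_on U. g js x * \<psi> x)))"
    by (simp add: sum_distrib_left mult_ac)
  also have "(\<Sum>js\<in>?L. chain_coeff B is js * (dilation_factor A a * (LINT x|lebesgue_on U. g js x * \<psi> x)))
      = (LINT y|lebesgue_on V. (\<Sum>js\<in>?L. chain_coeff B is js * (g js (G y) * \<psi> (G y))))"
    using pull[OF gL \<psi>] by simp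
  also have "\<dots> = (LINT y|lebesgue_on V. (\<Sum>js\<in>?L. chain_coeff B is js * g js (G y)) * \<phi> y)"
    unfolding \<phi>_eq by (simp add: sum_distrib_right mult.assoc)
  finally show "(LINT y|lebesgue_on V. v (G y) * foldr pderiv1 is \<phi> y) =
      (-1) ^ length is * (LINT y|lebesgue_on V. (\<Sum>js\<in>?L. chain_coeff B is js * g js (G y)) * \<phi> y)" .
qed

lemma sobolev_space_AE_bounded:
  assumes "v \<in> sobolev_space l \<infinity> U" shows "v \<in> Lp_space \<infinity> U"
proof -
  obtain g where g: "g \<in> Lp_space \<infinity> U" "is_weak_deriv U (count_list []) v g"
    using assms unfolding sobolev_space_infinity_iff by (metis le0 list.size(3))
  then have "is_weak_deriv U (count_list []) v v" by (simp add: is_weak_deriv_iff del: count_list.simps)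
  then have "AE x in lebesgue_on U. g x = v x" using g(2) is_weak_deriv_unique[OF openU] by blast
  then show ?thesis using Lp_space_infinity_cong_AE[OF g(1)] by simp
qed

text \<open>The square of \<open>CARD('n)\<close> has two sources: one factor counts the lists in
  the chain rule expansion of a single derivative, the other the derivatives summed on the
  left.\<close>

lemma sobolev_seminorm_pullback:
  assumes v: "v \<in> sobolev_space l \<infinity> U" and w: "AE y in lebesgue_on V. v (G y) = w y"
    and Bc: "\<And>i j. \<bar>B $ i $ j\<bar> \<le> c" and p: "1 \<le> p"
  shows "w \<in> sobolev_space l \<infinity> V"
    and "j \<le> l \<Longrightarrow> sobolev_seminorm j p V w \<le>
      dilation_factor A a powr rinv p * (real CARD('n) ^ 2 * c) ^ j * sobolev_seminorm j p U v"
proof -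
  let ?g = "\<lambda>is y. \<Sum>js\<in>lists_of_length (length is). chain_coeff B is js * wderiv U js v (G y)"
  have c0: "0 \<le> c" using order_trans[OF abs_ge_zero Bc] .
  have mem: "wderiv U js v \<in> Lp_space \<infinity> U" if "length js \<le> l" for js
    using sobolev_wderiv(2)[OF openU v that] .
  have g: "?g is \<in> Lp_space \<infinity> V" "is_weak_deriv V (count_list is) w (?g is)" if "length is \<le> l" for "is"
  proof -
    show "?g is \<in> Lp_space \<infinity> V"
      using that by (intro Lp_space_infinity_sum Lp_space_pullback mem) (simp, simp add: lists_of_length_def)
    have "is_weak_deriv V (count_list is) (\<lambda>y. v (G y)) (?g is)"
      using that by (intro is_weak_deriv_pullback sobolev_space_AE_bounded[OF v] conjI mem sobolev_wderiv(1)[OF openU v]) auto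
    then show "is_weak_deriv V (count_list is) w (?g is)"
      by (rule is_weak_deriv_cong_AE[OF openV _ w]) simp
  qed
  then show "w \<in> sobolev_space l \<infinity> V" unfolding sobolev_space_infinity_iff by blast
  assume j: "j \<le> l"
  let ?k = "dilation_factor A a powr rinv p * sobolev_seminorm j p U v"
  have "Lp_norm p V (wderiv V is w) \<le> (real CARD('n) * c) ^ j * ?k" if "length is = j" for "is"
  proof -
    have il: "length is \<le> l" using that j by simp
    have "Lp_norm p V (wderiv V is w) = Lp_norm p V (?g is)" by (rule wderiv_eq(3)[OF openV g(2,1)[OF il]])
    also have "\<dots> \<le> (\<Sum>js\<in>lists_of_length (length is). \<bar>chain_coeff B is js\<bar>) * ?k"
    proof (rule Lp_norm_sum_le[OF Vm _ _ p])
      fix js :: "'n list" assume js: "js \<in> lists_of_length (length is)"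
      then have js': "length js = j" using that by (simp add: lists_of_length_def)
      show "(\<lambda>y. wderiv U js v (G y)) \<in> Lp_space \<infinity> V"
        using js' j by (intro Lp_space_pullback mem) simp
      have "Lp_norm p V (\<lambda>y. wderiv U js v (G y)) \<le> dilation_factor A a powr rinv p * Lp_norm p U (wderiv U js v)"
        using js' j by (intro Lp_norm_pullback mem p) simp
      also have "\<dots> \<le> ?k" using Lp_norm_le_sobolev_seminorm[of p U js v] js' by (intro mult_left_mono) auto
      finally show "Lp_norm p V (\<lambda>y. wderiv U js v (G y)) \<le> ?k" .
    qed (auto intro!: mult_nonneg_nonneg sobolev_seminorm_nonneg)
    also have "\<dots> \<le> (\<Sum>js\<in>(lists_of_length j :: 'n list set). c ^ j) * ?k"
      unfolding that
    proof (intro mult_right_mono sum_mono)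
      show "\<bar>chain_coeff B is js\<bar> \<le> c ^ j" if "js \<in> lists_of_length j" for js
        using chain_coeff_bound[OF Bc, of "is" js] that \<open>length is = j\<close> by (simp add: lists_of_length_def)
    qed (auto intro!: mult_nonneg_nonneg sobolev_seminorm_nonneg)
    also have "\<dots> = (real CARD('n) * c) ^ j * ?k" by (simp add: card_lists_of_length power_mult_distrib)
    finally show ?thesis .
  qed
  then have "sobolev_seminorm j p V w \<le> (\<Sum>is\<in>(lists_of_length j :: 'n list set). (real CARD('n) * c) ^ j * ?k)"
    unfolding sobolev_seminorm_def[of j p V] by (intro sum_mono) (simp add: lists_of_length_def)
  also have "\<dots> = dilation_factor A a powr rinv p * (real CARD('n) ^ 2 * c) ^ j * sobolev_seminorm j p U v"
    by (simp add: card_lists_of_length power_mult_distrib power2_eq_square)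
  finally show "sobolev_seminorm j p V w \<le>
      dilation_factor A a powr rinv p * (real CARD('n) ^ 2 * c) ^ j * sobolev_seminorm j p U v" .
qed

end

section \<open>Seminorms on finite-dimensional function spaces\<close>

abbreviation (input) fscale :: "real \<Rightarrow> ('a \<Rightarrow> real) \<Rightarrow> 'a \<Rightarrow> real" where
  "fscale c f \<equiv> \<lambda>x. c * f x"

text \<open>Homogeneity is required as an inequality because that is easy to verify for quotient
  seminorms; on a subspace equality follows by scaling back.\<close>

definition seminorm_on :: "('a \<Rightarrow> real) set \<Rightarrow> (('a \<Rightarrow> real) \<Rightarrow> real) \<Rightarrow> bool" where
  "seminorm_on P N \<longleftrightarrow> (\<forall>u\<in>P. 0 \<le> N u) \<and> (\<forall>u\<in>P. \<forall>v\<in>P. N (u + v) \<le> N u + N v) \<and>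
     (\<forall>u\<in>P. \<forall>c. N (fscale c u) \<le> \<bar>c\<bar> * N u)"

lemma seminorm_onD:
  assumes "seminorm_on P N"
  shows "u \<in> P \<Longrightarrow> 0 \<le> N u" "u \<in> P \<Longrightarrow> v \<in> P \<Longrightarrow> N (u + v) \<le> N u + N v"
    "u \<in> P \<Longrightarrow> N (fscale c u) \<le> \<bar>c\<bar> * N u"
  using assms by (auto simp: seminorm_on_def)

lemma seminorm_on_scale:
  assumes N: "seminorm_on P N" and P: "fun_space.subspace P" and u: "u \<in> P"
  shows "N (fscale c u) = \<bar>c\<bar> * N u"
proof (cases "c = 0")
  case True
  have cu: "fscale c u \<in> P" using fun_space.subspace_scale[OF P u] .
  show ?thesis using seminorm_onD(3)[OF N u, of c] seminorm_onD(1)[OF N cu] True by simp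
next
  case False
  have cu: "fscale c u \<in> P" using fun_space.subspace_scale[OF P u] .
  have "N (fscale (1 / c) (fscale c u)) \<le> \<bar>1 / c\<bar> * N (fscale c u)" by (rule seminorm_onD(3)[OF N cu])
  moreover have "fscale (1 / c) (fscale c u) = u" using False by auto
  ultimately have "\<bar>c\<bar> * N u \<le> N (fscale c u)" using False by (simp add: field_simps)
  then show ?thesis using seminorm_onD(3)[OF N u, of c] by simp
qed

lemma seminorm_on_diff:
  assumes N: "seminorm_on P N" and P: "fun_space.subspace P" and u: "u \<in> P" "v \<in> P"
  shows "N u - N v \<le> N (u - v)" "N (u - v) = N (v - u)"
proof -
  have uv: "u - v \<in> P" using fun_space.subspace_diff[OF P] u by blast
  show "N u - N v \<le> N (u - v)" using seminorm_onD(2)[OF N uv u(2)] by simp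
  have "fscale (-1) (u - v) = v - u" by auto
  then show "N (u - v) = N (v - u)" using seminorm_on_scale[OF N P uv, of "-1"] by simp
qed

text \<open>Along the line the seminorm is constant if N d = 0. Otherwise it is Lipschitz and tends
  to infinity, so a minimum over a compact interval is global.\<close>

lemma seminorm_line_attains_min:
  assumes N: "seminorm_on P N" and P: "fun_space.subspace P" and b: "b \<in> P" "d \<in> P"
  obtains t0 where "\<And>t. N (b + fscale t0 d) \<le> N (b + fscale t d)"
proof (cases "N d = 0")
  case True
  have "N b \<le> N (b + fscale t d)" for t
  proof -
    have td: "fscale t d \<in> P" using fun_space.subspace_scale[OF P b(2)] .
    have bt: "b + fscale t d \<in> P" using fun_space.subspace_add[OF P b(1) td] .
    show ?thesis using seminorm_on_diff(1)[OF N P b(1) bt] seminorm_on_diff(2)[OF N P b(1) bt]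
        seminorm_on_scale[OF N P b(2), of t] True by simp
  qed
  moreover have "b + fscale 0 d = b" by auto
  ultimately show thesis using that[of 0] by simp
next
  case False
  then have d: "N d > 0" using seminorm_onD(1)[OF N b(2)] by simp
  define f where "f t = N (b + fscale t d)" for t
  have bt: "b + fscale t d \<in> P" for t
    using fun_space.subspace_add[OF P b(1) fun_space.subspace_scale[OF P b(2)]] .
  have lip: "f s - f t \<le> \<bar>s - t\<bar> * N d" for s t
  proof -
    have "(b + fscale s d) - (b + fscale t d) = fscale (s - t) d" by (auto simp: algebra_simps)
    then show ?thesis using seminorm_on_diff(1)[OF N P bt bt, of s t] seminorm_on_scale[OF N P b(2), of "s - t"]
      by (simp add: f_def)
  qed
  have lip2: "dist (f s) (f t) \<le> N d * dist s t" for s t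
    using lip[of s t] lip[of t s] by (simp add: dist_real_def abs_le_iff mult.commute abs_minus_commute)
  have "(N d)-lipschitz_on UNIV f"
    using lip2 d by (intro lipschitz_onI) auto
  then have cont: "continuous_on S f" for S
    using lipschitz_on_continuous_on continuous_on_subset by blast
  have f0: "f 0 = N b"
  proof -
    have "b + fscale 0 d = b" by auto
    then show ?thesis by (simp add: f_def)
  qed
  \<comment> \<open>For |t| \<ge> R the value is at least |t| N d - N b \<ge> N b, the value at t =
    0.\<close>
  define R where "R = 2 * N b / N d"
  have R: "0 \<le> R" using d seminorm_onD(1)[OF N b(1)] by (simp add: R_def)
  obtain t0 where t0: "t0 \<in> {-R..R}" "\<And>t. t \<in> {-R..R} \<Longrightarrow> f t0 \<le> f t"
    using continuous_attains_inf[OF compact_Icc _ cont, of "-R" R] R by auto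
  have "f t0 \<le> f t" for t
  proof (cases "t \<in> {-R..R}")
    case False
    then have "R * N d \<le> \<bar>t\<bar> * N d" using d by (intro mult_right_mono) auto
    then have "2 * N b \<le> \<bar>t\<bar> * N d" using d by (simp add: R_def)
    moreover have "\<bar>t\<bar> * N d - N b \<le> f t"
    proof -
      have td: "fscale t d \<in> P" using fun_space.subspace_scale[OF P b(2)] .
      have nb: "fscale (-1) b \<in> P" using fun_space.subspace_scale[OF P b(1)] .
      have eq: "(b + fscale t d) + fscale (-1) b = fscale t d" by (rule ext) simp
      have "N (fscale t d) \<le> N (b + fscale t d) + N (fscale (-1) b)"
        using seminorm_onD(2)[OF N bt nb, of t] unfolding eq .
      also have "N (fscale (-1) b) = N b" using seminorm_on_scale[OF N P b(1), of "-1"] by simp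
      finally have "N (fscale t d) \<le> N (b + fscale t d) + N b" .
      then show ?thesis using seminorm_on_scale[OF N P b(2)] by (simp add: f_def)
    qed
    ultimately have "f 0 \<le> f t" by (simp add: f0)
    moreover have "f t0 \<le> f 0" using t0(2)[of 0] R by simp
    ultimately show ?thesis by simp
  qed (rule t0(2))
  then show thesis using that[of t0] by (simp add: f_def)
qed

text \<open>Induction step: minimising over the span of \<open>B\<close> gives a quotient seminorm, which is then
  minimised along the line in the new direction.\<close>

lemma seminorm_span_attains_min:
  assumes "finite B" "B \<subseteq> P" and P: "fun_space.subspace P" and N: "seminorm_on P N" and "b \<in> P"
  shows "\<exists>u\<in>fun_space.span B. \<forall>u'\<in>fun_space.span B. N (b + u) \<le> N (b + u')"
  using assms(1,2,5)
proof (induction B arbitrary: b rule: finite_induct)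
  case empty
  then show ?case by simp
next
  case (insert d B)
  note IH = insert.IH
  have BP: "B \<subseteq> P" "d \<in> P" using insert.prems by auto
  have sP: "fun_space.span B \<subseteq> P" using fun_space.span_minimal[OF BP(1) P] .
  note sub = fun_space.subspace_add[OF P] fun_space.subspace_scale[OF P]
  have "\<forall>x\<in>P. \<exists>u\<in>fun_space.span B. \<forall>u'\<in>fun_space.span B. N (x + u) \<le> N (x + u')"
    using IH BP by blast
  then obtain m where m: "\<And>x. x \<in> P \<Longrightarrow> m x \<in> fun_space.span B"
    "\<And>x u'. x \<in> P \<Longrightarrow> u' \<in> fun_space.span B \<Longrightarrow> N (x + m x) \<le> N (x + u')"
    by metis
  define D where "D x = N (x + m x)" for x
  have mP: "m x \<in> P" if "x \<in> P" for x using m(1)[OF that] sP by blast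
  have D: "seminorm_on P D"
    unfolding seminorm_on_def
  proof (intro conjI ballI allI)
    fix u assume u: "u \<in> P"
    show "0 \<le> D u" unfolding D_def using seminorm_onD(1)[OF N] sub(1)[OF u mP[OF u]] .
    fix v assume v: "v \<in> P"
    have "D (u + v) \<le> N ((u + v) + (m u + m v))"
      unfolding D_def by (intro m(2) sub(1) u v fun_space.span_add m(1))
    also have "(u + v) + (m u + m v) = (u + m u) + (v + m v)" by (simp add: algebra_simps)
    also have "N \<dots> \<le> D u + D v" unfolding D_def by (intro seminorm_onD(2)[OF N] sub(1) u v mP)
    finally show "D (u + v) \<le> D u + D v" .
  next
    fix u c assume u: "u \<in> P"
    have "D (fscale c u) \<le> N (fscale c u + fscale c (m u))"
      unfolding D_def by (intro m(2) sub(2) u fun_space.span_scale m(1))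
    also have "fscale c u + fscale c (m u) = fscale c (u + m u)" by (auto simp: algebra_simps)
    also have "N \<dots> \<le> \<bar>c\<bar> * D u" unfolding D_def by (intro seminorm_onD(3)[OF N] sub(1) u mP)
    finally show "D (fscale c u) \<le> \<bar>c\<bar> * D u" .
  qed
  obtain t0 where t0: "\<And>t. D (b + fscale t0 d) \<le> D (b + fscale t d)"
    using seminorm_line_attains_min[OF D P \<open>b \<in> P\<close> BP(2)] by blast
  have bt: "b + fscale t d \<in> P" for t using sub(1)[OF \<open>b \<in> P\<close> sub(2)[OF BP(2)]] .
  show ?case
  proof (intro bexI[of _ "fscale t0 d + m (b + fscale t0 d)"] ballI)
    have "fscale t0 d \<in> fun_space.span (insert d B)" by (intro fun_space.span_scale fun_space.span_base) simp
    moreover have "m (b + fscale t0 d) \<in> fun_space.span (insert d B)"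
      using m(1)[OF bt] fun_space.span_mono[of B "insert d B"] by blast
    ultimately show "fscale t0 d + m (b + fscale t0 d) \<in> fun_space.span (insert d B)"
      by (rule fun_space.span_add)
    fix u' assume "u' \<in> fun_space.span (insert d B)"
    then obtain t where t: "u' - fscale t d \<in> fun_space.span B"
      using fun_space.span_breakdown_eq by blast
    have "N (b + (fscale t0 d + m (b + fscale t0 d))) = D (b + fscale t0 d)"
      by (simp add: D_def add.assoc)
    also have "\<dots> \<le> D (b + fscale t d)" by (rule t0)
    also have "\<dots> \<le> N (b + fscale t d + (u' - fscale t d))" unfolding D_def by (rule m(2)[OF bt t])
    also have "b + fscale t d + (u' - fscale t d) = b + u'" by simp
    finally show "N (b + (fscale t0 d + m (b + fscale t0 d))) \<le> N (b + u')" .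
  qed
qed

text \<open>\<open>N2\<close> may have a kernel, so equivalence of norms does not apply directly. In
  the induction the new direction is represented by the element of \<open>b + span B\<close> with
  least \<open>N2\<close>. If that least value is 0, \<open>N1\<close> vanishes there too and the
  old constant survives; if it is positive, it controls the coefficient of the new
  direction.\<close>

lemma seminorm_span_comparison:
  assumes "finite B" "B \<subseteq> P" and P: "fun_space.subspace P" and N1: "seminorm_on P N1" and N2: "seminorm_on P N2"
    and ker: "\<And>u. u \<in> P \<Longrightarrow> N2 u = 0 \<Longrightarrow> N1 u = 0"
  shows "\<exists>C\<ge>0. \<forall>u\<in>fun_space.span B. N1 u \<le> C * N2 u"
  using assms(1,2)
proof (induction B rule: finite_induct)
  case empty
  have "(0::'a \<Rightarrow> real) \<in> P" by (rule fun_space.subspace_0[OF P])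
  then have "N2 0 = 0" "N1 0 = 0"
    using seminorm_on_scale[OF N2 P, of 0 0] seminorm_on_scale[OF N1 P, of 0 0] by (simp_all add: zero_fun_def)
  then show ?case by (intro exI[of _ 0]) (simp add: zero_fun_def)
next
  case (insert b B)
  then obtain C where C: "0 \<le> C" "\<And>u. u \<in> fun_space.span B \<Longrightarrow> N1 u \<le> C * N2 u" by auto
  have BP: "B \<subseteq> P" "b \<in> P" using insert.prems by auto
  have sP: "fun_space.span B \<subseteq> P" using fun_space.span_minimal[OF BP(1) P] .
  note sub = fun_space.subspace_add[OF P] fun_space.subspace_scale[OF P]
  obtain w where w: "w \<in> fun_space.span B" "\<And>u. u \<in> fun_space.span B \<Longrightarrow> N2 (b + w) \<le> N2 (b + u)"
    using seminorm_span_attains_min[OF insert(1) BP(1) P N2 BP(2)] by blast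
  have wP: "w \<in> P" using w sP by blast
  have bw: "b + w \<in> P" using sub(1)[OF BP(2) wP] .
  have dec: "\<exists>t u. v = fscale t b + u \<and> u \<in> fun_space.span B" if v: "v \<in> fun_space.span (insert b B)" for v
  proof -
    obtain t where "v - fscale t b \<in> fun_space.span B" using v fun_space.span_breakdown_eq by blast
    then show ?thesis by (intro exI[of _ t] exI[of _ "v - fscale t b"]) simp
  qed
  show ?case
  proof (cases "N2 (b + w) = 0")
    case True
    then have 0: "N1 (b + w) = 0" by (rule ker[OF bw])
    have "N1 v \<le> C * N2 v" if vs: "v \<in> fun_space.span (insert b B)" for v
    proof -
      obtain t u where v: "v = fscale t b + u" and u: "u \<in> fun_space.span B" using dec[OF vs] by blast
      define u' where "u' = u + fscale (- t) w"
      have u': "u' \<in> fun_space.span B" unfolding u'_def by (intro fun_space.span_add fun_space.span_scale u w)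
      then have u'P: "u' \<in> P" using sP by blast
      have v1: "v = fscale t (b + w) + u'" and v2: "u' = v + fscale (-t) (b + w)"
        unfolding v u'_def by (auto simp: algebra_simps)
      have tb: "fscale s (b + w) \<in> P" for s by (rule sub(2)[OF bw])
      have vP: "v \<in> P" unfolding v1 by (intro sub(1) tb u'P)
      have "N1 v \<le> N1 (fscale t (b + w)) + N1 u'" unfolding v1 by (rule seminorm_onD(2)[OF N1 tb u'P])
      also have "\<dots> \<le> C * N2 u'" using C(2)[OF u'] seminorm_on_scale[OF N1 P bw] 0 by simp
      also have "\<dots> \<le> C * (N2 v + N2 (fscale (-t) (b + w)))"
        unfolding v2 by (rule mult_left_mono[OF seminorm_onD(2)[OF N2 vP tb] C(1)])
      also have "N2 (fscale (-t) (b + w)) = 0"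
        unfolding seminorm_on_scale[OF N2 P bw] True by simp
      finally show ?thesis by simp
    qed
    then show ?thesis using C(1) by blast
  next
    case False
    define \<delta> where "\<delta> = N2 (b + w)"
    have \<delta>: "\<delta> > 0" using False seminorm_onD(1)[OF N2 bw] by (simp add: \<delta>_def)
    \<comment> \<open>For v = t b + u one has |t| \<delta> \<le> N2 v. The first term pays for N1 of
      t b, the others for u, whose N2 is at most N2 v + |t| N2 b.\<close>
    define K where "K = N1 b / \<delta> + C + C * N2 b / \<delta>"
    have K: "0 \<le> K" unfolding K_def using \<delta> C(1) seminorm_onD(1)[OF N1 BP(2)] seminorm_onD(1)[OF N2 BP(2)] by simp
    have "N1 v \<le> K * N2 v" if vs: "v \<in> fun_space.span (insert b B)" for v
    proof -
      obtain t u where v: "v = fscale t b + u" and u: "u \<in> fun_space.span B" using dec[OF vs] by blast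
      have uP: "u \<in> P" using u sP by blast
      have tb: "fscale s b \<in> P" for s by (rule sub(2)[OF BP(2)])
      have vP: "v \<in> P" unfolding v by (intro sub(1) tb uP)
      have t: "\<bar>t\<bar> * \<delta> \<le> N2 v"
      proof (cases "t = 0")
        case True
        then show ?thesis using seminorm_onD(1)[OF N2 vP] by simp
      next
        case False
        have tu: "fscale (1 / t) u \<in> fun_space.span B" by (rule fun_space.span_scale[OF u])
        have "v = fscale t (b + fscale (1 / t) u)" unfolding v using False by (auto simp: algebra_simps)
        then have "N2 v = N2 (fscale t (b + fscale (1 / t) u))" by (rule arg_cong)
        also have "\<dots> = \<bar>t\<bar> * N2 (b + fscale (1 / t) u)"
          by (rule seminorm_on_scale[OF N2 P sub(1)[OF BP(2) sub(2)[OF uP]]])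
        finally have "N2 v = \<bar>t\<bar> * N2 (b + fscale (1 / t) u)" .
        then show ?thesis using w(2)[OF tu] by (simp add: \<delta>_def mult_left_mono)
      qed
      have "u = v + fscale (- t) b" unfolding v by auto
      then have Nu: "N2 u \<le> N2 v + \<bar>t\<bar> * N2 b"
        using seminorm_onD(2)[OF N2 vP tb[of "-t"]] seminorm_on_scale[OF N2 P BP(2), of "-t"] by simp
      have "N1 v \<le> \<bar>t\<bar> * N1 b + N1 u"
        unfolding v using seminorm_onD(2)[OF N1 tb uP, of t] seminorm_on_scale[OF N1 P BP(2), of t] by simp
      also have "\<dots> \<le> \<bar>t\<bar> * N1 b + C * (N2 v + \<bar>t\<bar> * N2 b)"
        using C(2)[OF u] mult_left_mono[OF Nu C(1)] by linarith
      also have "\<dots> = \<bar>t\<bar> * \<delta> * (N1 b / \<delta> + C * N2 b / \<delta>) + C * N2 v"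
        using \<delta> by (simp add: field_simps)
      also have "\<dots> \<le> N2 v * (N1 b / \<delta> + C * N2 b / \<delta>) + C * N2 v"
        using t \<delta> C(1) seminorm_onD(1)[OF N1 BP(2)] seminorm_onD(1)[OF N2 BP(2)]
        by (intro add_right_mono mult_right_mono) auto
      also have "\<dots> = K * N2 v" by (simp add: K_def algebra_simps)
      finally show ?thesis .
    qed
    then show ?thesis using K by blast
  qed
qed

subsection \<open>Equivalence of Sobolev seminorms\<close>

lemma is_weak_deriv_lincomb:
  assumes U: "open U" and f: "is_weak_deriv U \<alpha> f f'" and g: "is_weak_deriv U \<alpha> g g'"
  shows "is_weak_deriv U \<alpha> (\<lambda>x. a * f x + b * g x) (\<lambda>x. a * f' x + b * g' x)"
proof -
  obtain js where js: "\<alpha> = count_list js" using ex_count_list[of \<alpha>] by metis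
  have li: "locally_integrable U f" "locally_integrable U f'" "locally_integrable U g" "locally_integrable U g'"
    using f g by (auto simp: is_weak_deriv_def)
  have lc: "locally_integrable U (\<lambda>x. a * u x + b * v x)" if "locally_integrable U u" "locally_integrable U v" for u v
    using that unfolding locally_integrable_def by (auto intro!: set_integral_add)
  have int: "(LINT x|lebesgue_on U. (a * u x + b * v x) * \<phi> x) =
      a * (LINT x|lebesgue_on U. u x * \<phi> x) + b * (LINT x|lebesgue_on U. v x * \<phi> x)"
    if "locally_integrable U u" "locally_integrable U v" "test_fun U \<phi>" for u v \<phi>
    using integral_test_fun(2)[OF U that(1,3)] integral_test_fun(2)[OF U that(2,3)]
    by (simp add: distrib_right mult.assoc)
  show ?thesis
    using f g unfolding js is_weak_deriv_iff
    by (simp add: lc li int test_fun_foldr, simp add: algebra_simps)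
qed

lemma is_weak_deriv_append:
  assumes g: "is_weak_deriv U (count_list is) f g" and h: "is_weak_deriv U (count_list js) g h"
  shows "is_weak_deriv U (count_list (is @ js)) f h"
  using assms unfolding is_weak_deriv_iff by (simp add: test_fun_foldr power_add mult.assoc)

lemma Lp_norm_scale_le:
  assumes "U \<in> lmeasurable" "f \<in> Lp_space \<infinity> U" "1 \<le> p"
  shows "Lp_norm p U (\<lambda>x. c * f x) \<le> \<bar>c\<bar> * Lp_norm p U f"
  using Lp_norm_sum_le[of U "{()}" "\<lambda>_. f" p "Lp_norm p U f" "\<lambda>_. c"] assms by (simp add: Lp_norm_nonneg)

lemma Lp_space_infinity_lincomb:
  assumes "f \<in> Lp_space \<infinity> U" "g \<in> Lp_space \<infinity> U"
  shows "(\<lambda>x. a * f x + b * g x) \<in> Lp_space \<infinity> U"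
  using Lp_space_infinity_sum[of "UNIV :: bool set" "\<lambda>i. if i then f else g" U "\<lambda>i. if i then a else b"] assms
  by (simp add: UNIV_bool add.commute)

text \<open>Seminorms are compared only at the extreme exponents 1 and \<infinity>; the other
  exponents are sandwiched between them on a set of finite measure.\<close>

lemma Lp_norm_triangle:
  assumes U: "U \<in> lmeasurable" and f: "f \<in> Lp_space \<infinity> U" and g: "g \<in> Lp_space \<infinity> U" and p: "p = 1 \<or> p = \<infinity>"
  shows "Lp_norm p U (\<lambda>x. f x + g x) \<le> Lp_norm p U f + Lp_norm p U g"
  using p
proof
  assume p: "p = \<infinity>"
  have "AE x in lebesgue_on U. \<bar>f x + g x\<bar> \<le> Lp_norm \<infinity> U f + Lp_norm \<infinity> U g"
    using AE_le_Lp_norm_infinity[OF f] AE_le_Lp_norm_infinity[OF g] by eventually_elim linarith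
  then show ?thesis unfolding p using f g
    by (intro Lp_norm_infinity_le) (auto simp: Lp_space_infinity_iff Lp_norm_nonneg)
next
  assume p: "p = 1"
  have 1: "Lp_norm 1 U f = (LINT x|lebesgue_on U. \<bar>f x\<bar>)" for f
    using Lp_norm_ereal[of 1 U f] by (simp flip: one_ereal_def add: integral_nonneg_AE)
  have i: "integrable (lebesgue_on U) f" "integrable (lebesgue_on U) g"
    using integrable_of_Lp_space_infinity[OF U] f g by auto
  have "(LINT x|lebesgue_on U. \<bar>f x + g x\<bar>) \<le> (LINT x|lebesgue_on U. \<bar>f x\<bar> + \<bar>g x\<bar>)"
    using i by (intro integral_mono) auto
  then show ?thesis unfolding p 1 using i by simp
qed

lemma seminorm_on_sobolev_seminorm:
  assumes U: "open U" "U \<in> lmeasurable" and P: "P \<subseteq> sobolev_space l \<infinity> U" "fun_space.subspace P"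
    and p: "p = 1 \<or> p = \<infinity>" and j: "j \<le> l"
  shows "seminorm_on P (sobolev_seminorm j p U)"
  unfolding seminorm_on_def
proof (intro conjI ballI allI)
  show "0 \<le> sobolev_seminorm j p U u" for u by (rule sobolev_seminorm_nonneg)
  have p1: "1 \<le> p" using p by auto
  note wd = sobolev_wderiv[OF U(1) P(1)[THEN subsetD]]
  { fix u v :: "real^'a \<Rightarrow> real" and js :: "'a list" and a b :: real
    assume uv: "u \<in> P" "v \<in> P" and js: "js \<in> lists_of_length j"
    have jl: "length js \<le> l" using js j by (simp add: lists_of_length_def)
    have "is_weak_deriv U (count_list js) (\<lambda>x. a * u x + b * v x) (\<lambda>x. a * wderiv U js u x + b * wderiv U js v x)"
      by (intro is_weak_deriv_lincomb U(1) wd(1) uv jl)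
    moreover have "(\<lambda>x. a * wderiv U js u x + b * wderiv U js v x) \<in> Lp_space \<infinity> U"
      by (intro Lp_space_infinity_lincomb wd(2) uv jl)
    ultimately have "Lp_norm p U (wderiv U js (\<lambda>x. a * u x + b * v x)) = Lp_norm p U (\<lambda>x. a * wderiv U js u x + b * wderiv U js v x)"
      by (rule wderiv_eq(3)[OF U(1)]) }
  note lin = this
  show "sobolev_seminorm j p U (u + v) \<le> sobolev_seminorm j p U u + sobolev_seminorm j p U v" if "u \<in> P" "v \<in> P" for u v
    unfolding sobolev_seminorm_def sum.distrib[symmetric]
  proof (rule sum_mono)
    fix js :: "'a list" assume js: "js \<in> lists_of_length j"
    then have jl: "length js \<le> l" using j by (simp add: lists_of_length_def)
    show "Lp_norm p U (wderiv U js (u + v)) \<le> Lp_norm p U (wderiv U js u) + Lp_norm p U (wderiv U js v)"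
      using lin[OF that js, of 1 1] Lp_norm_triangle[OF U(2) wd(2)[OF that(1) jl] wd(2)[OF that(2) jl] p]
      by (simp add: plus_fun_def)
  qed
  show "sobolev_seminorm j p U (fscale c u) \<le> \<bar>c\<bar> * sobolev_seminorm j p U u" if "u \<in> P" for u c
    unfolding sobolev_seminorm_def sum_distrib_left
  proof (rule sum_mono)
    fix js :: "'a list" assume js: "js \<in> lists_of_length j"
    then have jl: "length js \<le> l" using j by (simp add: lists_of_length_def)
    show "Lp_norm p U (wderiv U js (fscale c u)) \<le> \<bar>c\<bar> * Lp_norm p U (wderiv U js u)"
      using lin[OF that that js, of c 0] Lp_norm_scale_le[OF U(2) wd(2)[OF that jl] p1, of c] by simp
  qed
qed

lemma Lp_norm_1_eq_0:
  assumes U: "U \<in> lmeasurable" and f: "f \<in> Lp_space \<infinity> U" and z: "Lp_norm 1 U f = 0"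
  shows "AE x in lebesgue_on U. f x = 0"
proof -
  have "(LINT x|lebesgue_on U. \<bar>f x\<bar>) = 0"
    using Lp_norm_ereal[of 1 U f] z by (simp flip: one_ereal_def add: integral_nonneg_AE)
  then show ?thesis
    using integral_nonneg_eq_0_iff_AE[of "lebesgue_on U" "\<lambda>x. \<bar>f x\<bar>"] integrable_of_Lp_space_infinity[OF U f] by simp
qed

text \<open>A derivative of order j \<ge> r is a further derivative of one of order r: the list is
  cut after r entries, and a weak derivative of zero is zero.\<close>

lemma sobolev_seminorm_kernel:
  assumes U: "open U" "U \<in> lmeasurable" and v: "v \<in> sobolev_space l \<infinity> U" and rj: "r \<le> j" "j \<le> l"
    and z: "sobolev_seminorm r 1 U v = 0"
  shows "sobolev_seminorm j \<infinity> U v = 0"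
proof -
  have 0: "(\<lambda>x. 0) \<in> Lp_space \<infinity> U" by (auto simp: Lp_space_infinity_iff)
  have n0: "Lp_norm \<infinity> U (\<lambda>x. 0) = 0"
    using Lp_norm_infinity_le[of "\<lambda>x. 0" U 0] Lp_norm_nonneg[of \<infinity> U "\<lambda>x. 0"] by simp
  have "Lp_norm \<infinity> U (wderiv U js v) = 0" if js: "length js = j" for js
  proof -
    define a b where "a = take r js" and "b = drop r js"
    have ab: "js = a @ b" "length a = r" using rj js by (auto simp: a_def b_def)
    have al: "length a \<le> l" using ab rj by simp
    have "Lp_norm 1 U (wderiv U a v) = 0"
      using Lp_norm_le_sobolev_seminorm[of 1 U a v] z Lp_norm_nonneg[of 1 U "wderiv U a v"] ab by simp
    then have ae: "AE x in lebesgue_on U. wderiv U a v x = 0"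
      by (rule Lp_norm_1_eq_0[OF U(2) sobolev_wderiv(2)[OF U(1) v al]])
    have "is_weak_deriv U (count_list a) v (\<lambda>x. 0)"
      by (rule is_weak_deriv_cong_AE[OF U(1) sobolev_wderiv(1)[OF U(1) v al] _ ae]) simp
    moreover have "is_weak_deriv U (count_list b) (\<lambda>x. 0) (\<lambda>x. 0)"
      using locally_integrable_of_Lp_space_infinity[OF U(2) 0] by (simp add: is_weak_deriv_iff)
    ultimately have "is_weak_deriv U (count_list js) v (\<lambda>x. 0)"
      unfolding ab(1) by (rule is_weak_deriv_append)
    from wderiv_eq(3)[OF U(1) this 0] show ?thesis using n0 by simp
  qed
  then show ?thesis unfolding sobolev_seminorm_def by (simp add: lists_of_length_def)
qed

lemma sobolev_seminorm_le_infinity: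
  assumes U: "open U" "U \<in> lmeasurable" and v: "v \<in> sobolev_space l \<infinity> U" and j: "j \<le> l" and p: "1 \<le> p"
  shows "sobolev_seminorm j p U v \<le> (measure lebesgue U + 1) * sobolev_seminorm j \<infinity> U v"
    "sobolev_seminorm j 1 U v \<le> (measure lebesgue U + 1) * sobolev_seminorm j p U v"
  unfolding sobolev_seminorm_def sum_distrib_left
  using j by (auto intro!: sum_mono Lp_norm_le_infinity Lp_norm_1_le U p sobolev_wderiv(2)[OF U(1) v] simp: lists_of_length_def)

text \<open>The chain goes from p up to \<infinity>, by finite dimension from \<infinity> down to 1,
  and from 1 up to q. Summing the constants over all orders makes M independent of j.\<close>

lemma sobolev_seminorm_equiv:
  assumes U: "open U" "U \<in> lmeasurable" and B: "finite B" "P = fun_space.span B" and P: "P \<subseteq> sobolev_space l \<infinity> U"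
    and p: "1 \<le> p" "1 \<le> q"
  obtains M where "0 \<le> M" "\<And>v j. v \<in> P \<Longrightarrow> j \<le> l \<Longrightarrow> sobolev_seminorm j p U v \<le> M * sobolev_seminorm (min j m) q U v"
proof -
  have sub: "fun_space.subspace P" unfolding B(2) by (rule fun_space.subspace_span)
  have BP: "B \<subseteq> P" unfolding B(2) by (rule fun_space.span_superset)
  let ?\<mu> = "measure lebesgue U + 1"
  have "\<exists>M\<ge>0. \<forall>v\<in>P. sobolev_seminorm j \<infinity> U v \<le> M * sobolev_seminorm (min j m) 1 U v" if "j \<le> l" for j
    unfolding B(2)
    by (rule seminorm_span_comparison[OF B(1) BP sub])
       (use that P in \<open>auto intro!: seminorm_on_sobolev_seminorm[OF U P sub] sobolev_seminorm_kernel[OF U, of _ l "min j m"]\<close>)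
  then obtain M where M: "\<And>j. j \<le> l \<Longrightarrow> 0 \<le> M j"
    "\<And>j v. j \<le> l \<Longrightarrow> v \<in> P \<Longrightarrow> sobolev_seminorm j \<infinity> U v \<le> M j * sobolev_seminorm (min j m) 1 U v"
    by metis
  let ?M = "\<Sum>j\<le>l. M j"
  show thesis
  proof (rule that[of "?\<mu> * ?M * ?\<mu>"])
    show "0 \<le> ?\<mu> * ?M * ?\<mu>" using M(1) by (auto intro!: mult_nonneg_nonneg sum_nonneg)
    fix v j assume v: "v \<in> P" and j: "j \<le> l"
    have v': "v \<in> sobolev_space l \<infinity> U" using v P by blast
    have "sobolev_seminorm j p U v \<le> ?\<mu> * sobolev_seminorm j \<infinity> U v"
      by (rule sobolev_seminorm_le_infinity(1)[OF U v' j p(1)])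
    also have "\<dots> \<le> ?\<mu> * (M j * sobolev_seminorm (min j m) 1 U v)"
      using M(2)[OF j v] by (intro mult_left_mono) auto
    also have "\<dots> \<le> ?\<mu> * (?M * sobolev_seminorm (min j m) 1 U v)"
      using j M(1) by (intro mult_left_mono mult_right_mono member_le_sum sobolev_seminorm_nonneg) auto
    also have "\<dots> \<le> ?\<mu> * (?M * (?\<mu> * sobolev_seminorm (min j m) q U v))"
      using j M(1) by (intro mult_left_mono sobolev_seminorm_le_infinity(2)[OF U v' _ p(2)]) (auto intro: sum_nonneg)
    finally show "sobolev_seminorm j p U v \<le> ?\<mu> * ?M * ?\<mu> * sobolev_seminorm (min j m) q U v" by (simp add: mult_ac)
  qed
qed

section \<open>The Markov inequality in Lebesgue norms\<close>

fun chebyshev :: "nat \<Rightarrow> real poly" where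
  "chebyshev 0 = 1"
| "chebyshev (Suc 0) = [:0, 1:]"
| "chebyshev (Suc (Suc n)) = [:0, 2:] * chebyshev (Suc n) - chebyshev n"

lemma degree_chebyshev: "degree (chebyshev n) \<le> n"
proof (induction n rule: chebyshev.induct)
  case (3 n)
  have "degree ([:0, 2:] * chebyshev (Suc n)) \<le> Suc (Suc n)"
    by (rule order_trans[OF degree_mult_le]) (use 3 in simp)
  moreover have "degree (chebyshev n) \<le> Suc (Suc n)" using 3 by simp
  ultimately show ?case by (simp only: chebyshev.simps degree_diff_le)
qed auto

lemma poly_chebyshev_cos: "poly (chebyshev n) (cos t) = cos (real n * t)"
proof (induction n rule: chebyshev.induct)
  case (3 n)
  have "cos (real (Suc (Suc n)) * t) = cos (real (Suc n) * t + t)" "cos (real n * t) = cos (real (Suc n) * t - t)"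
    by (simp_all add: algebra_simps)
  then show ?case using 3 by (simp add: cos_add cos_diff del: of_nat_Suc)
qed auto

lemma poly_chebyshev_1: "poly (chebyshev n) 1 = 1"
  using poly_chebyshev_cos[of n 0] by simp

text \<open>Differentiating the recurrence at 1, where all values are 1, gives 2 + 2 (n+1)^2 - n^2 =
  (n+2)^2.\<close>

lemma pderiv_chebyshev_1: "poly (pderiv (chebyshev n)) 1 = (real n)\<^sup>2"
proof (induction n rule: chebyshev.induct)
  case (3 n)
  then show ?case
    by (simp add: pderiv_diff pderiv_mult pderiv_pCons pderiv_smult poly_chebyshev_1 power2_eq_square algebra_simps)
qed (auto simp: pderiv_pCons)

lemma pderiv_sum: "pderiv (\<Sum>i\<in>I. f i) = (\<Sum>i\<in>I. pderiv (f i))"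
  by (induction I rule: infinite_finite_induct) (simp_all add: pderiv_add)

text \<open>Lagrange interpolation of the derivative at 1 in the extremal points of the Chebyshev polynomial:
  the weights alternate in sign just like the Chebyshev polynomial at the nodes, so their absolute sum is
  the derivative of that polynomial.\<close>

lemma markov_endpoint_formula:
  assumes k: "1 \<le> k"
  obtains y w :: "nat \<Rightarrow> real" where "\<And>j. \<bar>y j\<bar> \<le> 1" "(\<Sum>j\<le>k. \<bar>w j\<bar>) = (real k)\<^sup>2"
    "\<And>u. degree u \<le> k \<Longrightarrow> poly (pderiv u) 1 = (\<Sum>j\<le>k. w j * poly u (y j))"
proof -
  \<comment> \<open>The points where the Chebyshev polynomial equals 1 or -1, decreasing in j on
    [0, k] from y_0 = 1 to y_k = -1.\<close>
  define y where "y j = cos (real j * (pi / real k))" for j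
  have y1: "\<bar>y j\<bar> \<le> 1" for j by (simp add: y_def)
  have mono: "y j < y i" if "i < j" "j \<le> k" for i j
    unfolding y_def
  proof (rule cos_monotone_0_pi)
    have "real j * pi \<le> real k * pi" using that by (intro mult_right_mono) auto
    then show "real j * (pi / real k) \<le> pi" using k by (simp add: field_simps)
    show "real i * (pi / real k) < real j * (pi / real k)" using that k by (intro mult_strict_right_mono) auto
  qed (use k in auto)
  have inj: "inj_on y {..k}"
    by (rule inj_onI) (metis atMost_iff linorder_neqE_nat mono order_less_irrefl)
  define N where "N j = (\<Prod>i\<in>{..k} - {j}. [:- y i, 1:])" for j
  define c where "c j = (\<Prod>i\<in>{..k} - {j}. y j - y i)" for j
  have c0: "c j \<noteq> 0" if "j \<le> k" for j
    unfolding c_def using that inj by (auto simp: prod_zero_iff inj_on_def)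
  have polyN: "poly (N j) x = (\<Prod>i\<in>{..k} - {j}. x - y i)" for j x
    by (simp add: N_def poly_prod)
  have N0: "poly (N j) (y i) = 0" if "i \<le> k" "i \<noteq> j" for i j
    unfolding polyN using that by (intro prod_zero) auto
  have Nc: "poly (N j) (y j) = c j" for j by (simp add: polyN c_def)
  have degN: "degree (N j) \<le> k" if "j \<le> k" for j
  proof -
    have "degree (N j) \<le> (\<Sum>i\<in>{..k} - {j}. degree [:- y i, 1:])" unfolding N_def using degree_prod_sum_le[of "{..k} - {j}" "\<lambda>i. [:- y i, 1:]"] by (simp add: o_def)
    then show ?thesis using that by simp
  qed
  define w where "w j = poly (pderiv (N j)) 1 / c j" for j
  have formula: "poly (pderiv u) 1 = (\<Sum>j\<le>k. w j * poly u (y j))" if u: "degree u \<le> k" for u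
  proof -
    have "u = (\<Sum>j\<le>k. smult (poly u (y j) / c j) (N j))"
    proof (rule poly_eqI_degree[of "y ` {..k}"])
      fix x assume "x \<in> y ` {..k}"
      then obtain i where i: "i \<le> k" "x = y i" by auto
      have "(\<Sum>j\<le>k. poly u (y j) / c j * poly (N j) (y i)) = (\<Sum>j\<le>k. if j = i then poly u (y i) else 0)"
        using i N0 c0 by (intro sum.cong refl) (auto simp: Nc)
      then show "poly u x = poly (\<Sum>j\<le>k. smult (poly u (y j) / c j) (N j)) x"
        using i by (simp add: poly_sum)
    next
      have "card (y ` {..k}) = Suc k" using card_image[OF inj] by simp
      moreover have "degree (\<Sum>j\<le>k. smult (poly u (y j) / c j) (N j)) \<le> k"
        by (intro degree_sum_le order_trans[OF degree_smult_le degN]) auto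
      ultimately show "degree u < card (y ` {..k})"
        "degree (\<Sum>j\<le>k. smult (poly u (y j) / c j) (N j)) < card (y ` {..k})" using u by auto
    qed
    then have "pderiv u = (\<Sum>j\<le>k. smult (poly u (y j) / c j) (pderiv (N j)))"
      by (metis (no_types, lifting) pderiv_smult pderiv_sum sum.cong)
    then show ?thesis by (simp add: poly_sum w_def mult.commute)
  qed
  \<comment> \<open>The derivative at 1 is a sum of products of factors 1 - y_i, all nonnegative.
    This is what singles out the endpoint.\<close>
  have pN: "0 \<le> poly (pderiv (N j)) 1" for j
    unfolding N_def pderiv_prod using y1
    by (auto simp: poly_sum poly_prod pderiv_pCons abs_le_iff intro!: sum_nonneg prod_nonneg)
  \<comment> \<open>Exactly the j factors with i < j are negative, as the nodes decrease.\<close>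
  have sign: "(-1) ^ j * c j > 0" if j: "j \<le> k" for j
  proof -
    have "{..k} - {j} = {..<j} \<union> {j<..k}" using j by auto
    then have "c j = (\<Prod>i<j. y j - y i) * (\<Prod>i\<in>{j<..k}. y j - y i)"
      unfolding c_def by (simp add: prod.union_disjoint disjoint_iff)
    also have "(\<Prod>i<j. y j - y i) = (-1) ^ j * (\<Prod>i<j. y i - y j)"
      using prod.distrib[of "\<lambda>_. -1" "\<lambda>i. y i - y j" "{..<j}"] by simp
    finally have "(-1) ^ j * c j = (\<Prod>i<j. y i - y j) * (\<Prod>i\<in>{j<..k}. y j - y i)"
      by (simp add: mult.assoc[symmetric] power_add[symmetric] flip: mult_2)
    then show ?thesis using mono j by (auto intro!: mult_pos_pos prod_pos)
  qed
  have absw: "\<bar>w j\<bar> = w j * (-1) ^ j" if j: "j \<le> k" for j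
  proof -
    have "0 \<le> poly (pderiv (N j)) 1 / ((-1) ^ j * c j)" using pN sign[OF j] by (intro divide_nonneg_pos) auto
    also have "\<dots> = w j * (-1) ^ j" by (cases "even j") (auto simp: w_def)
    finally have "\<bar>w j * (-1) ^ j\<bar> = w j * (-1) ^ j" by simp
    then show ?thesis by (simp add: abs_mult power_abs)
  qed
  have "poly (chebyshev k) (y j) = (-1) ^ j" for j
  proof -
    have "real k * (real j * (pi / real k)) = real j * pi" using k by simp
    then show ?thesis unfolding y_def poly_chebyshev_cos by simp
  qed
  then have "(\<Sum>j\<le>k. \<bar>w j\<bar>) = poly (pderiv (chebyshev k)) 1"
    using formula[OF degree_chebyshev] absw by simp
  then show thesis using that[of y w] y1 formula pderiv_chebyshev_1 by simp
qed

subsection \<open>Tensor product polynomials\<close>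

text \<open>Members of \<open>Qk\<close> are cut off by zero outside the cube and are thus not
  smooth. These are the uncut polynomials on the whole space, equal to them on the cube.\<close>

inductive_set tensor_polys :: "nat \<Rightarrow> (real^'n::finite \<Rightarrow> real) set" for k where
  monomial: "(\<And>i. \<alpha> i \<le> k) \<Longrightarrow> (\<lambda>x. c * (\<Prod>i\<in>UNIV. (x $ i) ^ \<alpha> i)) \<in> tensor_polys k"
| add: "u \<in> tensor_polys k \<Longrightarrow> v \<in> tensor_polys k \<Longrightarrow> (\<lambda>x. u x + v x) \<in> tensor_polys k"

lemma Qk_tensor_poly:
  assumes "v \<in> Qk k K" obtains u where "u \<in> tensor_polys k" "\<And>x. x \<in> K \<Longrightarrow> v x = u x"
proof -
  have "\<exists>u\<in>tensor_polys k. \<forall>x\<in>K. v x = u x"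
    using assms unfolding Qk_def
  proof (induction rule: fun_space.span_induct_alt)
    case base
    show ?case by (rule bexI[OF _ tensor_polys.monomial[of "\<lambda>_. 0" k 0]]) auto
  next
    case (step c f g)
    then obtain \<alpha> where \<alpha>: "\<And>i. \<alpha> i \<le> k" and f: "f = (\<lambda>x. if x \<in> K then \<Prod>i\<in>UNIV. (x $ i) ^ \<alpha> i else 0)" by auto
    obtain u where u: "u \<in> tensor_polys k" "\<forall>x\<in>K. g x = u x" using step by blast
    have "(\<lambda>x. c * (\<Prod>i\<in>UNIV. (x $ i) ^ \<alpha> i) + u x) \<in> tensor_polys k"
      by (intro tensor_polys.add tensor_polys.monomial \<alpha> u)
    then show ?case by (rule bexI[rotated]) (use u in \<open>auto simp: f\<close>)
  qed
  then show thesis using that by blast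
qed

lemma smooth_fun_nth: "smooth_fun (\<lambda>x::real^'n::finite. x $ i)"
proof -
  let ?F = "\<lambda>(n::nat) (t::real). if n = 0 then t else if n = 1 then 1 else (0::real)"
  have "(?F n has_real_derivative ?F (Suc n) t) (at t)" for n t by simp
  from smooth_fun_coordinate[where F="?F" and s=1 and i=i and t=0, OF this] show ?thesis by simp
qed

lemma smooth_fun_power: "smooth_fun f \<Longrightarrow> smooth_fun (\<lambda>x. f x ^ n)"
  by (induction n) (auto intro: smooth_fun_const smooth_fun_mult)

lemma smooth_fun_tensor_poly: "v \<in> tensor_polys k \<Longrightarrow> smooth_fun v"
  by (induction rule: tensor_polys.induct)
     (auto intro!: smooth_fun_cmult smooth_fun_prod smooth_fun_power smooth_fun_nth smooth_fun_add)

lemma monomial_along_axis: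
  fixes x :: "real^'n::finite"
  shows "(\<Prod>j\<in>UNIV. ((x + t *\<^sub>R axis i 1) $ j) ^ \<alpha> j) = (x $ i + t) ^ \<alpha> i * (\<Prod>j\<in>UNIV - {i}. (x $ j) ^ \<alpha> j)"
  by (subst prod.remove[of _ i]) (auto simp: axis_def intro!: prod.cong)

lemma pderiv1_unique:
  fixes f :: "real^'n::finite \<Rightarrow> real"
  assumes "smooth_fun f" "((\<lambda>t. f (x + t *\<^sub>R axis i 1)) has_real_derivative d) (at 0)"
  shows "pderiv1 i f x = d"
  using DERIV_unique[OF has_real_derivative_along_axis[OF smooth_fun_differentiable[OF assms(1)], where x=x and t=0 and i=i] assms(2)] by simp

lemma tensor_poly_pderiv1: "v \<in> tensor_polys k \<Longrightarrow> pderiv1 i v \<in> tensor_polys k"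
proof (induction rule: tensor_polys.induct)
  case (monomial \<alpha> c)
  \<comment> \<open>For \<alpha> i = 0 the truncated subtraction is harmless because the coefficient
    \<alpha> i is 0.\<close>
  let ?v = "\<lambda>x. c * (\<Prod>i\<in>UNIV. (x $ i) ^ \<alpha> i)" and ?\<beta> = "\<alpha>(i := \<alpha> i - 1)"
  have s: "smooth_fun ?v" by (rule smooth_fun_tensor_poly[OF tensor_polys.monomial[OF monomial]])
  have "pderiv1 i ?v = (\<lambda>x. (c * real (\<alpha> i)) * (\<Prod>j\<in>UNIV. (x $ j) ^ ?\<beta> j))"
  proof (rule ext, rule pderiv1_unique[OF s])
    fix x :: "real^'a"
    have "(\<Prod>j\<in>UNIV. (x $ j) ^ ?\<beta> j) = (x $ i) ^ (\<alpha> i - 1) * (\<Prod>j\<in>UNIV - {i}. (x $ j) ^ \<alpha> j)"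
      by (subst prod.remove[of _ i]) (auto intro!: prod.cong)
    then show "((\<lambda>t. c * (\<Prod>j\<in>UNIV. ((x + t *\<^sub>R axis i 1) $ j) ^ \<alpha> j)) has_real_derivative
        c * real (\<alpha> i) * (\<Prod>j\<in>UNIV. (x $ j) ^ ?\<beta> j)) (at 0)"
      unfolding monomial_along_axis by (auto intro!: derivative_eq_intros)
  qed
  moreover have "?\<beta> j \<le> k" for j using monomial[of j] monomial[of i] by auto
  ultimately show ?case using tensor_polys.monomial[of ?\<beta> k "c * real (\<alpha> i)"] by simp
next
  case (add u v)
  have "pderiv1 i (\<lambda>x. u x + v x) = (\<lambda>x. pderiv1 i u x + pderiv1 i v x)"
    using pderiv1_affine(2)[OF smooth_fun_differentiable smooth_fun_differentiable, where a=1 and b=1 and i=i]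
      add(1,2)[THEN smooth_fun_tensor_poly] by (simp add: fun_eq_iff)
  then show ?case using add by (auto intro: tensor_polys.add)
qed

lemma tensor_poly_foldr: "v \<in> tensor_polys k \<Longrightarrow> foldr pderiv1 js v \<in> tensor_polys k"
  by (induction js) (auto intro: tensor_poly_pderiv1)

text \<open>Bounding the degree in each variable separately is exactly what bounds the degree along
  lines parallel to the axes, so one-dimensional formulas apply.\<close>

lemma tensor_poly_along_axis:
  "v \<in> tensor_polys k \<Longrightarrow> \<exists>u. degree u \<le> k \<and> (\<forall>t. v (x + t *\<^sub>R axis i 1) = poly u t)"
proof (induction rule: tensor_polys.induct)
  case (monomial \<alpha> c)
  let ?u = "smult (c * (\<Prod>j\<in>UNIV - {i}. (x $ j) ^ \<alpha> j)) ([:x $ i, 1:] ^ \<alpha> i)"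
  have "degree ?u \<le> k"
    by (rule order_trans[OF degree_smult_le], rule order_trans[OF degree_power_le]) (simp add: monomial)
  moreover have "\<forall>t. c * (\<Prod>j\<in>UNIV. ((x + t *\<^sub>R axis i 1) $ j) ^ \<alpha> j) = poly ?u t"
    unfolding monomial_along_axis by (simp add: poly_power)
  ultimately show ?case by blast
next
  case (add u v)
  then obtain u' v' where "degree u' \<le> k" "\<forall>t. u (x + t *\<^sub>R axis i 1) = poly u' t"
    "degree v' \<le> k" "\<forall>t. v (x + t *\<^sub>R axis i 1) = poly v' t" by blast
  then show ?case by (intro exI[of _ "u' + v'"]) (auto intro: degree_add_le)
qed

text \<open>The endpoint formula is transplanted from [-1, 1] to an interval of length 1 ending or
  starting at x. Halving the length doubles the weights, hence 2 k^2; reversing the orientation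
  changes the sign in the second form.\<close>

lemma tensor_poly_pderiv1_formula:
  assumes k: "1 \<le> k"
  obtains s w :: "nat \<Rightarrow> real" where "\<And>j. 0 \<le> s j \<and> s j \<le> 1" "(\<Sum>j\<le>k. \<bar>w j\<bar>) = 2 * (real k)\<^sup>2"
    "\<And>(v :: real^'n::finite \<Rightarrow> real) i x. v \<in> tensor_polys k \<Longrightarrow>
       pderiv1 i v x = (\<Sum>j\<le>k. w j * v (x - s j *\<^sub>R axis i 1)) \<and>
       pderiv1 i v x = (\<Sum>j\<le>k. w j * - v (x + s j *\<^sub>R axis i 1))"
proof -
  obtain y w :: "nat \<Rightarrow> real" where yw: "\<And>j. \<bar>y j\<bar> \<le> 1" "(\<Sum>j\<le>k. \<bar>w j\<bar>) = (real k)\<^sup>2"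
    "\<And>u. degree u \<le> k \<Longrightarrow> poly (pderiv u) 1 = (\<Sum>j\<le>k. w j * poly u (y j))"
    using markov_endpoint_formula[OF k] by metis
  define s where "s j = (1 - y j) / 2" for j
  show thesis
  proof (rule that[of s "\<lambda>j. 2 * w j"])
    show "0 \<le> s j \<and> s j \<le> 1" for j using yw(1)[of j] by (auto simp: s_def abs_le_iff)
    show "(\<Sum>j\<le>k. \<bar>2 * w j\<bar>) = 2 * (real k)\<^sup>2" using yw(2) by (simp add: abs_mult sum_distrib_left[symmetric])
    fix v :: "real^'n \<Rightarrow> real" and i x assume v: "v \<in> tensor_polys k"
    obtain u where u: "degree u \<le> k" "\<And>t. v (x + t *\<^sub>R axis i 1) = poly u t"
      using tensor_poly_along_axis[OF v] by blast
    have d: "pderiv1 i v x = poly (pderiv u) 0"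
      by (rule pderiv1_unique[OF smooth_fun_tensor_poly[OF v]]) (simp add: u(2) poly_DERIV)
    \<comment> \<open>The substitution y -> c (y - 1) takes 1 to 0; c = 1/2 and c = -1/2 take
      [-1, 1] onto [-1, 0] and [0, 1].\<close>
    have f: "poly (pderiv u) 0 = (\<Sum>j\<le>k. (w j / c) * poly u (c * (y j - 1)))" if "c \<noteq> 0" for c
    proof -
      have "degree (pcompose u [:- c, c:]) \<le> k" using u(1) by (simp add: degree_pcompose that)
      from yw(3)[OF this] have "c * poly (pderiv u) 0 = (\<Sum>j\<le>k. w j * poly u (c * (y j - 1)))"
        by (simp add: pderiv_pcompose pderiv_pCons poly_pcompose algebra_simps)
      then have "poly (pderiv u) 0 = (\<Sum>j\<le>k. w j * poly u (c * (y j - 1))) / c" using that by (simp add: field_simps)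
      then show ?thesis by (simp add: sum_divide_distrib)
    qed
    have 1: "v (x - s j *\<^sub>R axis i 1) = poly u (1/2 * (y j - 1))" for j
    proof -
      have "x - s j *\<^sub>R axis i 1 = x + (1/2 * (y j - 1)) *\<^sub>R axis i 1"
        by (simp add: s_def vec_eq_iff axis_def field_simps)
      then show ?thesis by (simp only: u(2))
    qed
    have 2: "v (x + s j *\<^sub>R axis i 1) = poly u (- 1/2 * (y j - 1))" for j
    proof -
      have "x + s j *\<^sub>R axis i 1 = x + (- 1/2 * (y j - 1)) *\<^sub>R axis i 1"
        by (simp add: s_def vec_eq_iff axis_def field_simps)
      then show ?thesis by (simp only: u(2))
    qed
    show "pderiv1 i v x = (\<Sum>j\<le>k. 2 * w j * v (x - s j *\<^sub>R axis i 1)) \<and>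
       pderiv1 i v x = (\<Sum>j\<le>k. 2 * w j * - v (x + s j *\<^sub>R axis i 1))"
      unfolding d 1 2 using f[of "1/2"] f[of "-1/2"] by (simp add: mult.commute)
  qed
qed

section \<open>Continuous functions and translations on the open cube\<close>

lemma integral_lebesgue_on_borel:
  fixes f :: "'a::euclidean_space \<Rightarrow> real"
  assumes U: "U \<in> sets borel" and f: "f \<in> borel_measurable borel"
  shows "(LINT x|lebesgue_on U. f x) = (LINT x|lborel. indicator U x * f x)"
    "integrable (lebesgue_on U) f \<longleftrightarrow> integrable lborel (\<lambda>x. indicator U x * f x)"
proof -
  have m: "(\<lambda>x. indicator U x * f x) \<in> borel_measurable lborel"
    using U f by (auto intro!: borel_measurable_times borel_measurable_indicator)
  show "(LINT x|lebesgue_on U. f x) = (LINT x|lborel. indicator U x * f x)"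
    using U m by (subst integral_restrict_space) (auto simp: integral_completion)
  show "integrable (lebesgue_on U) f \<longleftrightarrow> integrable lborel (\<lambda>x. indicator U x * f x)"
    using U m by (subst integrable_restrict_space) (auto simp: integrable_completion)
qed

definition open_cube :: "(real^'n::finite) set" where
  "open_cube = box (\<chi> i. - 1) (\<chi> i. 1)"

lemma interior_ref_cube: "interior ref_cube = open_cube"
  by (simp add: ref_cube_def open_cube_def interior_cbox)

lemma open_open_cube [simp]: "open open_cube" unfolding open_cube_def by (rule open_box)

lemma open_cube_lmeasurable [simp]: "open_cube \<in> lmeasurable" by (simp add: open_cube_def)

lemma mem_open_cube: "x \<in> open_cube \<longleftrightarrow> (\<forall>i. \<bar>x $ i\<bar> < 1)"
  by (auto simp: open_cube_def mem_box_cart abs_less_iff minus_less_iff)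

lemma open_cube_subset: "open_cube \<subseteq> ref_cube"
  unfolding open_cube_def ref_cube_def by (rule box_subset_cbox)

lemma continuous_in_Lp_space_cube:
  assumes "continuous_on UNIV v" shows "v \<in> Lp_space \<infinity> open_cube"
proof -
  have "compact (v ` ref_cube)"
    using assms by (auto simp: ref_cube_def intro!: compact_continuous_image intro: continuous_on_subset)
  then obtain B where "\<And>x. x \<in> ref_cube \<Longrightarrow> \<bar>v x\<bar> \<le> B"
    using compact_imp_bounded[of "v ` ref_cube"] unfolding bounded_iff by auto
  then have "AE x in lebesgue_on open_cube. \<bar>v x\<bar> \<le> B"
    using open_cube_subset by (intro AE_I2) auto
  moreover have "v \<in> borel_measurable (lebesgue_on open_cube)"
    using assms by (intro measurable_restrict_space1 measurable_completion) (simp add: borel_measurable_continuous_onI)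
  ultimately show ?thesis by (auto simp: Lp_space_infinity_iff)
qed

text \<open>If the bound failed at one point it would fail on a nonempty open set, which is not
  negligible.\<close>

lemma continuous_AE_le:
  fixes v :: "'a::euclidean_space \<Rightarrow> real"
  assumes v: "continuous_on UNIV v" and U: "open U" and ae: "AE x in lebesgue_on U. \<bar>v x\<bar> \<le> a" and x: "x \<in> U"
  shows "\<bar>v x\<bar> \<le> a"
proof (rule ccontr)
  let ?S = "U \<inter> (\<lambda>x. \<bar>v x\<bar>) -` {a<..}"
  assume "\<not> \<bar>v x\<bar> \<le> a"
  then have "x \<in> ?S" using x by simp
  moreover have "open ?S" using v U by (intro open_Int open_vimage continuous_intros) auto
  ultimately have "\<not> negligible ?S" using open_not_negligible by blast
  moreover have "AE x in lebesgue. x \<notin> ?S"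
    using ae U by (subst (asm) AE_restrict_space_iff) (auto elim!: eventually_mono)
  then have "?S \<in> null_sets lebesgue" using \<open>open ?S\<close> by (subst AE_iff_null_sets) auto
  ultimately show False by (simp add: negligible_iff_null_sets)
qed

lemma abs_le_Lp_norm_infinity_cube:
  "continuous_on UNIV v \<Longrightarrow> x \<in> open_cube \<Longrightarrow> \<bar>v x\<bar> \<le> Lp_norm \<infinity> open_cube v"
  using continuous_AE_le[OF _ open_open_cube AE_le_Lp_norm_infinity[OF continuous_in_Lp_space_cube]] by blast

text \<open>Translating by at most 1 towards the hyperplane \<open>x\<^sub>i = 0\<close> keeps each half of the cube inside the cube.\<close>

lemma Lp_norm_fold_translate:
  fixes v :: "real^'n::finite \<Rightarrow> real" and i :: 'n
  assumes v: "continuous_on UNIV v" and s: "0 \<le> s" "s \<le> 1" and p: "1 \<le> p"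
  defines "g \<equiv> \<lambda>x. if 0 \<le> x $ i then v (x - s *\<^sub>R axis i 1) else - v (x + s *\<^sub>R axis i 1)"
  shows "g \<in> Lp_space \<infinity> open_cube" "Lp_norm p open_cube g \<le> 2 * Lp_norm p open_cube v"
proof -
  let ?e = "axis i 1 :: real^'n"
  \<comment> \<open>The hyperplane x_i = 0 must be left out: for s = 1 its points are moved onto the
    boundary. It is a null set.\<close>
  have cube: "(if 0 \<le> x $ i then x - s *\<^sub>R ?e else x + s *\<^sub>R ?e) \<in> open_cube"
    if x: "x \<in> open_cube" "x $ i \<noteq> 0" for x
    unfolding mem_open_cube
  proof
    fix j
    have "\<bar>x $ j\<bar> < 1" using x(1) by (simp add: mem_open_cube)
    then show "\<bar>(if 0 \<le> x $ i then x - s *\<^sub>R ?e else x + s *\<^sub>R ?e) $ j\<bar> < 1"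
      using x(2) s by (cases "j = i") (auto simp: axis_def abs_less_iff)
  qed
  have "{x::real^'n. x $ i = 0} \<in> null_sets lebesgue"
    using negligible_standard_hyperplane_cart[where k=i] by (simp add: negligible_iff_null_sets)
  from AE_not_in[OF this] have ae0: "AE x::real^'n in lebesgue. x $ i \<noteq> 0" by simp
  have [measurable]: "v \<in> borel_measurable borel" using v by (rule borel_measurable_continuous_onI)
  have nth[measurable]: "(\<lambda>x::real^'n. x $ i) \<in> borel_measurable borel"
    by (intro borel_measurable_continuous_onI continuous_intros)
  have gm: "g \<in> borel_measurable borel"
    unfolding g_def by (intro measurable_If) measurable
  then have gm': "g \<in> borel_measurable (lebesgue_on open_cube)"
    by (intro measurable_restrict_space1 measurable_completion) simp
  have "\<bar>g x\<bar> \<le> Lp_norm \<infinity> open_cube v" if "x \<in> open_cube" "x $ i \<noteq> 0" for x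
    using abs_le_Lp_norm_infinity_cube[OF v cube[OF that]] by (auto simp: g_def split: if_splits)
  then have ae: "AE x in lebesgue_on open_cube. \<bar>g x\<bar> \<le> Lp_norm \<infinity> open_cube v"
    using ae0 by (subst AE_restrict_space_iff) (auto elim!: eventually_mono)
  then show gE: "g \<in> Lp_space \<infinity> open_cube" using gm' by (auto simp: Lp_space_infinity_iff)
  show "Lp_norm p open_cube g \<le> 2 * Lp_norm p open_cube v"
    using p
  proof (cases rule: exponent_cases)
    case 1
    have "Lp_norm \<infinity> open_cube g \<le> Lp_norm \<infinity> open_cube v" by (rule Lp_norm_infinity_le[OF gm' ae Lp_norm_nonneg])
    then show ?thesis using 1 Lp_norm_nonneg[of \<infinity> open_cube v] by simp
  next
    case (2 r)
    define h where "h x = indicator open_cube x * \<bar>v x\<bar> powr r" for x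
    have hm: "(\<lambda>x. \<bar>v x\<bar> powr r) \<in> borel_measurable borel" "(\<lambda>x. \<bar>g x\<bar> powr r) \<in> borel_measurable borel"
      using gm by measurable
    have ob: "open_cube \<in> sets (borel :: (real^'n) measure)" by simp
    note conv = integral_lebesgue_on_borel[OF ob hm(1), folded h_def] integral_lebesgue_on_borel[OF ob hm(2)]
    have hi: "integrable lborel h" unfolding conv(2)[symmetric]
      using Lp_space_infinity_integrable_powr[OF open_cube_lmeasurable continuous_in_Lp_space_cube[OF v]] 2 by simp
    note tr = lborel_integral_translation[OF hi]
    have gi: "integrable lborel (\<lambda>x. indicator open_cube x * \<bar>g x\<bar> powr r)" unfolding conv(4)[symmetric]
      using Lp_space_infinity_integrable_powr[OF open_cube_lmeasurable gE] 2 by simp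
    \<comment> \<open>Bounding by both translates avoids splitting the cube; each has the integral
      of h, which costs 2 and hence at most 2^r.\<close>
    have le: "indicator open_cube x * \<bar>g x\<bar> powr r \<le> h (x + - s *\<^sub>R ?e) + h (x + s *\<^sub>R ?e)" if "x $ i \<noteq> 0" for x
    proof (cases "x \<in> open_cube")
      case True
      then show ?thesis using cube[OF True that] by (auto simp: g_def h_def add_increasing add_increasing2 split: if_splits)
    qed (auto simp: h_def)
    have "AE x::real^'n in lborel. x $ i \<noteq> 0" using ae0 by (simp add: AE_completion_iff)
    then have "AE x in lborel. indicator open_cube x * \<bar>g x\<bar> powr r \<le> h (x + - s *\<^sub>R ?e) + h (x + s *\<^sub>R ?e)"
      by (rule eventually_mono) (rule le)
    then have "(LINT x|lborel. indicator open_cube x * \<bar>g x\<bar> powr r) \<le> (LINT x|lborel. h (x + - s *\<^sub>R ?e) + h (x + s *\<^sub>R ?e))"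
      by (intro integral_mono_AE gi Bochner_Integration.integrable_add tr(1))
    also have "\<dots> = 2 * (LINT x|lborel. h x)"
      using tr(1)[of "- s *\<^sub>R ?e"] tr(1)[of "s *\<^sub>R ?e"] tr(2)[of "- s *\<^sub>R ?e"] tr(2)[of "s *\<^sub>R ?e"] by simp
    also have "\<dots> = 2 * Lp_norm p open_cube v powr r"
      unfolding conv(1)[symmetric] 2 using 2 by (subst integral_powr_Lp_norm) auto
    also have "\<dots> \<le> 2 powr r * Lp_norm p open_cube v powr r"
      using 2 powr_mono[of 1 r 2] by (intro mult_right_mono) auto
    also have "\<dots> = (2 * Lp_norm p open_cube v) powr r" by (simp add: powr_mult Lp_norm_nonneg)
    finally show ?thesis unfolding conv(3)[symmetric] 2 using 2 by (intro Lp_norm_ereal_le) (auto simp: Lp_norm_nonneg)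
  qed
qed

lemma tensor_poly_continuous: "v \<in> tensor_polys k \<Longrightarrow> continuous_on S v"
  by (intro smooth_fun_continuous smooth_fun_tensor_poly)

text \<open>The constant 4 k^2 is the weight sum 2 k^2 times the factor 2 lost by folding. It is the
  same for all p.\<close>

lemma markov_inequality_Lp:
  fixes v :: "real^'n::finite \<Rightarrow> real"
  assumes k: "1 \<le> k" and v: "v \<in> tensor_polys k" and p: "1 \<le> p"
  shows "Lp_norm p open_cube (pderiv1 i v) \<le> 4 * (real k)\<^sup>2 * Lp_norm p open_cube v"
proof -
  obtain s w :: "nat \<Rightarrow> real" where sw: "\<And>j. 0 \<le> s j \<and> s j \<le> 1" "(\<Sum>j\<le>k. \<bar>w j\<bar>) = 2 * (real k)\<^sup>2"
    "\<And>(v :: real^'n \<Rightarrow> real) i x. v \<in> tensor_polys k \<Longrightarrow>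
       pderiv1 i v x = (\<Sum>j\<le>k. w j * v (x - s j *\<^sub>R axis i 1)) \<and>
       pderiv1 i v x = (\<Sum>j\<le>k. w j * - v (x + s j *\<^sub>R axis i 1))"
    using tensor_poly_pderiv1_formula[OF k, where 'n='n] by blast
  define g where "g j x = (if 0 \<le> x $ i then v (x - s j *\<^sub>R axis i 1) else - v (x + s j *\<^sub>R axis i 1))" for j x
  have eq: "pderiv1 i v = (\<lambda>x. \<Sum>j\<le>k. w j * g j x)"
  proof
    fix x
    show "pderiv1 i v x = (\<Sum>j\<le>k. w j * g j x)"
      using sw(3)[OF v, of i x] by (cases "0 \<le> x $ i") (auto simp: g_def)
  qed
  note g = Lp_norm_fold_translate[OF tensor_poly_continuous[OF v] _ _ p, of "s _" i, folded g_def]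
  have "Lp_norm p open_cube (pderiv1 i v) \<le> (\<Sum>j\<le>k. \<bar>w j\<bar>) * (2 * Lp_norm p open_cube v)"
    unfolding eq using g sw(1) by (intro Lp_norm_sum_le p) (auto simp: Lp_norm_nonneg)
  then show ?thesis by (simp add: sw(2))
qed

lemma markov_inequality_Lp_foldr:
  assumes "1 \<le> k" "v \<in> tensor_polys k" "1 \<le> p"
  shows "Lp_norm p open_cube (foldr pderiv1 js v) \<le> (4 * (real k)\<^sup>2) ^ length js * Lp_norm p open_cube v"
proof (induction js)
  case (Cons i js)
  have "Lp_norm p open_cube (foldr pderiv1 (i # js) v) \<le> 4 * (real k)\<^sup>2 * Lp_norm p open_cube (foldr pderiv1 js v)"
    using markov_inequality_Lp[OF assms(1) tensor_poly_foldr[OF assms(2)] assms(3)] by simp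
  also have "\<dots> \<le> 4 * (real k)\<^sup>2 * ((4 * (real k)\<^sup>2) ^ length js * Lp_norm p open_cube v)"
    by (rule mult_left_mono[OF Cons]) simp
  finally show ?case by (simp add: mult.assoc)
qed simp


section \<open>The Nikolskii inequality\<close>

text \<open>By the Markov inequality, \<open>|v|\<close> stays above half its maximum on a cube of side \<open>1 / (16 d\<^sup>2 k\<^sup>2)\<close>.\<close>

lemma nikolskii_infinity:
  fixes v :: "real^'n::finite \<Rightarrow> real"
  assumes k: "1 \<le> k" and v: "v \<in> tensor_polys k" and r: "1 \<le> r"
  shows "Lp_norm \<infinity> open_cube v \<le>
    2 * (16 * (real CARD('n))\<^sup>2 * (real k)\<^sup>2) powr (real CARD('n) / r) * Lp_norm (ereal r) open_cube v"
proof -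
  let ?U = "open_cube :: (real^'n) set"
  define d where "d = real CARD('n)"
  define K where "K = 16 * d\<^sup>2 * (real k)\<^sup>2"
  define \<delta> where "\<delta> = 1 / K"
  define M where "M = Lp_norm \<infinity> ?U v"
  define N where "N = Lp_norm (ereal r) ?U v"
  have d1: "1 \<le> d" unfolding d_def by (simp add: Suc_leI)
  have "1 \<le> d\<^sup>2 * (real k)\<^sup>2" using d1 k by (intro mult_ge1_I) (auto simp: one_le_power)
  then have K: "16 \<le> K" by (simp add: K_def)
  then have \<delta>: "0 < \<delta>" "\<delta> \<le> 1/16" by (simp_all add: \<delta>_def field_simps)
  have c: "continuous_on S v" for S by (rule tensor_poly_continuous[OF v])
  have NM: "0 \<le> N" "0 \<le> M" by (simp_all add: N_def M_def Lp_norm_nonneg)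
  show ?thesis
  proof (cases "M = 0")
    case True
    then show ?thesis using NM by (simp add: M_def N_def)
  next
    case False
    then have M: "M > 0" using NM by simp
    \<comment> \<open>The supremum need not be attained in the open cube. Three quarters of it leave
      a quarter to spend on the variation of v.\<close>
    obtain x0 where x0: "x0 \<in> ?U" "\<bar>v x0\<bar> > 3/4 * M"
    proof (rule ccontr)
      assume "\<not> thesis"
      then have "\<bar>v x\<bar> \<le> 3/4 * M" if "x \<in> ?U" for x using that \<open>\<And>x0. x0 \<in> ?U \<Longrightarrow> 3/4 * M < \<bar>v x0\<bar> \<Longrightarrow> thesis\<close> by (meson not_le)
      then have "AE x in lebesgue_on ?U. \<bar>v x\<bar> \<le> 3/4 * M" by (intro AE_I2) simp
      then have "M \<le> 3/4 * M"
        unfolding M_def using continuous_in_Lp_space_cube[OF c] NM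
        by (intro Lp_norm_infinity_le) (auto simp: Lp_space_infinity_iff M_def)
      then show False using M by simp
    qed
    have grad: "\<bar>pderiv1 i v x\<bar> \<le> 4 * (real k)\<^sup>2 * M" if "x \<in> ?U" for i x
      using abs_le_Lp_norm_infinity_cube[OF tensor_poly_continuous[OF tensor_poly_pderiv1[OF v]] that, of i]
        markov_inequality_Lp[OF k v, of \<infinity> i] by (simp add: M_def)
    have lip: "\<bar>v x - v y\<bar> \<le> (d * (4 * (real k)\<^sup>2 * M)) * norm (x - y)" if xy: "x \<in> ?U" "y \<in> ?U" for x y
    proof -
      have "norm (v x - v y) \<le> (d * (4 * (real k)\<^sup>2 * M)) * norm (x - y)"
      proof (rule differentiable_bound[OF _ _ _ xy])
        show "convex ?U" by (simp add: open_cube_def)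
        fix x assume x: "x \<in> ?U"
        show "(v has_derivative (\<lambda>h. \<Sum>i\<in>UNIV. h $ i * pderiv1 i v x)) (at x within ?U)"
          by (rule has_derivative_at_withinI[OF has_derivative_pderiv1[OF smooth_fun_differentiable[OF smooth_fun_tensor_poly[OF v]]]])
        show "onorm (\<lambda>h. \<Sum>i\<in>UNIV. h $ i * pderiv1 i v x) \<le> d * (4 * (real k)\<^sup>2 * M)"
        proof (rule onorm_bound)
          fix h :: "real^'n"
          have "norm (\<Sum>i\<in>UNIV. h $ i * pderiv1 i v x) \<le> (\<Sum>i\<in>(UNIV::'n set). norm h * (4 * (real k)\<^sup>2 * M))"
            by (rule sum_norm_le) (auto simp: abs_mult intro!: mult_mono grad x component_le_norm_cart)
          then show "norm (\<Sum>i\<in>UNIV. h $ i * pderiv1 i v x) \<le> d * (4 * (real k)\<^sup>2 * M) * norm h"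
            by (simp add: d_def mult_ac)
        qed (use d1 M in auto)
      qed
      then show ?thesis by simp
    qed
    \<comment> \<open>The small cube has x0 as a corner and extends from there towards the
      coordinate hyperplanes, so it stays inside the open cube.\<close>
    define lo where "lo = (\<chi> i. if 0 \<le> x0 $ i then x0 $ i - \<delta> else x0 $ i)"
    define hi where "hi = (\<chi> i. lo $ i + \<delta>)"
    let ?B = "cbox lo hi"
    have x0i: "\<bar>x0 $ i\<bar> < 1" for i using x0(1) by (simp add: mem_open_cube)
    have Bi: "\<bar>x $ i - x0 $ i\<bar> \<le> \<delta> \<and> \<bar>x $ i\<bar> < 1" if "x \<in> ?B" for x i
    proof -
      have "lo $ i \<le> x $ i" "x $ i \<le> lo $ i + \<delta>" using that by (auto simp: mem_box_cart hi_def)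
      then show ?thesis using x0i[of i] \<delta> by (auto simp: lo_def abs_le_iff abs_less_iff split: if_splits)
    qed
    then have BU: "?B \<subseteq> ?U" by (auto simp: mem_open_cube)
    have big: "M / 2 \<le> \<bar>v x\<bar>" if x: "x \<in> ?B" for x
    proof -
      have "norm (x - x0) \<le> (\<Sum>i\<in>(UNIV::'n set). \<delta>)"
        by (rule order_trans[OF norm_le_l1_cart], rule sum_mono) (use Bi[OF x] in simp)
      then have "norm (x - x0) \<le> d * \<delta>" by (simp add: d_def)
      then have "(d * (4 * (real k)\<^sup>2 * M)) * norm (x - x0) \<le> (d * (4 * (real k)\<^sup>2 * M)) * (d * \<delta>)"
        using d1 M by (intro mult_left_mono) auto
      \<comment> \<open>Lipschitz constant 4 d k^2 M times distance d \<delta>: this product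
        dictates the value of \<delta>.\<close>
      also have "\<dots> = M / 4" using K d1 k by (simp add: \<delta>_def K_def power2_eq_square)
      finally have "\<bar>v x - v x0\<bar> \<le> M / 4" using lip[OF BU[THEN subsetD, OF x] x0(1)] by linarith
      then show ?thesis using x0(2) by linarith
    qed
    have mB: "measure (lebesgue_on ?U) ?B = \<delta> ^ CARD('n)"
    proof -
      have "?B \<noteq> {}" using \<delta> by (auto simp: interval_eq_empty_cart hi_def not_le)
      then have "measure lborel ?B = \<delta> ^ CARD('n)" by (simp add: content_cbox_cart hi_def)
      then show ?thesis using BU by (subst measure_restrict_space) auto
    qed
    have fB: "emeasure (lebesgue_on ?U) ?B < \<infinity>" using BU by (subst emeasure_restrict_space) (auto simp: emeasure_lborel_cbox_eq)
    have Bm: "?B \<in> sets (lebesgue_on ?U)" using BU by (auto simp: sets_restrict_space image_iff intro!: bexI[of _ ?B])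
    have "(M / 2) powr r * \<delta> ^ CARD('n) = (LINT x|lebesgue_on ?U. (M / 2) powr r * indicator ?B x)"
      using mB Bm fB Int_absorb2[OF BU] by simp
    also have "\<dots> \<le> (LINT x|lebesgue_on ?U. \<bar>v x\<bar> powr r)"
    proof (rule integral_mono)
      show "integrable (lebesgue_on ?U) (\<lambda>x. (M / 2) powr r * indicator ?B x)"
        using Bm fB by (intro integrable_mult_right integrable_real_indicator) auto
      show "integrable (lebesgue_on ?U) (\<lambda>x. \<bar>v x\<bar> powr r)"
        using r by (intro Lp_space_infinity_integrable_powr continuous_in_Lp_space_cube c) auto
      show "(M / 2) powr r * indicator ?B x \<le> \<bar>v x\<bar> powr r" for x
        using big[of x] M r by (auto simp: indicator_def intro!: powr_mono2)
    qed
    also have "\<dots> = N powr r" unfolding N_def using r by (intro integral_powr_Lp_norm) auto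
    finally have "((M / 2) powr r * \<delta> powr d) powr (1 / r) \<le> (N powr r) powr (1 / r)"
      using r \<delta> by (intro powr_mono2) (auto simp: d_def powr_realpow)
    then have "M / 2 * \<delta> powr (d / r) \<le> N"
      using r NM by (simp add: powr_mult powr_powr)
    moreover have "\<delta> powr (d / r) = 1 / K powr (d / r)" using K by (simp add: \<delta>_def powr_divide)
    ultimately have "M \<le> 2 * K powr (d / r) * N" using K by (simp add: field_simps)
    then show ?thesis by (simp add: M_def N_def K_def d_def)
  qed
qed

text \<open>Finite p follows from p = \<infinity> by interpolation: |v|^s \<le> M^(s-r) |v|^r, where
  M is the maximum norm.\<close>

lemma nikolskii:
  fixes v :: "real^'n::finite \<Rightarrow> real"
  assumes k: "1 \<le> k" and v: "v \<in> tensor_polys k" and q: "1 \<le> q" "q \<le> p"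
  shows "Lp_norm p open_cube v \<le>
    2 * (16 * (real CARD('n))\<^sup>2 * (real k)\<^sup>2) powr (real CARD('n) * (rinv q - rinv p)) * Lp_norm q open_cube v"
proof -
  let ?U = "open_cube :: (real^'n) set"
  define d where "d = real CARD('n)"
  define K where "K = 16 * d\<^sup>2 * (real k)\<^sup>2"
  have K: "0 < K" using k by (simp add: K_def d_def)
  show ?thesis
    using q(1)
  proof (cases rule: exponent_cases)
    case 1
    then have "p = \<infinity>" using q by simp
    then show ?thesis using 1 k Lp_norm_nonneg[of \<infinity> ?U v] by (simp add: K_def d_def)
  next
    case q': (2 r)
    have "1 \<le> p" using q by (rule order_trans)
    then show ?thesis
    proof (cases rule: exponent_cases)
      case 1
      then show ?thesis using nikolskii_infinity[OF k v q'(2)] q' by simp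
    next
      case (2 s)
      define M N where "M = Lp_norm \<infinity> ?U v" and "N = Lp_norm (ereal r) ?U v"
      have rs: "r \<le> s" using q q' 2 by simp
      have NM: "0 \<le> N" "0 \<le> M" by (simp_all add: N_def M_def Lp_norm_nonneg)
      have vE: "v \<in> Lp_space \<infinity> ?U" by (rule continuous_in_Lp_space_cube[OF tensor_poly_continuous[OF v]])
      have int: "integrable (lebesgue_on ?U) (\<lambda>x. \<bar>v x\<bar> powr t)" if "0 < t" for t
        using that by (intro Lp_space_infinity_integrable_powr vE) auto
      have "(LINT x|lebesgue_on ?U. \<bar>v x\<bar> powr s) \<le> (LINT x|lebesgue_on ?U. M powr (s - r) * \<bar>v x\<bar> powr r)"
      proof (rule integral_mono_AE)
        show "AE x in lebesgue_on ?U. \<bar>v x\<bar> powr s \<le> M powr (s - r) * \<bar>v x\<bar> powr r"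
          using AE_le_Lp_norm_infinity[OF vE]
        proof eventually_elim
          case (elim x)
          have "\<bar>v x\<bar> powr s = \<bar>v x\<bar> powr (s - r) * \<bar>v x\<bar> powr r" by (simp flip: powr_add)
          also have "\<dots> \<le> M powr (s - r) * \<bar>v x\<bar> powr r"
            using elim rs by (intro mult_right_mono powr_mono2) (auto simp: M_def)
          finally show ?case .
        qed
      qed (use int q' 2 in auto)
      also have "\<dots> = M powr (s - r) * N powr r" using q' by (simp add: N_def integral_powr_Lp_norm)
      also have "\<dots> \<le> (2 * K powr (d / r) * N) powr (s - r) * N powr r"
        using nikolskii_infinity[OF k v q'(2)] rs NM
        by (intro mult_right_mono powr_mono2) (auto simp: M_def N_def K_def d_def)
      also have "\<dots> = 2 powr (s - r) * K powr (d / r * (s - r)) * N powr s"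
        using NM K by (simp add: powr_mult powr_powr mult.assoc flip: powr_add)
      \<comment> \<open>Enlarged so that the s-th root leaves the constant 2, independent of both
        exponents.\<close>
      also have "\<dots> \<le> 2 powr s * K powr (d / r * (s - r)) * N powr s"
        using q' by (intro mult_right_mono powr_mono) auto
      also have "d / r * (s - r) = d * (1 / r - 1 / s) * s" using q' 2 by (simp add: field_simps)
      also have "2 powr s * K powr (d * (1 / r - 1 / s) * s) * N powr s = (2 * K powr (d * (1 / r - 1 / s)) * N) powr s"
        using NM K by (simp add: powr_mult powr_powr)
      finally have "Lp_norm p ?U v \<le> 2 * K powr (d * (1 / r - 1 / s)) * N"
        unfolding 2 using 2 NM by (intro Lp_norm_ereal_le) auto
      then show ?thesis using q' 2 by (simp add: N_def K_def d_def)
    qed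
  qed
qed

text \<open>Each list of length j is cut: the outer j - r derivatives are removed by Markov's
  inequality at exponent p, and Nikolskii's inequality then passes from p to q for the inner r
  derivatives.\<close>

lemma sobolev_seminorm_Qk:
  fixes v :: "real^'n::finite \<Rightarrow> real"
  assumes k: "1 \<le> k" and v: "v \<in> Qk k ref_cube" and q: "1 \<le> q" "q \<le> p" and rj: "r \<le> j" "j \<le> l"
  shows "sobolev_seminorm j p open_cube v \<le>
    ((4 * real CARD('n)) ^ l * 2 * (16 * (real CARD('n))\<^sup>2) ^ CARD('n)) * ((real k)\<^sup>2) ^ (j - r)
      * ((real k)\<^sup>2) powr (real CARD('n) * (rinv q - rinv p)) * sobolev_seminorm r q open_cube v"
proof -
  let ?U = "open_cube :: (real^'n) set" and ?d = "real CARD('n)"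
  let ?E = "?d * (rinv q - rinv p)" and ?S = "sobolev_seminorm r q open_cube v"
  obtain u where u: "u \<in> tensor_polys k" "\<And>x. x \<in> ref_cube \<Longrightarrow> v x = u x" using Qk_tensor_poly[OF v] by blast
  have p: "1 \<le> p" using q by (rule order_trans)
  have norm_eq: "Lp_norm s ?U (wderiv ?U js v) = Lp_norm s ?U (foldr pderiv1 js u)" for s js
  proof (rule wderiv_eq(3))
    have wd: "is_weak_deriv ?U (count_list js) u (foldr pderiv1 js u)"
      by (rule smooth_fun_is_weak_deriv[OF open_open_cube smooth_fun_tensor_poly[OF u(1)]])
    have ae: "AE x in lebesgue_on ?U. u x = v x" using u(2) open_cube_subset by (intro AE_I2) auto
    show "is_weak_deriv ?U (count_list js) v (foldr pderiv1 js u)"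
      by (rule is_weak_deriv_cong_AE[OF open_open_cube wd ae AE_I2]) (rule refl)
    show "foldr pderiv1 js u \<in> Lp_space \<infinity> ?U"
      by (intro continuous_in_Lp_space_cube tensor_poly_continuous[OF tensor_poly_foldr[OF u(1)]])
  qed simp
  have E: "0 \<le> ?E" "?E \<le> ?d"
  proof -
    have "rinv p \<le> rinv q" using q p by (elim exponent_cases) (auto simp: frac_le)
    moreover have "rinv q - rinv p \<le> 1" using rinv_bounds[OF q(1)] rinv_bounds[OF p] by linarith
    ultimately show "0 \<le> ?E" "?E \<le> ?d" using mult_left_mono[of "rinv q - rinv p" 1 ?d] by auto
  qed
  have d1: "1 \<le> ?d" by (simp add: Suc_leI)
  let ?c = "(4 * (real k)\<^sup>2) ^ (j - r) * (2 * (16 * ?d\<^sup>2 * (real k)\<^sup>2) powr ?E * ?S)"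
  have "Lp_norm p ?U (wderiv ?U js v) \<le> ?c" if js: "length js = j" for js
  proof -
    define a b where "a = take (j - r) js" and "b = drop (j - r) js"
    have ab: "js = a @ b" "length a = j - r" "length b = r" using rj js by (auto simp: a_def b_def)
    have tb: "foldr pderiv1 b u \<in> tensor_polys k" by (rule tensor_poly_foldr[OF u(1)])
    have "Lp_norm p ?U (wderiv ?U js v) \<le> (4 * (real k)\<^sup>2) ^ (j - r) * Lp_norm p ?U (foldr pderiv1 b u)"
      unfolding norm_eq using markov_inequality_Lp_foldr[OF k tb p, of a] ab by simp
    also have "\<dots> \<le> (4 * (real k)\<^sup>2) ^ (j - r) * (2 * (16 * ?d\<^sup>2 * (real k)\<^sup>2) powr ?E * Lp_norm q ?U (foldr pderiv1 b u))"
      by (intro mult_left_mono nikolskii k tb q) simp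
    also have "\<dots> \<le> ?c"
      using Lp_norm_le_sobolev_seminorm[of q ?U b v] ab(3) unfolding norm_eq by (intro mult_left_mono) auto
    finally show ?thesis .
  qed
  then have "sobolev_seminorm j p ?U v \<le> (\<Sum>js\<in>(lists_of_length j :: 'n list set). ?c)"
    unfolding sobolev_seminorm_def[of j p] by (intro sum_mono) (simp add: lists_of_length_def)
  also have "\<dots> = ?d ^ j * ?c" by (simp add: card_lists_of_length)
  also have "\<dots> = (?d ^ j * 4 ^ (j - r)) * 2 * (16 * ?d\<^sup>2) powr ?E * ((real k)\<^sup>2 ^ (j - r) * (real k)\<^sup>2 powr ?E * ?S)"
    by (simp add: powr_mult power_mult_distrib mult_ac)
  \<comment> \<open>The exponent \<open>?E\<close> lies in [0, d], so everything except the powers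
    of k is bounded in terms of d and l.\<close>
  also have "\<dots> \<le> ((4 * ?d) ^ l * 2 * (16 * ?d\<^sup>2) ^ CARD('n)) * ((real k)\<^sup>2 ^ (j - r) * (real k)\<^sup>2 powr ?E * ?S)"
  proof (rule mult_right_mono)
    have "?d ^ j * 4 ^ (j - r) \<le> ?d ^ l * 4 ^ l" using d1 rj by (intro mult_mono power_increasing) auto
    moreover have "1 \<le> 16 * ?d\<^sup>2" using d1 one_le_power[OF d1, of 2] by linarith
    then have "(16 * ?d\<^sup>2) powr ?E \<le> (16 * ?d\<^sup>2) powr ?d" using E by (intro powr_mono)
    then have "(16 * ?d\<^sup>2) powr ?E \<le> (16 * ?d\<^sup>2) ^ CARD('n)" using d1 by (simp add: powr_realpow)
    ultimately show "?d ^ j * 4 ^ (j - r) * 2 * (16 * ?d\<^sup>2) powr ?E \<le> (4 * ?d) ^ l * 2 * (16 * ?d\<^sup>2) ^ CARD('n)"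
      by (intro mult_mono) (auto simp: power_mult_distrib mult.commute)
  qed (auto intro!: mult_nonneg_nonneg sobolev_seminorm_nonneg)
  finally show ?thesis by (simp only: mult.assoc)
qed

section \<open>Discrete norms\<close>

lemma lp_sum_infinity: "lp_sum \<infinity> I a = Max (a ` I)"
  by (simp add: lp_sum_def)

lemma lp_sum_ereal: "lp_sum (ereal r) I a = (\<Sum>i\<in>I. a i powr r) powr (1 / r)"
  by (simp add: lp_sum_def)

lemma lp_sum_ereal_powr:
  assumes "0 < r" shows "(\<Sum>i\<in>I. a i powr r) = lp_sum (ereal r) I a powr r"
  using assms by (simp add: lp_sum_ereal powr_powr sum_nonneg)

lemma lp_sum_ereal_le:
  assumes "0 < r" "(\<Sum>i\<in>I. a i powr r) \<le> b powr r" "0 \<le> b" shows "lp_sum (ereal r) I a \<le> b"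
proof -
  have "(\<Sum>i\<in>I. a i powr r) powr (1 / r) \<le> (b powr r) powr (1 / r)"
    using assms by (intro powr_mono2) (auto intro: sum_nonneg)
  then show ?thesis using assms by (simp add: lp_sum_ereal powr_powr)
qed

lemma le_lp_sum:
  assumes I: "finite I" "i \<in> I" and a: "\<And>i. i \<in> I \<Longrightarrow> 0 \<le> a i" and p: "1 \<le> p"
  shows "a i \<le> lp_sum p I a"
  using p
proof (cases rule: exponent_cases)
  case 1
  then show ?thesis using I by (simp add: lp_sum_infinity)
next
  case (2 r)
  have "a i powr r \<le> (\<Sum>i\<in>I. a i powr r)" using I by (intro member_le_sum) auto
  then have "(a i powr r) powr (1 / r) \<le> lp_sum p I a" unfolding 2 lp_sum_ereal using 2 by (intro powr_mono2) auto
  then show ?thesis using 2 a[OF I(2)] by (simp add: powr_powr)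
qed

lemma lp_sum_nonneg:
  assumes "finite I" "I \<noteq> {}" "\<And>i. i \<in> I \<Longrightarrow> 0 \<le> a i" "1 \<le> p"
  shows "0 \<le> lp_sum p I a"
proof -
  obtain i where "i \<in> I" using assms by blast
  then show ?thesis using le_lp_sum[of I i a p] assms order_trans by blast
qed

text \<open>Every entry is at most the q-sum, so the surplus power s - r of each entry can be
  replaced by that of the q-sum.\<close>

lemma lp_sum_mono_exponent:
  assumes I: "finite I" "I \<noteq> {}" and a: "\<And>i. i \<in> I \<Longrightarrow> 0 \<le> a i" and q: "1 \<le> q" "q \<le> p"
  shows "lp_sum p I a \<le> lp_sum q I a"
proof -
  have le: "a i \<le> lp_sum q I a" if "i \<in> I" for i by (rule le_lp_sum[OF I(1) that a q(1)])
  have N: "0 \<le> lp_sum q I a" by (rule lp_sum_nonneg[OF I a q(1)])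
  have "1 \<le> p" using q by (rule order_trans)
  then show ?thesis
  proof (cases rule: exponent_cases)
    case 1
    then show ?thesis using le I by (simp add: lp_sum_infinity)
  next
    case (2 s)
    then obtain r where r: "q = ereal r" "1 \<le> r" "r \<le> s" using q by (cases q) auto
    have "(\<Sum>i\<in>I. a i powr s) = (\<Sum>i\<in>I. a i powr (s - r) * a i powr r)" by (simp flip: powr_add)
    also have "\<dots> \<le> (\<Sum>i\<in>I. lp_sum q I a powr (s - r) * a i powr r)"
      using le a r by (intro sum_mono mult_right_mono powr_mono2) auto
    also have "\<dots> = lp_sum q I a powr (s - r) * lp_sum q I a powr r"
      using lp_sum_ereal_powr[of r a I] r by (simp add: sum_distrib_left[symmetric])
    also have "\<dots> = lp_sum q I a powr s" by (simp flip: powr_add)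
    finally show ?thesis unfolding 2 using 2 N by (intro lp_sum_ereal_le) auto
  qed
qed

lemma lp_sum_le_sum:
  assumes I: "finite I" "I \<noteq> {}" and a: "\<And>i. i \<in> I \<Longrightarrow> 0 \<le> a i" and p: "1 \<le> p"
  shows "lp_sum p I a \<le> (\<Sum>i\<in>I. a i)"
proof -
  have "lp_sum p I a \<le> lp_sum 1 I a" by (rule lp_sum_mono_exponent[OF I a _ p]) simp_all
  also have "lp_sum 1 I a = (\<Sum>i\<in>I. a i)"
    using lp_sum_ereal[of 1 I a] a by (simp flip: one_ereal_def add: sum_nonneg)
  finally show ?thesis .
qed

lemma lp_sum_le_scale:
  assumes I: "finite I" "I \<noteq> {}" and ab: "\<And>i. i \<in> I \<Longrightarrow> 0 \<le> a i \<and> a i \<le> K * b i"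
    and K: "0 \<le> K" and b: "\<And>i. i \<in> I \<Longrightarrow> 0 \<le> b i" and p: "1 \<le> p"
  shows "lp_sum p I a \<le> K * lp_sum p I b"
  using p
proof (cases rule: exponent_cases)
  case 1
  have "a i \<le> K * lp_sum p I b" if "i \<in> I" for i
      proof -
    have "b i \<le> lp_sum p I b" by (rule le_lp_sum[OF I(1) that b p])
    then show ?thesis using ab[OF that] mult_left_mono[OF _ K] order_trans by blast
  qed
  then show ?thesis unfolding 1 lp_sum_infinity[of I a] using I by simp
next
  case (2 r)
  have "(\<Sum>i\<in>I. a i powr r) \<le> (\<Sum>i\<in>I. (K * b i) powr r)" using ab 2 by (intro sum_mono powr_mono2) auto
  also have "\<dots> = K powr r * (\<Sum>i\<in>I. b i powr r)" using K b by (simp add: powr_mult sum_distrib_left)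
  also have "\<dots> = (K * lp_sum p I b) powr r"
    using 2 K lp_sum_ereal_powr[of r b I] lp_sum_nonneg[OF I b p] by (simp add: powr_mult)
  finally show ?thesis unfolding 2 using 2 K lp_sum_nonneg[OF I b p] by (intro lp_sum_ereal_le) auto
qed

text \<open>For finite exponents r \<le> s this is Jensen's inequality with unit weights and
  exponent s / r.\<close>

lemma lp_sum_holder:
  assumes I: "finite I" "I \<noteq> {}" and b: "\<And>i. i \<in> I \<Longrightarrow> 0 \<le> b i" and p: "1 \<le> p" "p \<le> q"
  shows "lp_sum p I b \<le> real (card I) powr (rinv p - rinv q) * lp_sum q I b"
proof -
  have n: "0 < real (card I)" using I by (simp add: card_gt_0_iff)
  have q1: "1 \<le> q" using p by (rule order_trans)
  have N: "0 \<le> lp_sum q I b" by (rule lp_sum_nonneg[OF I b q1])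
  show ?thesis
    using p(1)
  proof (cases rule: exponent_cases)
    case 1
    then show ?thesis using p I by simp
  next
    case r: (2 r)
    show ?thesis
      using q1
    proof (cases rule: exponent_cases)
      case 1
      have "(\<Sum>i\<in>I. b i powr r) \<le> (\<Sum>i\<in>I. lp_sum q I b powr r)"
        using r b le_lp_sum[OF I(1) _ b q1] by (intro sum_mono powr_mono2) auto
      also have "\<dots> = (real (card I) powr (1 / r) * lp_sum q I b) powr r"
        using r n N by (simp add: powr_mult powr_powr)
      finally show ?thesis unfolding r using r 1 N by (intro lp_sum_ereal_le) auto
    next
      case (2 s)
      have rs: "r \<le> s" using p r 2 by simp
      have "(\<Sum>i\<in>I. b i powr r) powr (s / r) \<le> real (card I) powr (s / r - 1) * (\<Sum>i\<in>I. (b i powr r) powr (s / r))"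
        using powr_sum_le[OF I(1), of "s / r" "\<lambda>_. 1" "\<lambda>i. b i powr r"] r rs by (simp add: sum_nonneg)
      also have "\<dots> = real (card I) powr (s / r - 1) * lp_sum q I b powr s"
        using r 2 lp_sum_ereal_powr[of s b I] by (simp add: powr_powr)
      finally have "((\<Sum>i\<in>I. b i powr r) powr (s / r)) powr (1 / s) \<le> (real (card I) powr (s / r - 1) * lp_sum q I b powr s) powr (1 / s)"
        using 2 by (intro powr_mono2) auto
      then show ?thesis
        using r 2 n N by (simp add: lp_sum_ereal powr_powr powr_mult diff_divide_distrib sum_nonneg)
    qed
  qed
qed

section \<open>Sobolev norms and seminorms\<close>

lemma multi_indices_eq: "{\<alpha>::'n::finite \<Rightarrow> nat. mdegree \<alpha> \<le> l} = count_list ` (\<Union>j\<le>l. lists_of_length j)"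
proof
  show "{\<alpha>::'n \<Rightarrow> nat. mdegree \<alpha> \<le> l} \<subseteq> count_list ` (\<Union>j\<le>l. lists_of_length j)"
  proof
    fix \<alpha> :: "'n \<Rightarrow> nat" assume "\<alpha> \<in> {\<alpha>. mdegree \<alpha> \<le> l}"
    moreover obtain js where "count_list js = \<alpha>" using ex_count_list by blast
    ultimately show "\<alpha> \<in> count_list ` (\<Union>j\<le>l. lists_of_length j)"
      using mdegree_count_list[of js] by (auto simp: lists_of_length_def)
  qed
qed (auto simp: lists_of_length_def mdegree_count_list)

lemma finite_multi_indices: "finite {\<alpha>::'n::finite \<Rightarrow> nat. mdegree \<alpha> \<le> l}"
  unfolding multi_indices_eq by simp

lemma multi_indices_nonempty: "{\<alpha>::'n::finite \<Rightarrow> nat. mdegree \<alpha> \<le> l} \<noteq> {}"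
  by (auto simp: mdegree_def intro!: exI[of _ "\<lambda>_. 0"])

lemma sobolev_norm_nonneg: "1 \<le> p \<Longrightarrow> 0 \<le> sobolev_norm l p U v"
  unfolding sobolev_norm_def by (intro lp_sum_nonneg finite_multi_indices multi_indices_nonempty Lp_norm_nonneg)

text \<open>Bounding the p-sum by the plain sum keeps the constant free of p; several lists share a
  multi-index, so summing over lists only adds terms.\<close>

lemma sobolev_norm_le_seminorms:
  assumes "1 \<le> p" shows "sobolev_norm l p U v \<le> (\<Sum>j\<le>l. sobolev_seminorm j p U v)"
proof -
  let ?f = "\<lambda>\<alpha>. Lp_norm p U (weak_deriv U \<alpha> v)"
  have "sobolev_norm l p U v \<le> (\<Sum>\<alpha> | mdegree \<alpha> \<le> l. ?f \<alpha>)"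
    unfolding sobolev_norm_def by (intro lp_sum_le_sum finite_multi_indices multi_indices_nonempty Lp_norm_nonneg assms)
  also have "\<dots> \<le> (\<Sum>js\<in>(\<Union>j\<le>l. lists_of_length j). ?f (count_list js))"
    unfolding multi_indices_eq using sum_image_le[of "\<Union>j\<le>l. lists_of_length j" ?f count_list]
    by (simp add: Lp_norm_nonneg o_def)
  also have "\<dots> = (\<Sum>j\<le>l. sobolev_seminorm j p U v)"
    unfolding sobolev_seminorm_def by (rule sum.UNION_disjoint) (simp, simp, simp add: lists_of_length_def disjoint_iff)
  finally show ?thesis .
qed

lemma sobolev_seminorm_le_norm:
  fixes v :: "real^'n::finite \<Rightarrow> real"
  assumes "1 \<le> q" "j \<le> m" shows "sobolev_seminorm j q U v \<le> real CARD('n) ^ j * sobolev_norm m q U v"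
proof -
  have "sobolev_seminorm j q U v \<le> (\<Sum>js\<in>(lists_of_length j :: 'n list set). sobolev_norm m q U v)"
    unfolding sobolev_seminorm_def sobolev_norm_def
    by (intro sum_mono le_lp_sum finite_multi_indices Lp_norm_nonneg assms)
       (use assms in \<open>simp add: mdegree_count_list lists_of_length_def\<close>)
  then show ?thesis by (simp add: card_lists_of_length)
qed

section \<open>Mesh elements\<close>

lemma matrix_component: "A $ i $ j = (A *v axis j 1) $ i" for A :: "real^'n::finite^'m"
  by (simp add: matrix_vector_mul_component inner_axis)

lemma interior_elem_map_image:
  assumes "invertible A" shows "interior (elem_map A c ` S) = elem_map A c ` interior S"
proof -
  have lin: "linear ((*v) A)" by (rule matrix_vector_mul_linear)
  have "bij ((*v) A)" using assms invertible_eq_bij by blast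
  then have "interior ((*v) A ` S) = (*v) A ` interior S" using lin interior_bijective_linear_image by blast
  moreover have "elem_map A c ` X = (+) c ` ((*v) A ` X)" for X by (auto simp: elem_map_def image_image add.commute)
  ultimately show ?thesis by (simp add: interior_translation)
qed

text \<open>The normalisation 1 \<le> \<sigma>, reached by passing to
  \<open>max 1 \<sigma>0\<close>, makes the bases of later constants at least 1, so their exponents
  may be enlarged.\<close>

locale mesh_element =
  fixes A :: "real^'n::finite^'n" and a :: "real^'n" and T :: "(real^'n) set" and \<sigma> :: real
  assumes inv_A: "invertible A" and T: "T = elem_map A a ` ref_cube"
    and \<sigma>: "1 \<le> \<sigma>" and shape: "diameter T / inball_diameter T \<le> \<sigma>"
begin

abbreviation "h \<equiv> diameter T"

lemma d_ge_1: "1 \<le> real CARD('n)" by (simp add: Suc_leI)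

definition "B = matrix_inv A"
definition "b = - (matrix_inv A *v a)"

lemma compact_T: "compact T"
proof -
  have "continuous_on ref_cube (elem_map A a)"
    by (intro continuous_at_imp_continuous_on ballI has_derivative_continuous[OF elem_map_has_derivative])
  then show ?thesis unfolding T by (rule compact_continuous_image) (simp add: ref_cube_def)
qed

lemma interior_T: "interior T = elem_map A a ` open_cube"
  unfolding T interior_elem_map_image[OF inv_A] interior_ref_cube ..

lemma inverse_maps: "elem_map B b (elem_map A a x) = x" "elem_map A a (elem_map B b x) = x" "invertible B"
  "inv (elem_map A a) = elem_map B b"
  using elem_map_inverse(1,2,4)[OF inv_A, of a] elem_map_inverse(3)[OF inv_A] by (auto simp: B_def b_def)

sublocale affine_iso A B a b open_cube "interior T"
proof
  show "y \<in> interior T \<longleftrightarrow> elem_map B b y \<in> open_cube" for y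
  proof
    show "elem_map B b y \<in> open_cube" if "y \<in> interior T"
      using that inverse_maps(1) unfolding interior_T by auto
    show "y \<in> interior T" if "elem_map B b y \<in> open_cube"
      using imageI[OF that, of "elem_map A a"] inverse_maps(2) unfolding interior_T by simp
  qed
  show "interior T \<in> lmeasurable"
    using compact_T bounded_interior compact_imp_bounded by (intro bounded_set_imp_lmeasurable) auto
qed (use inv_A inverse_maps in auto)

lemma T_iff: "y \<in> T \<longleftrightarrow> elem_map B b y \<in> ref_cube"
proof
  show "elem_map B b y \<in> ref_cube" if "y \<in> T"
    using that inverse_maps(1) unfolding T by auto
  show "y \<in> T" if "elem_map B b y \<in> ref_cube"
    using imageI[OF that, of "elem_map A a"] inverse_maps(2) unfolding T by simp
qed

lemma zero_in_cube: "0 \<in> open_cube" by (simp add: mem_open_cube)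

lemma interior_nonempty: "interior T \<noteq> {}" using zero_in_cube interior_T by blast

text \<open>A ball whose diameter 2r exceeds half the supremum is taken, so attainment is not an
  issue; this turns h \<le> \<sigma> \<rho> into h \<le> 4 \<sigma> r, where \<rho> is the
  supremum.\<close>

lemma inball_exists:
  obtains c r where "cball c r \<subseteq> T" "h \<le> 4 * \<sigma> * r" "0 < r" "0 < h"
proof -
  let ?S = "{diameter (cball c r) | c r. 0 \<le> r \<and> cball c r \<subseteq> T}"
  obtain x e where e: "0 < e" "cball x e \<subseteq> interior T"
    using interior_nonempty open_contains_cball open_interior by (metis ex_in_conv)
  then have xe: "cball x e \<subseteq> T" using interior_subset by blast
  have diam: "diameter (cball c r) = 2 * r" if "0 \<le> r" for c :: "real^'n" and r using that by simp
  have le: "s \<le> h" if s: "s \<in> ?S" for s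
  proof -
    obtain c r where "s = diameter (cball c r)" "cball c r \<subseteq> T" using s by blast
    then show ?thesis using diameter_subset[OF _ compact_imp_bounded[OF compact_T]] by blast
  qed
  have mem: "2 * e \<in> ?S"
    by (intro CollectI exI[of _ x] exI[of _ e] conjI xe) (use e(1) diam in simp_all)
  have bdd: "bdd_above ?S" using le by (rule bdd_aboveI)
  have inball: "inball_diameter T = Sup ?S" by (simp add: inball_diameter_def)
  \<comment> \<open>Without positivity the shape condition would be void, since division by 0 yields
    0.\<close>
  have \<rho>: "0 < inball_diameter T" unfolding inball using cSup_upper[OF mem bdd] e by linarith
  have h: "0 < h" using le[OF mem] e by linarith
  have "inball_diameter T / 2 < Sup ?S" using \<rho> unfolding inball by simp
  then obtain s where s: "s \<in> ?S" "inball_diameter T / 2 < s" using less_cSup_iff[of ?S] mem bdd by blast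
  then obtain c r where cr: "0 \<le> r" "cball c r \<subseteq> T" "s = 2 * r" using diam by blast
  have "h \<le> \<sigma> * inball_diameter T" using shape \<rho> by (simp add: divide_le_eq)
  also have "\<dots> \<le> \<sigma> * (4 * r)" using s(2) cr(3) \<sigma> by (intro mult_left_mono) auto
  finally have "h \<le> 4 * \<sigma> * r" by simp
  moreover have "0 < r" using s(2) cr \<rho> by linarith
  ultimately show thesis using that cr h by blast
qed

lemma h_pos: "0 < h" using inball_exists by blast

text \<open>The ends c + r e_j and c - r e_j of a diameter of the inscribed ball are mapped into the
  cube of side 2, hence 2 r |B_ij| \<le> 2.\<close>

lemma B_bound: "\<bar>B $ i $ j\<bar> \<le> 4 * \<sigma> / h"
proof -
  obtain c r where cr: "cball c r \<subseteq> T" "h \<le> 4 * \<sigma> * r" "0 < r" using inball_exists by blast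
  have "c + r *\<^sub>R axis j 1 \<in> T" "c - r *\<^sub>R axis j 1 \<in> T" using cr by (auto intro!: subsetD[OF cr(1)] simp: dist_norm)
  then have "elem_map B b (c + r *\<^sub>R axis j 1) \<in> ref_cube" "elem_map B b (c - r *\<^sub>R axis j 1) \<in> ref_cube"
    by (simp_all add: T_iff)
  then have "\<bar>elem_map B b (c + r *\<^sub>R axis j 1) $ i\<bar> \<le> 1" "\<bar>elem_map B b (c - r *\<^sub>R axis j 1) $ i\<bar> \<le> 1"
    by (auto simp: ref_cube_def mem_box_cart abs_le_iff minus_le_iff)
  moreover have "elem_map B b (c + r *\<^sub>R axis j 1) $ i - elem_map B b (c - r *\<^sub>R axis j 1) $ i = 2 * r * B $ i $ j"
    by (simp add: elem_map_def matrix_vector_right_distrib matrix_vector_mult_diff_distrib matrix_vector_mult_scaleR matrix_component)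
  ultimately have "r * \<bar>B $ i $ j\<bar> \<le> 1" using cr(3) abs_mult[of "2 * r" "B $ i $ j"] by linarith
  then have "\<bar>B $ i $ j\<bar> \<le> 1 / r" using cr(3) by (simp add: field_simps)
  also have "\<dots> \<le> 4 * \<sigma> / h" using cr(2,3) h_pos by (simp add: field_simps)
  finally show ?thesis .
qed

text \<open>The points e_j and -e_j of the cube have images in T at distance 2 |A e_j|, which is at
  most the diameter.\<close>

lemma A_bound: "\<bar>A $ i $ j\<bar> \<le> h"
proof -
  have c: "axis j 1 \<in> ref_cube" "- axis j 1 \<in> ref_cube" by (auto simp: ref_cube_def mem_box_cart axis_def)
  have "dist (elem_map A a (axis j 1)) (elem_map A a (- axis j 1)) \<le> h"
    using c compact_T compact_imp_bounded T by (intro diameter_bounded_bound) auto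
  moreover have "elem_map A a (axis j 1) - elem_map A a (- axis j 1) = 2 *\<^sub>R (A *v axis j 1)"
    using matrix_vector_mult_diff_distrib[of A 0 "axis j 1"] by (simp add: elem_map_def scaleR_2)
  ultimately have "2 * norm (A *v axis j 1) \<le> h" by (simp add: dist_norm)
  moreover have "\<bar>A $ i $ j\<bar> \<le> norm (A *v axis j 1)" unfolding matrix_component by (rule component_le_norm_cart)
  ultimately show ?thesis using norm_ge_zero[of "A *v axis j 1"] by linarith
qed

text \<open>A ball of radius r contains a cube of half side r / d, by comparing the Euclidean norm
  with the sum of the coordinates.\<close>

lemma measure_interior_T_ge: "(h / (2 * \<sigma> * real CARD('n))) ^ CARD('n) \<le> measure lebesgue (interior T)"
proof -
  obtain c r where cr: "cball c r \<subseteq> T" "h \<le> 4 * \<sigma> * r" "0 < r" using inball_exists by blast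
  let ?Q = "box (\<chi> i. c $ i - r / real CARD('n)) (\<chi> i. c $ i + r / real CARD('n))"
  have Q: "x \<in> cball c r" if "x \<in> ?Q" for x
  proof -
    have "norm (x - c) \<le> (\<Sum>i\<in>UNIV. \<bar>(x - c) $ i\<bar>)" by (rule norm_le_l1_cart)
    also have "\<dots> \<le> (\<Sum>i\<in>(UNIV::'n set). r / real CARD('n))"
    proof (rule sum_mono)
      fix i
      have "c $ i - r / real CARD('n) < x $ i" "x $ i < c $ i + r / real CARD('n)"
        using that by (simp_all add: mem_box_cart)
      then show "\<bar>(x - c) $ i\<bar> \<le> r / real CARD('n)" by (simp add: abs_le_iff)
    qed
    finally show ?thesis by (simp add: dist_norm norm_minus_commute)
  qed
  then have sub: "?Q \<subseteq> interior T" using cr(1) by (intro interior_maximal) auto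
  have "h / (2 * \<sigma> * real CARD('n)) \<le> 2 * r / real CARD('n)" using cr(2) \<sigma> d_ge_1 by (simp add: field_simps)
  then have "(h / (2 * \<sigma> * real CARD('n))) ^ CARD('n) \<le> (2 * r / real CARD('n)) ^ CARD('n)"
    using h_pos \<sigma> by (intro power_mono) auto
  also have "\<dots> = measure lebesgue ?Q"
  proof -
    have "measure lborel ?Q = measure lborel (cbox (\<chi> i. c $ i - r / real CARD('n)) (\<chi> i. c $ i + r / real CARD('n)))"
      using cr(3) d_ge_1 by (subst measure_lborel_box_eq, subst measure_lborel_cbox_eq) simp
    also have "\<dots> = (2 * r / real CARD('n)) ^ CARD('n)"
      using cr(3) d_ge_1 by (subst content_cbox_cart) (auto simp: interval_eq_empty_cart not_less)
    finally show ?thesis by simp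
  qed
  also have "\<dots> \<le> measure lebesgue (interior T)" using sub Vm by (intro measure_mono_fmeasurable) auto
  finally show ?thesis .
qed

lemma measure_interior_T_le: "measure lebesgue (interior T) \<le> (2 * h) ^ CARD('n)"
proof -
  obtain x0 where x0: "x0 \<in> T" using interior_nonempty interior_subset by blast
  let ?Q = "cbox (\<chi> i. x0 $ i - h) (\<chi> i. x0 $ i + h)"
  have "T \<subseteq> ?Q"
  proof
    fix x assume "x \<in> T"
    then have "norm (x - x0) \<le> h" using diameter_bounded_bound[OF compact_imp_bounded[OF compact_T] _ x0] by (simp add: dist_norm)
    then have "\<bar>(x - x0) $ i\<bar> \<le> h" for i using component_le_norm_cart[of "x - x0" i] by linarith
    then show "x \<in> ?Q" by (auto simp: mem_box_cart abs_le_iff diff_le_eq le_diff_eq add.commute minus_le_iff)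
  qed
  then have "interior T \<subseteq> ?Q" using interior_subset by blast
  then have "measure lebesgue (interior T) \<le> measure lebesgue ?Q" using Vm by (intro measure_mono_fmeasurable) auto
  also have "\<dots> = (2 * h) ^ CARD('n)"
    using h_pos by (simp add: content_cbox_cart interval_eq_empty_cart not_less)
  finally show ?thesis .
qed

end

section \<open>Volume factors and the estimate on one element\<close>

lemma (in affine_iso) dilation_factor_eq:
  assumes "0 < measure lebesgue U"
  shows "dilation_factor A a = measure lebesgue V / measure lebesgue U"
proof -
  have "measure (lebesgue_on V) V = dilation_factor A a * measure (lebesgue_on U) U"
    using integral_pullback[of "\<lambda>_. 1"] by simp
  then show ?thesis using assms by (simp add: measure_restrict_space)
qed

lemma measure_open_cube: "measure lebesgue (open_cube :: (real^'n::finite) set) = 2 ^ CARD('n)"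
proof -
  let ?Q = "cbox (\<chi> i. - 1) (\<chi> i. 1) :: (real^'n) set"
  have "measure lborel (box (\<chi> i. - 1) (\<chi> i. 1) :: (real^'n) set) = measure lborel ?Q"
    by (subst measure_lborel_box_eq, subst measure_lborel_cbox_eq) simp
  also have "\<dots> = 2 ^ CARD('n)" by (subst content_cbox_cart) (auto simp: interval_eq_empty_cart)
  finally show ?thesis by (simp add: open_cube_def)
qed

text \<open>The factors, in order: the number of orders j \<le> l, the pullback to the element with
  the entries of the inverse matrix, the way back to the cube, the passage from seminorm to norm,
  and the volume factor.\<close>

definition mesh_const :: "nat \<Rightarrow> real \<Rightarrow> nat \<Rightarrow> real" where
  "mesh_const l \<sigma> n = (real l + 1) * (4 * \<sigma> * (real n)\<^sup>2) ^ l * ((real n)\<^sup>2) ^ l * real n ^ l * (4 * \<sigma> * real n) ^ n"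

lemma mesh_const_pos: "1 \<le> \<sigma> \<Longrightarrow> 0 < n \<Longrightarrow> 0 < mesh_const l \<sigma> n"
  by (simp add: mesh_const_def)

context mesh_element begin

lemma dilation_factor_bounds:
  "(h / (4 * \<sigma> * real CARD('n))) ^ CARD('n) \<le> dilation_factor A a" "dilation_factor A a \<le> h ^ CARD('n)"
  "dilation_factor B b = 1 / dilation_factor A a"
proof -
  have eq: "dilation_factor A a = measure lebesgue (interior T) / 2 ^ CARD('n)"
    using dilation_factor_eq by (simp add: measure_open_cube)
  have "(h / (4 * \<sigma> * real CARD('n))) ^ CARD('n) = (h / (2 * \<sigma> * real CARD('n))) ^ CARD('n) / 2 ^ CARD('n)"
    by (simp add: power_divide[symmetric] mult.assoc)
  then show "(h / (4 * \<sigma> * real CARD('n))) ^ CARD('n) \<le> dilation_factor A a"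
    unfolding eq using measure_interior_T_ge by (simp add: divide_right_mono)
  show "dilation_factor A a \<le> h ^ CARD('n)"
    unfolding eq using measure_interior_T_le by (simp add: divide_le_eq power_mult_distrib mult.commute)
  have "0 < (h / (2 * \<sigma> * real CARD('n))) ^ CARD('n)" using h_pos \<sigma> by simp
  then have "0 < measure lebesgue (interior T)" using measure_interior_T_ge by linarith
  from affine_iso.dilation_factor_eq[OF swap this] show "dilation_factor B b = 1 / dilation_factor A a"
    unfolding eq by (simp add: measure_open_cube)
qed

text \<open>The exponent is 1/p - 1/q and may have either sign: the upper volume bound serves e
  \<ge> 0, the lower one e < 0.\<close>

lemma dilation_factor_powr:
  assumes e: "\<bar>e\<bar> \<le> 1"
  shows "dilation_factor A a powr e \<le> (4 * \<sigma> * real CARD('n)) ^ CARD('n) * h powr (real CARD('n) * e)"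
proof -
  let ?n = "CARD('n)" and ?D = "dilation_factor A a"
  let ?c = "4 * \<sigma> * real ?n"
  have D: "0 < ?D" by (rule dilation_factor(1)[OF A])
  have c: "1 \<le> ?c" using \<sigma> d_ge_1 mult_mono[of 1 \<sigma> 1 "real ?n"] by simp
  have pw: "(x ^ ?n) powr e = x powr (real ?n * e)" if "0 < x" for x :: real
    using that by (simp add: powr_realpow[symmetric] powr_powr)
  show ?thesis
  proof (cases "0 \<le> e")
    case True
    have "?D powr e \<le> (h ^ ?n) powr e" using True D dilation_factor_bounds(2) by (intro powr_mono2) auto
    also have "\<dots> = 1 * h powr (real ?n * e)" using pw[OF h_pos] by simp
    also have "\<dots> \<le> ?c ^ ?n * h powr (real ?n * e)" using c by (intro mult_right_mono one_le_power) auto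
    finally show ?thesis .
  next
    case False
    have "?D powr e \<le> ((h / ?c) ^ ?n) powr e"
      using False D dilation_factor_bounds(1) h_pos c by (intro powr_mono2') auto
    also have "\<dots> = (h / ?c) powr (real ?n * e)" using h_pos c by (intro pw) auto
    also have "\<dots> = ?c powr (real ?n * (- e)) * h powr (real ?n * e)"
    proof -
      have "(h / ?c) powr (real ?n * e) = h powr (real ?n * e) / ?c powr (real ?n * e)"
        by (rule powr_divide)
      moreover have "?c powr (real ?n * (- e)) = 1 / ?c powr (real ?n * e)"
        using powr_minus_divide[of ?c "real ?n * e"] by (simp only: mult_minus_right)
      ultimately show ?thesis by simp
    qed
    also have "\<dots> \<le> ?c powr (real ?n * 1) * h powr (real ?n * e)"
      using c e by (intro mult_right_mono powr_mono mult_left_mono) auto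
    also have "?c powr (real ?n * 1) = ?c ^ ?n" using c by (simp add: powr_realpow)
    finally show ?thesis .
  qed
qed

text \<open>The reference inequality at order j is framed by the two pullbacks. The volume factors
  combine to the exponent 1/p - 1/q and the powers of h to h^(r-j) with r = \<open>min j m\<close>.
  The parameter \<kappa> is 1 in the general case and k^2 for tensor product polynomials.\<close>

lemma local_inverse_estimate:
  assumes v: "v \<in> sobolev_space l \<infinity> open_cube" and w: "AE y in lebesgue_on (interior T). v (elem_map B b y) = w y"
    and pq: "1 \<le> p" "1 \<le> q" and ml: "m \<le> l" and h1: "h \<le> 1" and \<kappa>: "1 \<le> \<kappa>" and M: "0 \<le> M"
    and ref: "\<And>j. j \<le> l \<Longrightarrow> sobolev_seminorm j p open_cube v \<le>
      M * \<kappa> ^ (j - min j m) * sobolev_seminorm (min j m) q open_cube v"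
  shows "sobolev_norm l p (interior T) w \<le> mesh_const l \<sigma> CARD('n) * M * (\<kappa> / h) ^ (l - m)
    * h powr (real CARD('n) * (rinv p - rinv q)) * sobolev_norm m q (interior T) w"
proof -
  let ?V = "interior T" and ?n = "real CARD('n)" and ?D = "dilation_factor A a"
  let ?e = "rinv p - rinv q"
  have D: "0 < ?D" by (rule dilation_factor(1)[OF A])
  have w': "AE x in lebesgue_on open_cube. w (elem_map A a x) = v x"
    using affine_iso.AE_pullback[OF swap w] by (simp add: GF eq_commute)
  have wS: "w \<in> sobolev_space l \<infinity> ?V"
    by (rule sobolev_seminorm_pullback(1)[OF v w B_bound pq(1)])
  let ?c1 = "?n\<^sup>2 * (4 * \<sigma> / h)" and ?N = "sobolev_norm m q ?V w"
  have N: "0 \<le> ?N" by (rule sobolev_norm_nonneg[OF pq(2)])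
  have e: "\<bar>?e\<bar> \<le> 1" using rinv_bounds[OF pq(1)] rinv_bounds[OF pq(2)] by linarith
  have \<kappa>h: "1 \<le> \<kappa> / h" using \<kappa> h1 h_pos by simp
  have c4: "1 \<le> 4 * \<sigma> * ?n\<^sup>2" "1 \<le> ?n\<^sup>2"
    using \<sigma> one_le_power[OF d_ge_1, of 2] mult_mono[of 1 "4 * \<sigma>" 1 "?n\<^sup>2"] by auto
  let ?K = "(4 * \<sigma> * ?n\<^sup>2) ^ l * (?n\<^sup>2) ^ l * ?n ^ l * M * (\<kappa> / h) ^ (l - m) * ?D powr ?e * ?N"
  have "sobolev_seminorm j p ?V w \<le> ?K" if j: "j \<le> l" for j
  proof -
    define r where "r = min j m"
    \<comment> \<open>The difference j - r is 0 or j - m, so \<kappa> / h \<ge> 1 allows the common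
      exponent l - m.\<close>
    have r: "r \<le> j" "r \<le> m" "r \<le> l" "j - r \<le> l - m" using ml j by (auto simp: r_def)
    have "sobolev_seminorm j p ?V w \<le> ?D powr rinv p * ?c1 ^ j * sobolev_seminorm j p open_cube v"
      by (rule sobolev_seminorm_pullback(2)[OF v w B_bound pq(1) j])
    also have "\<dots> \<le> ?D powr rinv p * ?c1 ^ j * (M * \<kappa> ^ (j - r) * sobolev_seminorm r q open_cube v)"
      using ref[OF j] \<sigma> h_pos by (intro mult_left_mono) (auto simp: r_def)
    also have "\<dots> \<le> ?D powr rinv p * ?c1 ^ j * (M * \<kappa> ^ (j - r) *
        ((1 / ?D) powr rinv q * (?n\<^sup>2 * h) ^ r * sobolev_seminorm r q ?V w))"
      using affine_iso.sobolev_seminorm_pullback(2)[OF swap wS w' A_bound pq(2) r(3)] \<sigma> h_pos M \<kappa>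
      by (intro mult_left_mono) (auto simp: dilation_factor_bounds(3))
    also have "\<dots> = (?D powr rinv p * (1 / ?D) powr rinv q) * (4 * \<sigma> * ?n\<^sup>2) ^ j * (?n\<^sup>2) ^ r * M
        * (\<kappa> ^ (j - r) * (h ^ r / h ^ j)) * sobolev_seminorm r q ?V w"
      by (simp add: power_mult_distrib power_divide mult_ac)
    also have "h ^ r / h ^ j = 1 / h ^ (j - r)" using r(1) h_pos by (simp add: power_diff)
    also have "?D powr rinv p * (1 / ?D) powr rinv q = ?D powr ?e" using D by (simp add: powr_divide powr_diff)
    also have "?D powr ?e * (4 * \<sigma> * ?n\<^sup>2) ^ j * (?n\<^sup>2) ^ r * M * (\<kappa> ^ (j - r) * (1 / h ^ (j - r))) * sobolev_seminorm r q ?V w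
        \<le> ?D powr ?e * (4 * \<sigma> * ?n\<^sup>2) ^ l * (?n\<^sup>2) ^ l * M * (\<kappa> / h) ^ (l - m) * (?n ^ l * ?N)"
    proof (intro mult_mono order_refl)
      show "\<kappa> ^ (j - r) * (1 / h ^ (j - r)) \<le> (\<kappa> / h) ^ (l - m)"
        using power_increasing[OF r(4) \<kappa>h] by (simp add: power_divide)
      have "sobolev_seminorm r q ?V w \<le> ?n ^ r * ?N" by (rule sobolev_seminorm_le_norm[OF pq(2) r(2)])
      also have "\<dots> \<le> ?n ^ l * ?N" using d_ge_1 r(3) N by (intro mult_right_mono power_increasing) auto
      finally show "sobolev_seminorm r q ?V w \<le> ?n ^ l * ?N" .
      show "(4 * \<sigma> * ?n\<^sup>2) ^ j \<le> (4 * \<sigma> * ?n\<^sup>2) ^ l" by (rule power_increasing[OF j c4(1)])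
      show "(?n\<^sup>2) ^ r \<le> (?n\<^sup>2) ^ l" by (rule power_increasing[OF r(3) c4(2)])
    qed (use M \<kappa> h_pos \<sigma> N in \<open>auto intro!: mult_nonneg_nonneg sobolev_seminorm_nonneg\<close>)
    finally show ?thesis by (simp only: mult_ac)
  qed
  then have "(\<Sum>j\<le>l. sobolev_seminorm j p ?V w) \<le> (\<Sum>j\<le>l. ?K)" by (intro sum_mono) auto
  also have "(\<Sum>j\<le>l. ?K) = (real l + 1) * ?K" by simp
  finally have "sobolev_norm l p ?V w \<le> (real l + 1) * ?K"
    using sobolev_norm_le_seminorms[OF pq(1), of l ?V w] by linarith
  also have "\<dots> = (real l + 1) * (4 * \<sigma> * ?n\<^sup>2) ^ l * (?n\<^sup>2) ^ l * ?n ^ l * M * (\<kappa> / h) ^ (l - m) * ?N * ?D powr ?e"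
    by (simp only: mult_ac)
  also have "\<dots> \<le> (real l + 1) * (4 * \<sigma> * ?n\<^sup>2) ^ l * (?n\<^sup>2) ^ l * ?n ^ l * M * (\<kappa> / h) ^ (l - m) * ?N *
      ((4 * \<sigma> * ?n) ^ CARD('n) * h powr (?n * ?e))"
    using M \<kappa> h_pos \<sigma> N by (intro mult_left_mono dilation_factor_powr[OF e]) (auto intro!: mult_nonneg_nonneg)
  also have "\<dots> = mesh_const l \<sigma> CARD('n) * M * (\<kappa> / h) ^ (l - m) * h powr (?n * ?e) * ?N"
    unfolding mesh_const_def by (simp only: mult_ac)
  finally show ?thesis .
qed

end

section \<open>Quasiuniform families\<close>

lemma quasiuniform_family_mesh:
  assumes fam: "quasiuniform_affine_family \<Omega> \<T> J b \<sigma>0 Cqu" and \<Omega>: "polyhedral_lipschitz_domain \<Omega>" and h: "h \<in> {0<..1}"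
  shows "finite (\<T> h)" "\<T> h \<noteq> {}" "0 < Cqu"
    and "T \<in> \<T> h \<Longrightarrow> mesh_element (J h T) (b h T) T (max 1 \<sigma>0)"
    and "T \<in> \<T> h \<Longrightarrow> diameter T \<le> h" "T \<in> \<T> h \<Longrightarrow> Cqu * h \<le> diameter T"
proof -
  have part: "affine_partition \<Omega> h (\<T> h) (J h) (b h)" and qu: "quasiuniform \<T> \<sigma>0 Cqu"
    using fam h by (auto simp: quasiuniform_affine_family_def)
  show fin: "finite (\<T> h)" using part by (simp add: affine_partition_def)
  have "\<Omega> \<noteq> {}" using \<Omega> by (simp add: polyhedral_lipschitz_domain_def)
  then have "\<Union>(\<T> h) \<noteq> {}" using part by (auto simp: affine_partition_def)
  then show "\<T> h \<noteq> {}" by blast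
  show "0 < Cqu" using qu by (simp add: quasiuniform_def)
  assume T: "T \<in> \<T> h"
  show "diameter T \<le> h" using part Max_ge[of "diameter ` \<T> h" "diameter T"] T fin by (simp add: affine_partition_def)
  show "Cqu * h \<le> diameter T" using qu h T by (simp add: quasiuniform_def)
  have "diameter T / inball_diameter T \<le> \<sigma>0" using qu h T by (simp add: quasiuniform_def locally_quasiuniform_def)
  then show "mesh_element (J h T) (b h T) T (max 1 \<sigma>0)"
    using part T by unfold_locales (auto simp: affine_partition_def)
qed

lemma card_mesh_le:
  fixes \<Omega> :: "(real^'n::finite) set"
  assumes fam: "quasiuniform_affine_family \<Omega> \<T> J b \<sigma>0 Cqu" and \<Omega>: "polyhedral_lipschitz_domain \<Omega>" and h: "h \<in> {0<..1}"
  shows "real (card (\<T> h)) * (Cqu * h / (2 * max 1 \<sigma>0 * real CARD('n))) ^ CARD('n) \<le> measure lebesgue (closure \<Omega>)"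
proof -
  note mesh = quasiuniform_family_mesh[OF fam \<Omega> h]
  have part: "affine_partition \<Omega> h (\<T> h) (J h) (b h)" using fam h by (auto simp: quasiuniform_affine_family_def)
  let ?c = "(Cqu * h / (2 * max 1 \<sigma>0 * real CARD('n))) ^ CARD('n)"
  have "real (card (\<T> h)) * ?c = (\<Sum>T\<in>\<T> h. ?c)" by simp
  also have "\<dots> \<le> (\<Sum>T\<in>\<T> h. measure lebesgue (interior T))"
  proof (rule sum_mono)
    fix T assume T: "T \<in> \<T> h"
    have "?c \<le> (diameter T / (2 * max 1 \<sigma>0 * real CARD('n))) ^ CARD('n)"
      using mesh(3) mesh(6)[OF T] h by (intro power_mono divide_right_mono) auto
    also have "\<dots> \<le> measure lebesgue (interior T)" by (rule mesh_element.measure_interior_T_ge[OF mesh(4)[OF T]])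
    finally show "?c \<le> measure lebesgue (interior T)" .
  qed
  also have "\<dots> = measure lebesgue (\<Union>T\<in>\<T> h. interior T)"
  proof (rule measure_finite_Union[OF mesh(1), symmetric])
    show "interior ` \<T> h \<subseteq> sets lebesgue" by auto
    show "disjoint_family_on interior (\<T> h)" using part by (auto simp: disjoint_family_on_def affine_partition_def)
    show "emeasure lebesgue (interior T) \<noteq> \<infinity>" if "T \<in> \<T> h" for T
    proof -
      have "bounded (interior T)"
        using mesh_element.compact_T[OF mesh(4)[OF that]] compact_imp_bounded bounded_interior by blast
      then show ?thesis using emeasure_bounded_finite by fastforce
    qed
  qed
  also have "\<dots> \<le> measure lebesgue (closure \<Omega>)"
  proof (rule measure_mono_fmeasurable)
    show "(\<Union>T\<in>\<T> h. interior T) \<subseteq> closure \<Omega>"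
      using part interior_subset by (fastforce simp: affine_partition_def)
    show "(\<Union>T\<in>\<T> h. interior T) \<in> sets lebesgue" by (intro sets.finite_UN mesh(1)) auto
    show "closure \<Omega> \<in> lmeasurable"
      using \<Omega> by (intro bounded_set_imp_lmeasurable) (auto simp: polyhedral_lipschitz_domain_def)
  qed
  finally show ?thesis .
qed

lemma Wh_local:
  assumes mesh: "mesh_element (J T) (c T) T \<sigma>" and v: "v \<in> Wh \<Omega> P \<T> J c" and T_in: "T \<in> \<T>"
  obtains u where "u \<in> P"
    "AE y in lebesgue_on (interior T). u (elem_map (mesh_element.B (J T)) (mesh_element.b (J T) (c T)) y) = v y"
proof -
  interpret mesh_element "J T" "c T" T \<sigma> by fact
  obtain u' where u': "u' \<in> local_space P (J T) (c T)" "AE x in lebesgue_on T. v x = u' x"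
    using v T_in unfolding Wh_def by blast
  then obtain u where u: "u \<in> P" "u' = u \<circ> inv (elem_map (J T) (c T))" by (auto simp: local_space_def)
  have Tm: "T \<in> sets lebesgue" using compact_T by (simp add: borel_compact)
  then have ae: "AE x in lebesgue. x \<in> T \<longrightarrow> v x = u' x" using u'(2) by (subst (asm) AE_restrict_space_iff) auto
  have "AE y in lebesgue. y \<in> interior T \<longrightarrow> u (elem_map B b y) = v y"
    using ae by (rule eventually_mono) (use interior_subset in \<open>auto simp: u(2) inverse_maps(4)\<close>)
  then have "AE y in lebesgue_on (interior T). u (elem_map B b y) = v y"
    by (subst AE_restrict_space_iff) auto
  with u(1) show thesis by (rule that)
qed


section \<open>Summation over the elements of a mesh\<close>

lemma rinv_antimono: "1 \<le> q \<Longrightarrow> q \<le> p \<Longrightarrow> rinv p \<le> rinv q"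
  by (cases p; cases q) (auto simp: frac_le)

text \<open>The bound \<open>X\<close> for powers of the diameters stays abstract, because the sign
  of 1/p - 1/q decides whether the smallest or the largest diameter matters. The right-hand side
  still sums with exponent p; the passage to q differs between the applications.\<close>

lemma broken_inverse_estimate:
  fixes \<Omega> :: "(real^'n::finite) set"
  assumes fam: "quasiuniform_affine_family \<Omega> \<T> J b \<sigma>0 Cqu" and \<Omega>: "polyhedral_lipschitz_domain \<Omega>" and h: "h \<in> {0<..1}"
    and P: "P \<subseteq> sobolev_space l \<infinity> open_cube" and w: "w \<in> Wh \<Omega> P (\<T> h) (J h) (b h)"
    and pq: "1 \<le> p" "1 \<le> q" and ml: "m \<le> l" and \<kappa>: "1 \<le> \<kappa>" and M: "0 \<le> M"
    and ref: "\<And>v j. v \<in> P \<Longrightarrow> j \<le> l \<Longrightarrow> sobolev_seminorm j p open_cube v \<le>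
      M * \<kappa> ^ (j - min j m) * sobolev_seminorm (min j m) q open_cube v"
    and X: "\<And>t. Cqu * h \<le> t \<Longrightarrow> t \<le> h \<Longrightarrow> t powr (real CARD('n) * (rinv p - rinv q)) \<le> X"
  shows "broken_norm l p (\<T> h) w \<le> mesh_const l (max 1 \<sigma>0) CARD('n) * M * (Cqu * h / \<kappa>) powr (real m - real l)
    * X * lp_sum p (\<T> h) (\<lambda>T. sobolev_norm m q (interior T) w)"
proof -
  note mesh = quasiuniform_family_mesh[OF fam \<Omega> h]
  let ?C = "mesh_const l (max 1 \<sigma>0) CARD('n) * M"
  let ?E = "real CARD('n) * (rinv p - rinv q)"
  have mc: "0 \<le> mesh_const l (max 1 \<sigma>0) CARD('n)" using mesh_const_pos[of "max 1 \<sigma>0" "CARD('n)" l] by simp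
  then have C: "0 \<le> ?C" using M by simp
  have Ch: "0 < Cqu * h" using mesh(3) h by simp
  \<comment> \<open>Any element has a diameter in the range where \<open>X\<close> is an upper
    bound, so \<open>X\<close> is nonnegative.\<close>
  obtain T0 where T0: "T0 \<in> \<T> h" using mesh(2) by blast
  have "0 \<le> diameter T0 powr ?E" by simp
  also have "\<dots> \<le> X" by (rule X[OF mesh(6)[OF T0] mesh(5)[OF T0]])
  finally have X0: "0 \<le> X" .
  have loc: "sobolev_norm l p (interior T) w \<le> ?C * (Cqu * h / \<kappa>) powr (real m - real l) * X * sobolev_norm m q (interior T) w"
    if T: "T \<in> \<T> h" for T
  proof -
    note me = mesh(4)[OF T]
    have ht: "0 < diameter T" "diameter T \<le> 1" using mesh_element.h_pos[OF me] mesh(5)[OF T] h by auto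
    obtain u where u: "u \<in> P" "AE y in lebesgue_on (interior T).
        u (elem_map (mesh_element.B (J h T)) (mesh_element.b (J h T) (b h T)) y) = w y"
      using Wh_local[OF me w T] by blast
    have "sobolev_norm l p (interior T) w \<le> ?C * (\<kappa> / diameter T) ^ (l - m) * diameter T powr ?E * sobolev_norm m q (interior T) w"
      by (rule mesh_element.local_inverse_estimate[OF me P[THEN subsetD, OF u(1)] u(2) pq ml ht(2) \<kappa> M ref[OF u(1)]])
    also have "\<dots> \<le> ?C * (Cqu * h / \<kappa>) powr (real m - real l) * X * sobolev_norm m q (interior T) w"
    proof (intro mult_mono order_refl)
      have "(\<kappa> / diameter T) ^ (l - m) \<le> (\<kappa> / (Cqu * h)) ^ (l - m)"
        using mesh(6)[OF T] \<kappa> ht Ch by (intro power_mono divide_left_mono) auto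
      also have "\<dots> = (\<kappa> / (Cqu * h)) powr (real l - real m)"
        using \<kappa> Ch ml by (simp add: powr_realpow[symmetric] of_nat_diff)
      also have "\<dots> = (Cqu * h / \<kappa>) powr (real m - real l)"
        using powr_minus_divide[of "Cqu * h / \<kappa>" "real l - real m"] \<kappa> Ch powr_divide[of 1 "Cqu * h / \<kappa>" "real l - real m"] by simp
      finally show "(\<kappa> / diameter T) ^ (l - m) \<le> (Cqu * h / \<kappa>) powr (real m - real l)" .
      show "diameter T powr ?E \<le> X" by (rule X[OF mesh(6)[OF T] mesh(5)[OF T]])
    qed (use mc M C X0 \<kappa> ht sobolev_norm_nonneg[OF pq(2)] in \<open>auto intro!: mult_nonneg_nonneg\<close>)
    finally show ?thesis .
  qed
  show ?thesis
    unfolding broken_norm_def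
    using loc C X0 sobolev_norm_nonneg[OF pq(1)] sobolev_norm_nonneg[OF pq(2)]
    by (intro lp_sum_le_scale mesh(1,2) pq) (auto intro!: mult_nonneg_nonneg)
qed

lemma inverse_estimate:
  fixes \<Omega> :: "(real^'n::finite) set" and l m :: nat
  assumes ml: "m \<le> l" and pq: "1 \<le> p" "1 \<le> q" and \<Omega>: "polyhedral_lipschitz_domain \<Omega>"
    and P: "P \<subseteq> sobolev_space l \<infinity> open_cube" "finite B0" "P = fun_space.span B0" and Cqu: "0 < Cqu"
  shows "\<exists>C>0. \<forall>\<T> J b. quasiuniform_affine_family \<Omega> \<T> J b \<sigma>0 Cqu \<longrightarrow>
           (\<forall>h\<in>{0<..1}. \<forall>v \<in> Wh \<Omega> P (\<T> h) (J h) (b h).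
              broken_norm l p (\<T> h) v \<le>
                C * h powr (real m - real l + min 0 (real CARD('n) * (rinv p - rinv q)))
                  * broken_norm m q (\<T> h) v)"
proof -
  let ?n = "real CARD('n)" and ?e = "rinv p - rinv q" and ?\<sigma> = "max 1 \<sigma>0"
  obtain M where M: "0 \<le> M" "\<And>v j. v \<in> P \<Longrightarrow> j \<le> l \<Longrightarrow>
      sobolev_seminorm j p open_cube v \<le> M * sobolev_seminorm (min j m) q open_cube v"
    using sobolev_seminorm_equiv[OF open_open_cube open_cube_lmeasurable P(2,3,1) pq, of m] by blast
  define K where "K = mesh_const l ?\<sigma> CARD('n) * M * Cqu powr (real m - real l)"
  \<comment> \<open>The part of the bound for the number of elements that is free of h, raised to
    the Hoelder exponent; the dependence on the domain enters here.\<close>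
  define N where "N = (measure lebesgue (closure \<Omega>) * (2 * ?\<sigma> * ?n / Cqu) ^ CARD('n)) powr ?e"
  \<comment> \<open>The first term serves q \<le> p, the second p < q; the 1 ensures
    positivity.\<close>
  define C where "C = K * Cqu powr (?n * ?e) + K * N + 1"
  have K: "0 \<le> K" unfolding K_def using M mesh_const_pos[of ?\<sigma> "CARD('n)" l] by (intro mult_nonneg_nonneg) auto
  have N: "0 \<le> N" by (simp add: N_def)
  have Cge: "K * Cqu powr (?n * ?e) \<le> C" "K * N \<le> C" "0 < C"
  proof -
    have "0 \<le> K * N" "0 \<le> K * Cqu powr (?n * ?e)" using K N by auto
    then show "K * Cqu powr (?n * ?e) \<le> C" "K * N \<le> C" "0 < C" unfolding C_def by linarith+
  qed
  show ?thesis
  proof (intro exI[of _ C] conjI allI impI ballI)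
    show "0 < C" by (rule Cge)
    fix \<T> J b h v
    assume fam: "quasiuniform_affine_family \<Omega> \<T> J b \<sigma>0 Cqu" and h: "h \<in> {0<..1}" and v: "v \<in> Wh \<Omega> P (\<T> h) (J h) (b h)"
    note mesh = quasiuniform_family_mesh[OF fam \<Omega> h]
    let ?b = "\<lambda>T. sobolev_norm m q (interior T) v"
    have Ch: "0 < Cqu * h" and h0: "0 < h" using Cqu h by auto
    have b0: "0 \<le> ?b T" for T by (rule sobolev_norm_nonneg[OF pq(2)])
    have lp0: "0 \<le> lp_sum s (\<T> h) ?b" if "1 \<le> s" for s by (intro lp_sum_nonneg mesh(1,2) b0 that)
    have est: "broken_norm l p (\<T> h) v \<le> K * h powr (real m - real l) * X * lp_sum p (\<T> h) ?b"
      if X: "\<And>t. Cqu * h \<le> t \<Longrightarrow> t \<le> h \<Longrightarrow> t powr (?n * ?e) \<le> X" for X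
    proof -
      have "broken_norm l p (\<T> h) v \<le> mesh_const l ?\<sigma> CARD('n) * M * (Cqu * h / 1) powr (real m - real l) * X * lp_sum p (\<T> h) ?b"
        by (rule broken_inverse_estimate[OF fam \<Omega> h P(1) v pq ml order_refl M(1)]) (use M(2) X in auto)
      then show ?thesis using Cqu h0 by (simp add: K_def powr_mult mult_ac)
    qed
    have "broken_norm l p (\<T> h) v \<le> (C * h powr (real m - real l + min 0 (?n * ?e))) * lp_sum q (\<T> h) ?b"
    proof (cases "q \<le> p")
      case True
      then have e: "?n * ?e \<le> 0" using rinv_antimono[OF pq(2)] by (simp add: mult_nonneg_nonpos)
      have "broken_norm l p (\<T> h) v \<le> K * h powr (real m - real l) * (Cqu * h) powr (?n * ?e) * lp_sum p (\<T> h) ?b"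
        by (rule est) (use e Ch in \<open>auto intro: powr_mono2'\<close>)
      also have "\<dots> = (K * Cqu powr (?n * ?e)) * h powr (real m - real l + min 0 (?n * ?e)) * lp_sum p (\<T> h) ?b"
        using e Cqu h0 by (simp add: powr_mult powr_add min_absorb2 mult_ac)
      also have "\<dots> \<le> C * h powr (real m - real l + min 0 (?n * ?e)) * lp_sum q (\<T> h) ?b"
        using Cge lp0[OF pq(1)] by (intro mult_mono lp_sum_mono_exponent mesh(1,2) b0 pq True) auto
      finally show ?thesis .
    next
      case False
      then have pq': "p \<le> q" by simp
      have e: "0 \<le> ?e" using rinv_antimono[OF pq(1) pq'] by simp
      have "real (card (\<T> h)) * (Cqu * h / (2 * ?\<sigma> * ?n)) ^ CARD('n) \<le> measure lebesgue (closure \<Omega>)"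
        by (rule card_mesh_le[OF fam \<Omega> h])
      then have "real (card (\<T> h)) \<le> measure lebesgue (closure \<Omega>) / (Cqu * h / (2 * ?\<sigma> * ?n)) ^ CARD('n)"
        using Ch by (subst pos_le_divide_eq) auto
      also have "\<dots> = (measure lebesgue (closure \<Omega>) * (2 * ?\<sigma> * ?n / Cqu) ^ CARD('n)) * (1 / h) ^ CARD('n)"
        using h0 Cqu by (simp add: power_divide power_mult_distrib)
      finally have "real (card (\<T> h)) powr ?e \<le>
          ((measure lebesgue (closure \<Omega>) * (2 * ?\<sigma> * ?n / Cqu) ^ CARD('n)) * (1 / h) ^ CARD('n)) powr ?e"
        using e by (intro powr_mono2) auto
      also have "\<dots> = N * ((1 / h) ^ CARD('n)) powr ?e"
        unfolding N_def by (rule powr_mult)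
      also have "((1 / h) ^ CARD('n)) powr ?e = (1 / h) powr (?n * ?e)"
        using h0 by (simp add: powr_realpow[symmetric] powr_powr)
      also have "(1 / h) powr (?n * ?e) = 1 / h powr (?n * ?e)" using h0 by (simp add: powr_divide)
      finally have card: "real (card (\<T> h)) powr ?e \<le> N * (1 / h powr (?n * ?e))" .
      have "broken_norm l p (\<T> h) v \<le> K * h powr (real m - real l) * h powr (?n * ?e) * lp_sum p (\<T> h) ?b"
        by (rule est) (use e Ch in \<open>auto intro!: powr_mono2\<close>)
      also have "\<dots> \<le> K * h powr (real m - real l) * h powr (?n * ?e) * (real (card (\<T> h)) powr ?e * lp_sum q (\<T> h) ?b)"
        using K by (intro mult_left_mono lp_sum_holder mesh(1,2) b0 pq pq') auto
      also have "\<dots> \<le> K * h powr (real m - real l) * h powr (?n * ?e) * (N * (1 / h powr (?n * ?e)) * lp_sum q (\<T> h) ?b)"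
        using K lp0[OF pq(2)] by (intro mult_left_mono mult_right_mono card) auto
      \<comment> \<open>The gain h^(d(1/p - 1/q)) on the elements is used up by the number of
        elements, whence the minimum with 0 in the exponent.\<close>
      also have "\<dots> = (K * N) * h powr (real m - real l) * lp_sum q (\<T> h) ?b" using h0 by simp
      also have "\<dots> \<le> C * h powr (real m - real l + min 0 (?n * ?e)) * lp_sum q (\<T> h) ?b"
        using Cge lp0[OF pq(2)] e by (intro mult_right_mono mult_mono) (auto simp: min_absorb1)
      finally show ?thesis .
    qed
    then show "broken_norm l p (\<T> h) v \<le> C * h powr (real m - real l + min 0 (?n * ?e)) * broken_norm m q (\<T> h) v"
      by (simp add: broken_norm_def)
  qed
qed

text \<open>Here q \<le> p, so the sums over elements need no count and the constant involves
  neither the domain nor \<open>Cqu\<close>. The k-power from Nikolskii's inequality is moved next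
  to the mesh size by t^E = (k^2)^E (t / k^2)^E.\<close>

lemma inverse_estimate_Qk:
  fixes \<Omega> :: "(real^'n::finite) set" and l m :: nat
  assumes ml: "m \<le> l" and q: "1 \<le> q" "q \<le> p" and k: "1 \<le> k" and \<Omega>: "polyhedral_lipschitz_domain \<Omega>"
    and P: "Qk k ref_cube \<subseteq> sobolev_space l \<infinity> (open_cube :: (real^'n) set)"
    and fam: "quasiuniform_affine_family \<Omega> \<T> J b \<sigma>0 Cqu" and h: "h \<in> {0<..1}"
    and v: "v \<in> Wh \<Omega> (Qk k ref_cube) (\<T> h) (J h) (b h)"
  shows "broken_norm l p (\<T> h) v \<le>
    (mesh_const l (max 1 \<sigma>0) CARD('n) * ((4 * real CARD('n)) ^ l * 2 * (16 * (real CARD('n))\<^sup>2) ^ CARD('n)))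
      * (Cqu * h / (real k)\<^sup>2) powr (real m - real l)
      * (if p = q then 1 else (Cqu * h / (2 * (real_of_ereal q + 1) * (real k)\<^sup>2)) powr (real CARD('n) * (rinv p - rinv q)))
      * broken_norm m q (\<T> h) v"
proof -
  let ?n = "real CARD('n)" and ?e = "rinv p - rinv q" and ?\<sigma> = "max 1 \<sigma>0" and ?k = "(real k)\<^sup>2"
  let ?C0 = "(4 * ?n) ^ l * 2 * (16 * ?n\<^sup>2) ^ CARD('n)"
  let ?Y = "if p = q then 1 else (Cqu * h / (2 * (real_of_ereal q + 1) * ?k)) powr (?n * ?e)"
  let ?b = "\<lambda>T. sobolev_norm m q (interior T) v"
  note mesh = quasiuniform_family_mesh[OF fam \<Omega> h]
  have p: "1 \<le> p" using q by (rule order_trans)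
  have Ch: "0 < Cqu * h" and h0: "0 < h" using mesh(3) h by auto
  have k1: "1 \<le> ?k" using k by (simp add: one_le_power)
  have e: "?n * ?e \<le> 0" using rinv_antimono[OF q] by (simp add: mult_nonneg_nonpos)
  have b0: "0 \<le> ?b T" for T by (rule sobolev_norm_nonneg[OF q(1)])
  have Y: "(t / ?k) powr (?n * ?e) \<le> ?Y" if t: "Cqu * h \<le> t" for t
  proof (cases "p = q")
    case True
    then show ?thesis using t Ch k1 by simp
  next
    case False
    \<comment> \<open>For q < p the exponent q is finite, so \<open>real_of_ereal q\<close> is its
      true value; q = \<infinity> occurs only together with p = q.\<close>
    then obtain r where r: "q = ereal r" "1 \<le> r" using q by (cases q) auto
    have "Cqu * h / (2 * (r + 1) * ?k) \<le> t / ?k"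
    proof -
      have "Cqu * h / (2 * (r + 1) * ?k) \<le> Cqu * h / (1 * ?k)"
        using Ch k r by (intro divide_left_mono mult_right_mono) (auto intro!: mult_pos_pos)
      also have "\<dots> \<le> t / ?k" using t k1 by (simp add: divide_right_mono)
      finally show ?thesis .
    qed
    \<comment> \<open>The exponent is nonpositive, so decreasing the base by the factor 2 (q + 1)
      increases the power.\<close>
    then have "(t / ?k) powr (?n * ?e) \<le> (Cqu * h / (2 * (r + 1) * ?k)) powr (?n * ?e)"
      using e Ch k r by (intro powr_mono2') (auto intro!: divide_pos_pos mult_pos_pos)
    then show ?thesis using False r by simp
  qed
  let ?M = "?C0 * ?k powr (?n * (rinv q - rinv p))"
  have kk: "?k powr (?n * (rinv q - rinv p)) = 1 / ?k powr (?n * ?e)"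
    using powr_minus_divide[of ?k "?n * ?e"] by (simp add: algebra_simps)
  have "broken_norm l p (\<T> h) v \<le> mesh_const l ?\<sigma> CARD('n) * ?M * (Cqu * h / ?k) powr (real m - real l)
      * (?k powr (?n * ?e) * ?Y) * lp_sum p (\<T> h) ?b"
  proof (rule broken_inverse_estimate[OF fam \<Omega> h P v p q(1) ml k1])
    show "0 \<le> ?M" by simp
    show "sobolev_seminorm j p open_cube u \<le> ?M * ?k ^ (j - min j m) * sobolev_seminorm (min j m) q open_cube u"
      if "u \<in> Qk k ref_cube" "j \<le> l" for u :: "real^'n \<Rightarrow> real" and j
      using sobolev_seminorm_Qk[OF k that(1) q, of "min j m" j l] that(2) by (simp add: mult_ac)
    fix t assume t: "Cqu * h \<le> t"
    have "t powr (?n * ?e) = ?k powr (?n * ?e) * (t / ?k) powr (?n * ?e)"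
      using t Ch k by (simp add: powr_divide)
    then show "t powr (?n * ?e) \<le> ?k powr (?n * ?e) * ?Y" using Y[OF t] by (simp add: mult_left_mono)
  qed
  also have "\<dots> = (mesh_const l ?\<sigma> CARD('n) * ?C0) * (Cqu * h / ?k) powr (real m - real l) * ?Y * lp_sum p (\<T> h) ?b"
  proof -
    have "?k powr (?n * ?e) \<noteq> 0" using k by simp
    then show ?thesis unfolding kk by (simp add: mult_ac)
  qed
  also have "\<dots> \<le> (mesh_const l ?\<sigma> CARD('n) * ?C0) * (Cqu * h / ?k) powr (real m - real l) * ?Y * lp_sum q (\<T> h) ?b"
    using mesh_const_pos[of ?\<sigma> "CARD('n)" l]
    by (intro mult_left_mono lp_sum_mono_exponent mesh(1,2) b0 q) (auto intro!: mult_nonneg_nonneg)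
  finally show ?thesis by (simp add: broken_norm_def)
qed

theorem lemma19:
  fixes l m :: nat and \<sigma>0 :: real
  assumes "m \<le> l"
  shows
    "(\<forall>(p::ereal) (q::ereal) (\<Omega> :: (real^'n::finite) set) (P :: (real^'n \<Rightarrow> real) set) (Cqu::real).
        1 \<le> p \<and> 1 \<le> q \<and> polyhedral_lipschitz_domain \<Omega> \<longrightarrow>
        (\<exists>C>0. \<forall>S \<T> J b.
           finite_element ref_cube P S \<and> P \<subseteq> sobolev_space l \<infinity> (interior ref_cube) \<and>
           quasiuniform_affine_family \<Omega> \<T> J b \<sigma>0 Cqu \<longrightarrow>
           (\<forall>h\<in>{0<..1}. \<forall>v \<in> Wh \<Omega> P (\<T> h) (J h) (b h).
              broken_norm l p (\<T> h) v \<le>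
                C * h powr (real m - real l + min 0 (real CARD('n) * (rinv p - rinv q)))
                  * broken_norm m q (\<T> h) v)))
     \<and>
     (\<forall>p::ereal. 1 \<le> p \<longrightarrow>
        (\<exists>C>0. \<forall>(q::ereal) (k::nat) (\<Omega> :: (real^'n) set) (Cqu::real) P S \<T> J b.
           1 \<le> q \<and> q \<le> p \<and> 1 \<le> k \<and> polyhedral_lipschitz_domain \<Omega> \<and>
           finite_element ref_cube P S \<and> P \<subseteq> sobolev_space l \<infinity> (interior ref_cube) \<and>
           P = Qk k ref_cube \<and>
           quasiuniform_affine_family \<Omega> \<T> J b \<sigma>0 Cqu \<longrightarrow>
           (\<forall>h\<in>{0<..1}. \<forall>v \<in> Wh \<Omega> P (\<T> h) (J h) (b h).
              broken_norm l p (\<T> h) v \<le>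
                C * (Cqu * h / (real k)\<^sup>2) powr (real m - real l)
                  * (if p = q then 1
                     else (Cqu * h / (2 * (real_of_ereal q + 1) * (real k)\<^sup>2))
                            powr (real CARD('n) * (rinv p - rinv q)))
                  * broken_norm m q (\<T> h) v)))"
proof (intro conjI allI impI)
  fix p q :: ereal and \<Omega> :: "(real^'n) set" and P :: "(real^'n \<Rightarrow> real) set" and Cqu :: real
  assume asm: "1 \<le> p \<and> 1 \<le> q \<and> polyhedral_lipschitz_domain \<Omega>"
  show "\<exists>C>0. \<forall>S \<T> J b.
           finite_element ref_cube P S \<and> P \<subseteq> sobolev_space l \<infinity> (interior ref_cube) \<and>
           quasiuniform_affine_family \<Omega> \<T> J b \<sigma>0 Cqu \<longrightarrow>
           (\<forall>h\<in>{0<..1}. \<forall>v \<in> Wh \<Omega> P (\<T> h) (J h) (b h).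
              broken_norm l p (\<T> h) v \<le>
                C * h powr (real m - real l + min 0 (real CARD('n) * (rinv p - rinv q)))
                  * broken_norm m q (\<T> h) v)"
  \<comment> \<open>The constant is chosen before the element and the family are given. If P or
    \<open>Cqu\<close> admits neither, the claim is vacuous and any constant will do.\<close>
  proof (cases "(\<exists>B. finite B \<and> P = fun_space.span B) \<and> P \<subseteq> sobolev_space l \<infinity> open_cube \<and> 0 < Cqu")
    case True
    then obtain B where B: "finite B" "P = fun_space.span B" and P: "P \<subseteq> sobolev_space l \<infinity> open_cube" and Cqu: "0 < Cqu"
      by blast
    have pq: "1 \<le> p" "1 \<le> q" and \<Omega>: "polyhedral_lipschitz_domain \<Omega>" using asm by auto
    obtain C where C: "0 < C" and est: "\<And>\<T> J b h v. quasiuniform_affine_family \<Omega> \<T> J b \<sigma>0 Cqu \<Longrightarrow> h \<in> {0<..1} \<Longrightarrow>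
        v \<in> Wh \<Omega> P (\<T> h) (J h) (b h) \<Longrightarrow> broken_norm l p (\<T> h) v \<le>
          C * h powr (real m - real l + min 0 (real CARD('n) * (rinv p - rinv q))) * broken_norm m q (\<T> h) v"
      using inverse_estimate[OF assms pq \<Omega> P B Cqu, of \<sigma>0] by (elim exE conjE) blast
    show ?thesis
      by (intro exI[of _ C] conjI C allI impI ballI) (elim conjE, rule est)
  next
    case False
    have no: "\<not> (finite_element ref_cube P S \<and> P \<subseteq> sobolev_space l \<infinity> (interior ref_cube) \<and>
           quasiuniform_affine_family \<Omega> \<T> J b \<sigma>0 Cqu)" for S \<T> J b
      using False by (simp only: interior_ref_cube finite_element_def quasiuniform_affine_family_def quasiuniform_def) blast
    show ?thesis
      using no by (intro exI[of _ 1] conjI zero_less_one allI impI) (rule notE)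
  qed
next
  fix p :: ereal assume "1 \<le> p"
  \<comment> \<open>An expression in l, \<sigma>0 and the dimension alone, hence uniform in q, k,
    the domain and \<open>Cqu\<close>.\<close>
  define C where "C = mesh_const l (max 1 \<sigma>0) CARD('n) *
    ((4 * real CARD('n)) ^ l * 2 * (16 * (real CARD('n))\<^sup>2) ^ CARD('n))"
  have "0 < C" unfolding C_def using mesh_const_pos[of "max 1 \<sigma>0" "CARD('n)" l] by simp
  then show "\<exists>C>0. \<forall>(q::ereal) (k::nat) (\<Omega> :: (real^'n) set) (Cqu::real) P S \<T> J b.
           1 \<le> q \<and> q \<le> p \<and> 1 \<le> k \<and> polyhedral_lipschitz_domain \<Omega> \<and>
           finite_element ref_cube P S \<and> P \<subseteq> sobolev_space l \<infinity> (interior ref_cube) \<and>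
           P = Qk k ref_cube \<and>
           quasiuniform_affine_family \<Omega> \<T> J b \<sigma>0 Cqu \<longrightarrow>
           (\<forall>h\<in>{0<..1}. \<forall>v \<in> Wh \<Omega> P (\<T> h) (J h) (b h).
              broken_norm l p (\<T> h) v \<le>
                C * (Cqu * h / (real k)\<^sup>2) powr (real m - real l)
                  * (if p = q then 1
                     else (Cqu * h / (2 * (real_of_ereal q + 1) * (real k)\<^sup>2))
                            powr (real CARD('n) * (rinv p - rinv q)))
                  * broken_norm m q (\<T> h) v)"
  proof (intro exI[of _ C] conjI allI impI ballI)
    fix q :: ereal and k :: nat and \<Omega> :: "(real^'n) set" and Cqu :: real and P S \<T> J b h v
    assume *: "1 \<le> q \<and> q \<le> p \<and> 1 \<le> k \<and> polyhedral_lipschitz_domain \<Omega> \<and>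
           finite_element ref_cube P S \<and> P \<subseteq> sobolev_space l \<infinity> (interior ref_cube) \<and>
           P = Qk k ref_cube \<and> quasiuniform_affine_family \<Omega> \<T> J b \<sigma>0 Cqu"
      and h: "h \<in> {0<..1}" and v: "v \<in> Wh \<Omega> P (\<T> h) (J h) (b h)"
    have P: "P = Qk k ref_cube" and q: "1 \<le> q" "q \<le> p" and k: "1 \<le> k" and \<Omega>: "polyhedral_lipschitz_domain \<Omega>"
      and sub: "P \<subseteq> sobolev_space l \<infinity> open_cube" and fam: "quasiuniform_affine_family \<Omega> \<T> J b \<sigma>0 Cqu"
      using * unfolding interior_ref_cube by auto
    show "broken_norm l p (\<T> h) v \<le>
                C * (Cqu * h / (real k)\<^sup>2) powr (real m - real l)
                  * (if p = q then 1
                     else (Cqu * h / (2 * (real_of_ereal q + 1) * (real k)\<^sup>2))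
                            powr (real CARD('n) * (rinv p - rinv q)))
                  * broken_norm m q (\<T> h) v"
      unfolding C_def by (rule inverse_estimate_Qk[OF assms q k \<Omega> sub[unfolded P] fam h v[unfolded P]])
  qed
qed

end
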